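(* Let $\alpha_1,\alpha_2$ be algebraic numbers and let $d:=[\mathbb{Q}(\alpha_1,\alpha_2):\mathbb{Q}]$. Suppose that $(\alpha_1,\alpha_2)$ and all of its conjugates lie on an irreducible (plane) curve of degree $m$ defined over $\mathbb{C}$. Then for all $\delta\in\mathbb{Q}$ with $\delta>\max\{m,d/m\}$ there exists an effectively computable constant $C_0(\alpha_1,\alpha_2,\delta,m)$, depending only on $(\alpha_1,\alpha_2)$, $m$ and $\delta$, such that for all pairs of rational numbers $(p_1/q,p_2/q)$ satisfying $$\left|\alpha_i-\frac{p_i}{q}\right|\leq q^{-\delta}\quad\text{for } i=1,2$$ we have $q\leq C_0(\alpha_1,\alpha_2,\delta,m)$.
   Context: The conjugates of $(\alpha_1,\alpha_2)$ are the $d$ points $(\sigma(\alpha_1),\sigma(\alpha_2))\in\mathbb{C}^2$, where $\sigma$ runs over the field embeddings $\mathbb{Q}(\alpha_1,\alpha_2)\to\mathbb{C}$. Points of $\mathbb{A}^2$ are viewed in $\mathbb{P}^2$ in the standard way; the curve is a plane curve over $\mathbb{C}$ and is not required to be defined over $\mathbb{Q}$. In $(p_1/q,p_2/q)$, $p_1,p_2$ are integers and $q$ is a positive integer.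
   Formalization: When (p1/q, p2/q) equals (α1, α2), which is possible only for d = 1, the fractions are required to satisfy gcd(p1, p2, q) = 1; without this the claim fails, e.g. α1 = α2 = 0 with p1 = p2 = 0 and q arbitrary. *)

theory Defs
  imports
    "HOL-Analysis.Analysis"
    "HOL-Computational_Algebra.Polynomial_Factorial"
    "HOL-Library.Nat_Bijection"
begin

section \<open>The field generated by a pair of numbers, and its embeddings\<close>

definition subfield_of_complex :: "complex set \<Rightarrow> bool" where
  "subfield_of_complex K \<longleftrightarrow>
     1 \<in> K \<and>
     (\<forall>x\<in>K. \<forall>y\<in>K. x - y \<in> K \<and> x * y \<in> K) \<and>
     (\<forall>x\<in>K. inverse x \<in> K)"

definition rat_adjoin :: "complex \<Rightarrow> complex \<Rightarrow> complex set" where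
  "rat_adjoin \<alpha>1 \<alpha>2 = subfield_of_complex hull {\<alpha>1, \<alpha>2}"

global_interpretation rat_vs: vector_space "\<lambda>(r::rat) (z::complex). of_rat r * z"
  by standard (auto simp: algebra_simps of_rat_add of_rat_mult)

text \<open>
  The library dimension of an infinite-dimensional space is \<open>0\<close>; for algebraic \<open>\<alpha>1, \<alpha>2\<close> the
  space is finite-dimensional and this is the usual degree.
\<close>
definition rat_adjoin_degree :: "complex \<Rightarrow> complex \<Rightarrow> nat" where
  "rat_adjoin_degree \<alpha>1 \<alpha>2 = rat_vs.dim (rat_adjoin \<alpha>1 \<alpha>2)"

text \<open>Only the values of \<open>\<sigma>\<close> on \<open>K\<close> are constrained.\<close>
definition field_embedding :: "complex set \<Rightarrow> (complex \<Rightarrow> complex) \<Rightarrow> bool" where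
  "field_embedding K \<sigma> \<longleftrightarrow>
     \<sigma> 1 = 1 \<and> (\<forall>x\<in>K. \<forall>y\<in>K. \<sigma> (x + y) = \<sigma> x + \<sigma> y \<and> \<sigma> (x * y) = \<sigma> x * \<sigma> y)"

definition conjugate_points :: "complex \<Rightarrow> complex \<Rightarrow> (complex \<times> complex) set" where
  "conjugate_points \<alpha>1 \<alpha>2 = {(\<sigma> \<alpha>1, \<sigma> \<alpha>2) | \<sigma>. field_embedding (rat_adjoin \<alpha>1 \<alpha>2) \<sigma>}"


section \<open>Irreducible curves in the complex projective plane\<close>

text \<open>
  A polynomial in \<open>x, y, z\<close> is an element of \<open>((\<complex>[x])[y])[z]\<close>: the coefficient of
  \<open>x^i y^j z^k\<close> in \<open>F\<close> is \<open>coeff (coeff (coeff F k) j) i\<close>.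
\<close>
type_synonym poly3 = "complex poly poly poly"

definition poly3_eval :: "poly3 \<Rightarrow> complex \<Rightarrow> complex \<Rightarrow> complex \<Rightarrow> complex" where
  "poly3_eval F x y z = poly (poly (poly F [:[:z:]:]) [:y:]) x"

definition homogeneous3 :: "nat \<Rightarrow> poly3 \<Rightarrow> bool" where
  "homogeneous3 m F \<longleftrightarrow> (\<forall>i j k. coeff (coeff (coeff F k) j) i \<noteq> 0 \<longrightarrow> i + j + k = m)"

text \<open>
  Subsets of the projective plane are represented by the set of all homogeneous coordinate
  triples \<open>(x, y, z) \<noteq> 0\<close> of their points; the affine point \<open>(x, y)\<close> is \<open>(x : y : 1)\<close>.
\<close>
definition irreducible_plane_curve :: "nat \<Rightarrow> (complex \<times> complex \<times> complex) set \<Rightarrow> bool" where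
  "irreducible_plane_curve m C \<longleftrightarrow>
     (\<exists>F. irreducible F \<and> homogeneous3 m F \<and>
          C = {(x, y, z). (x, y, z) \<noteq> (0, 0, 0) \<and> poly3_eval F x y z = 0})"


section \<open>Partial recursive functions\<close>

datatype recf =
    Zero
  | Succ
  | Proj nat
  | Comp recf "recf list"
  | PrimRec recf recf
  | Mu recf

text \<open>\<open>computes f xs y\<close>: the program \<open>f\<close> halts on the argument list \<open>xs\<close> with result \<open>y\<close>.\<close>
inductive computes :: "recf \<Rightarrow> nat list \<Rightarrow> nat \<Rightarrow> bool" where
  zero: "computes Zero xs 0"
| succ: "computes Succ (x # xs) (Suc x)"
| proj: "i < length xs \<Longrightarrow> computes (Proj i) xs (xs ! i)"
| comp: "list_all2 (\<lambda>g y. computes g xs y) gs ys \<Longrightarrow> computes f ys z \<Longrightarrow>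
           computes (Comp f gs) xs z"
| prim_0: "computes f xs y \<Longrightarrow> computes (PrimRec f g) (0 # xs) y"
| prim_Suc: "computes (PrimRec f g) (n # xs) y \<Longrightarrow> computes g (n # y # xs) z \<Longrightarrow>
           computes (PrimRec f g) (Suc n # xs) z"
| mu: "computes f (n # xs) 0 \<Longrightarrow> (\<forall>k<n. \<exists>y. computes f (k # xs) (Suc y)) \<Longrightarrow>
           computes (Mu f) xs n"

inductive_cases computes_ZeroE: "computes Zero xs y"
inductive_cases computes_SuccE: "computes Succ xs y"
inductive_cases computes_ProjE: "computes (Proj i) xs y"
inductive_cases computes_CompE: "computes (Comp f gs) xs y"
inductive_cases computes_PrimRec_0E: "computes (PrimRec f g) (0 # xs) y"
inductive_cases computes_PrimRec_SucE: "computes (PrimRec f g) (Suc n # xs) y"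
inductive_cases computes_MuE: "computes (Mu f) xs y"

lemma computes_deterministic: "computes f xs y \<Longrightarrow> computes f xs y' \<Longrightarrow> y = y'"
proof (induction arbitrary: y' rule: computes.induct)
  case (comp xs gs ys f z)
  from comp.prems obtain ys' where ys': "list_all2 (\<lambda>g y. computes g xs y) gs ys'"
    and z': "computes f ys' y'"
    by (rule computes_CompE)
  have "ys = ys'"
  proof (rule nth_equalityI)
    show "length ys = length ys'"
      using comp.IH(1) ys' by (simp add: list_all2_lengthD [symmetric])
    show "ys ! i = ys' ! i" if "i < length ys" for i
      using list_all2_nthD2 [OF comp.IH(1) that] list_all2_nthD [OF ys', of i] that
        list_all2_lengthD [OF comp.IH(1)] by simp
  qed
  with comp.IH(2) z' show ?case by simp
next
  case (mu f n xs)
  from mu.prems have "computes f (y' # xs) 0" "\<forall>k<y'. \<exists>y. computes f (k # xs) (Suc y)"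
    by (auto elim: computes_MuE)
  then have "\<not> n < y'" "\<not> y' < n"
    using mu.IH by (metis nat.distinct(1))+
  then show ?case by simp
qed (blast elim: computes_ZeroE computes_SuccE computes_ProjE
      computes_PrimRec_0E computes_PrimRec_SucE)+


section \<open>Finite descriptions of the data\<close>

definition rat_encode :: "rat \<Rightarrow> nat" where
  "rat_encode r = (case quotient_of r of (a, b) \<Rightarrow> prod_encode (int_encode a, nat b))"

definition int_poly_encode :: "int poly \<Rightarrow> nat" where
  "int_poly_encode p = list_encode (map int_encode (coeffs p))"

text \<open>
  An algebraic number is described to an algorithm by its minimal polynomial over the integers
  (primitive, irreducible, with positive leading coefficient) together with a rational disc
  that isolates it among the roots of this polynomial.
\<close>
definition algebraic_code :: "nat \<Rightarrow> complex \<Rightarrow> bool" where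
  "algebraic_code c \<alpha> \<longleftrightarrow>
     (\<exists>(p :: int poly) (a :: rat) (b :: rat) (r :: rat).
        c = prod_encode (int_poly_encode p,
              prod_encode (rat_encode a, prod_encode (rat_encode b, rat_encode r))) \<and>
        irreducible p \<and> lead_coeff p > 0 \<and>
        {z. poly (map_poly of_int p) z = 0} \<inter> ball (Complex (of_rat a) (of_rat b)) (of_rat r)
          = {\<alpha>})"

lemma algebraic_code_unique:
  assumes "algebraic_code c \<alpha>" "algebraic_code c \<beta>"
  shows "\<alpha> = \<beta>"
proof -
  have rat_eq: "r = s" if "rat_encode r = rat_encode s" for r s
  proof -
    obtain a b a' b' where q: "quotient_of r = (a, b)" "quotient_of s = (a', b')"
      by (metis surj_pair)
    with that quotient_of_denom_pos [of r a b] quotient_of_denom_pos [of s a' b']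
    have "quotient_of r = quotient_of s"
      by (auto simp: rat_encode_def int_encode_eq eq_nat_nat_iff)
    then show ?thesis
      by (rule quotient_of_inject)
  qed
  have poly_eq: "p = q" if "int_poly_encode p = int_poly_encode q" for p q
    using that by (simp add: int_poly_encode_def list_encode_eq inj_map_eq_map
        inj_int_encode coeffs_eq_iff)
  from assms show ?thesis
    unfolding algebraic_code_def by (fastforce dest: rat_eq poly_eq)
qed

lemma algebraic_code_exists:
  assumes "algebraic \<alpha>"
  shows "\<exists>c. algebraic_code c \<alpha>"
proof -
  let ?e = "\<lambda>p :: int poly. map_poly (of_int :: int \<Rightarrow> complex) p"
  have e_mult: "?e (p * q) = ?e p * ?e q" for p q
    by (intro poly_eqI) (simp add: coeff_map_poly coeff_mult)
  obtain p0 where p0: "p0 \<noteq> 0" "poly (?e p0) \<alpha> = 0"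
    using assms by (rule algebraicE')
  obtain A where A: "\<And>p. p \<in># A \<Longrightarrow> prime p" "normalize (prod_mset A) = normalize p0"
    using prime_factorization_exists' [OF p0(1)] by blast
  from A(2) have "p0 dvd prod_mset A"
    by (metis dvd_normalize_iff dvd_refl normalize_dvd_iff)
  then obtain r where "prod_mset A = p0 * r" ..
  then have root: "poly (?e (prod_mset A)) \<alpha> = 0"
    by (simp add: e_mult p0(2))
  have "\<exists>p \<in># B. poly (?e p) \<alpha> = 0" if "poly (?e (prod_mset B)) \<alpha> = 0" for B
    using that
  proof (induction B)
    case empty
    then show ?case by (simp add: one_pCons map_poly_pCons)
  next
    case (add x B)
    then show ?case by (auto simp: e_mult)
  qed
  from this [OF root] obtain p1 where "p1 \<in># A" and p1_root: "poly (?e p1) \<alpha> = 0" by blast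
  with A(1) have p1: "prime_elem p1"
    by (simp add: prime_imp_prime_elem)
  define p where "p = (if lead_coeff p1 > 0 then p1 else - p1)"
  have irr: "irreducible p"
    using p1 by (intro prime_elem_imp_irreducible) (simp add: p_def prime_elem_def)
  have "lead_coeff p1 \<noteq> 0"
    using p1 by auto
  then have lead: "lead_coeff p > 0"
    by (auto simp add: p_def linorder_neq_iff simp del: leading_coeff_0_iff)
  have "?e (- p1) = - ?e p1"
    by (intro poly_eqI) (simp add: coeff_map_poly)
  with p1_root have p_root: "poly (?e p) \<alpha> = 0"
    by (simp add: p_def)
  let ?Z = "{z. poly (?e p) z = 0}"
  have "?e p \<noteq> 0"
    using lead by (metis coeff_0 coeff_map_poly less_irrefl of_int_0 of_int_eq_0_iff)
  then have "finite ?Z"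
    by (rule poly_roots_finite)
  then obtain e where e: "e > 0" "\<And>z. z \<in> ?Z \<Longrightarrow> z \<noteq> \<alpha> \<Longrightarrow> e \<le> dist \<alpha> z"
    by (metis finite_set_avoid)
  obtain r :: rat where r: "0 < (of_rat r :: real)" "of_rat r < e / 2"
    using of_rat_dense [of 0 "e / 2"] e(1) by auto
  obtain a :: rat where a: "Re \<alpha> < of_rat a" "of_rat a < Re \<alpha> + of_rat r / 2"
    using of_rat_dense [of "Re \<alpha>" "Re \<alpha> + of_rat r / 2"] r(1) by auto
  obtain b :: rat where b: "Im \<alpha> < of_rat b" "of_rat b < Im \<alpha> + of_rat r / 2"
    using of_rat_dense [of "Im \<alpha>" "Im \<alpha> + of_rat r / 2"] r(1) by auto
  let ?c = "Complex (of_rat a) (of_rat b)"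
  have "dist ?c \<alpha> \<le> \<bar>Re (?c - \<alpha>)\<bar> + \<bar>Im (?c - \<alpha>)\<bar>"
    unfolding dist_norm by (rule cmod_le)
  also have "\<dots> < of_rat r"
    using a b by simp
  finally have near: "dist ?c \<alpha> < of_rat r" .
  have "?Z \<inter> ball ?c (of_rat r) = {\<alpha>}"
  proof (intro equalityI subsetI)
    fix z assume z: "z \<in> ?Z \<inter> ball ?c (of_rat r)"
    then have "dist ?c z < of_rat r" by simp
    with near r(2) have "dist \<alpha> z < e"
      using dist_triangle3 [of \<alpha> z ?c] by linarith
    with e(2) z show "z \<in> {\<alpha>}" by force
  qed (use p_root near in auto)
  with irr lead show ?thesis
    unfolding algebraic_code_def by blast
qed

text \<open>
  On every description of the data \<open>(\<alpha>1, \<alpha>2, \<delta>, m)\<close>, the program \<open>f\<close> halts with the value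
  \<open>C0 \<alpha>1 \<alpha>2 \<delta> m\<close>. This value depends on the data only, not on the description chosen.
\<close>
definition computes_constant_at ::
    "recf \<Rightarrow> (complex \<Rightarrow> complex \<Rightarrow> rat \<Rightarrow> nat \<Rightarrow> nat) \<Rightarrow>
     complex \<Rightarrow> complex \<Rightarrow> rat \<Rightarrow> nat \<Rightarrow> bool" where
  "computes_constant_at f C0 \<alpha>1 \<alpha>2 \<delta> m \<longleftrightarrow>
     (\<forall>c1 c2. algebraic_code c1 \<alpha>1 \<longrightarrow> algebraic_code c2 \<alpha>2 \<longrightarrow>
        computes f [c1, c2, rat_encode \<delta>, m] (C0 \<alpha>1 \<alpha>2 \<delta> m))"

end

theory Submission
  imports Defs "Jordan_Normal_Form.Char_Poly" "HOL-Computational_Algebra.Field_as_Ring"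
begin

text \<open>
  The proof is a Thue-type argument on the curve. Its auxiliary polynomials are found by integer
  linear algebra, so that every constant is explicit.

  Let \<open>\<alpha> = (\<alpha>1, \<alpha>2)\<close>, let \<open>S\<close> be the set of its \<open>d\<close> conjugates, \<open>f = 0\<close> an affine equation of
  the curve and \<open>\<xi> = (p1/q, p2/q)\<close>. If an integer polynomial \<open>P\<close> of degree \<open>e\<close> vanishes to order \<open>n\<close>
  at \<open>\<alpha>\<close>, then \<open>P(\<xi>) = O(q^(-n\<delta>))\<close>, whereas \<open>q^e P(\<xi>)\<close> is an integer. Hence \<open>P(\<xi>) = 0\<close> if
  \<open>e < n\<delta>\<close> and \<open>q\<close> is large (\<open>xyeval_near_zero_bound\<close>, \<open>xyeval_rational_zero\<close>).

  The equation \<open>f\<close> need not have rational coefficients. But vanishing on \<open>S\<close> is a linear condition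
  on coefficients that can be written with integers, namely with traces, because \<open>S\<close> is stable
  under Galois. By \<open>integer_kernel_basis\<close> the complex solutions are spanned by integer solutions of
  bounded size (\<open>jet_basis\<close>). As \<open>m < \<delta>\<close>, the integer polynomials of degree at most \<open>m\<close> which
  vanish on \<open>S\<close> vanish at \<open>\<xi>\<close>, and so does their complex combination \<open>f\<close>.

  A second curve through \<open>\<xi>\<close> is needed. If some polynomial of degree at most \<open>m\<close> vanishes on \<open>S\<close>
  and is not a multiple of \<open>f\<close>, take it. Otherwise \<open>f\<close> is rational up to a factor and smooth at
  every point of \<open>S\<close> (\<open>smooth_on_conjugates\<close>). At a smooth point, vanishing to order \<open>n\<close> modulo
  \<open>f\<close> amounts to \<open>n\<close> linear conditions, so \<open>n d\<close> conditions suffice for all of \<open>S\<close>, while the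
  polynomials of degree at most \<open>e\<close> have dimension about \<open>e m\<close> modulo \<open>f\<close>. Since \<open>\<delta> > d/m\<close>, one
  can choose \<open>e < n\<delta>\<close> with \<open>e m\<close> larger than \<open>n d\<close> by enough to find a polynomial that is
  not a multiple of \<open>f\<close> (\<open>degree_count\<close>, \<open>auxiliary_curve\<close>). It is again a combination of
  integer polynomials that vanish at \<open>\<xi>\<close>.

  Two curves without common component meet at \<open>\<xi>\<close>. Eliminating a variable (\<open>eliminate_y\<close>,
  \<open>eliminate_x\<close>), and descending to integers once more, one gets nonzero integer polynomials of
  bounded size in one variable that vanish at the coordinates of \<open>\<xi>\<close>
  (\<open>small_integer_relations\<close>). So the reduced denominators of \<open>\<xi>\<close> are bounded. If \<open>\<xi> \<noteq> \<alpha>\<close>, then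
  \<open>\<xi>\<close> cannot be too close to \<open>\<alpha>\<close>, by Liouville's argument (\<open>liouville\<close>), and this bounds \<open>q\<close>;
  if \<open>\<xi> = \<alpha>\<close>, the fractions are in lowest terms and \<open>q\<close> divides a product of leading coefficients.

  The resulting bound is built by sums, products and powers from one number that exceeds the
  degrees and coefficients of the minimal polynomials of \<open>\<alpha>1\<close> and \<open>\<alpha>2\<close>, the numerator and
  denominator of \<open>\<delta>\<close>, and \<open>m\<close>. It is therefore a recursive function of the codes. It depends on the
  minimal polynomials alone, and not on the isolating discs, which makes it independent of the
  description chosen for \<open>\<alpha>1\<close> and \<open>\<alpha>2\<close>.
\<close>

section \<open>Recursive functions\<close>

definition recursive :: "nat \<Rightarrow> (nat list \<Rightarrow> nat) \<Rightarrow> bool" where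
  "recursive k h \<longleftrightarrow> (\<exists>r. \<forall>xs. length xs = k \<longrightarrow> computes r xs (h xs))"

lemma recursive_proj: "i < k \<Longrightarrow> recursive k (\<lambda>xs. xs ! i)"
  unfolding recursive_def by (metis computes.proj)

lemma recursive_comp:
  assumes "recursive (length hs) g" "\<And>h. h \<in> set hs \<Longrightarrow> recursive k h"
  shows "recursive k (\<lambda>xs. g (map (\<lambda>h. h xs) hs))"
proof -
  obtain r where r: "\<And>xs. length xs = length hs \<Longrightarrow> computes r xs (g xs)"
    using assms(1) unfolding recursive_def by blast
  have "\<exists>rs. \<forall>xs. length xs = k \<longrightarrow> list_all2 (\<lambda>p y. computes p xs y) rs (map (\<lambda>h. h xs) hs)"
    using assms(2)
  proof (induction hs)
    case (Cons h hs)
    then obtain rs p where "\<forall>xs. length xs = k \<longrightarrow> list_all2 (\<lambda>p y. computes p xs y) rs (map (\<lambda>h. h xs) hs)"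
      "\<forall>xs. length xs = k \<longrightarrow> computes p xs (h xs)"
      unfolding recursive_def by (meson list.set_intros)
    then show ?case by (intro exI[of _ "p # rs"]) auto
  qed auto
  then obtain rs where "\<And>xs. length xs = k \<Longrightarrow> list_all2 (\<lambda>p y. computes p xs y) rs (map (\<lambda>h. h xs) hs)"
    by blast
  then show ?thesis
    unfolding recursive_def using r by (intro exI[of _ "Comp r rs"]) (auto intro!: computes.comp)
qed

lemma recursive_comp1:
  assumes "recursive 1 (\<lambda>xs. g (xs ! 0))" "recursive k h"
  shows "recursive k (\<lambda>xs. g (h xs))"
  using recursive_comp[of "[h]" "\<lambda>xs. g (xs ! 0)" k] assms by simp

lemma recursive_comp2:
  assumes "recursive 2 (\<lambda>xs. g (xs ! 0) (xs ! 1))" "recursive k h1" "recursive k h2"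
  shows "recursive k (\<lambda>xs. g (h1 xs) (h2 xs))"
  using recursive_comp[of "[h1, h2]" "\<lambda>xs. g (xs ! 0) (xs ! 1)" k] assms
  by (auto simp: numeral_2_eq_2)

lemma recursive_Suc: "recursive k h \<Longrightarrow> recursive k (\<lambda>xs. Suc (h xs))"
proof -
  have "recursive 1 (\<lambda>xs. Suc (xs ! 0))"
    unfolding recursive_def
  proof (intro exI allI impI)
    fix xs :: "nat list" assume "length xs = 1"
    then obtain x where "xs = [x]" by (auto simp: length_Suc_conv)
    then show "computes Succ xs (Suc (xs ! 0))" by (auto intro: computes.succ)
  qed
  then show "recursive k h \<Longrightarrow> recursive k (\<lambda>xs. Suc (h xs))" by (rule recursive_comp1)
qed

lemma recursive_const: "recursive k (\<lambda>_. c)"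
proof (induction c)
  case 0
  then show ?case unfolding recursive_def by (auto intro: computes.zero)
next
  case (Suc c)
  then show ?case by (rule recursive_Suc)
qed

lemma recursive_prim:
  assumes "recursive 1 (\<lambda>xs. b (xs ! 0))" "recursive 3 (\<lambda>xs. s (xs ! 0) (xs ! 1) (xs ! 2))"
    and g: "\<And>y. g 0 y = b y" "\<And>n y. g (Suc n) y = s n (g n y) y"
  shows "recursive 2 (\<lambda>xs. g (xs ! 0) (xs ! 1))"
proof -
  obtain p where p: "\<And>xs. length xs = 1 \<Longrightarrow> computes p xs (b (xs ! 0))"
    using assms(1) unfolding recursive_def by blast
  obtain q where q: "\<And>xs. length xs = 3 \<Longrightarrow> computes q xs (s (xs ! 0) (xs ! 1) (xs ! 2))"
    using assms(2) unfolding recursive_def by blast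
  have "computes (PrimRec p q) [n, y] (g n y)" for n y
  proof (induction n)
    case 0
    then show ?case using p[of "[y]"] by (auto intro!: computes.prim_0 simp: g)
  next
    case (Suc n)
    then show ?case using q[of "[n, g n y, y]"] by (auto intro!: computes.prim_Suc simp: g)
  qed
  then show ?thesis
    unfolding recursive_def by (intro exI[of _ "PrimRec p q"]) (auto simp: numeral_2_eq_2 length_Suc_conv)
qed

lemma recursive_least:
  assumes "recursive 2 (\<lambda>xs. g (xs ! 0) (xs ! 1))" "\<And>y. \<exists>n. g n y = 0"
  shows "recursive 1 (\<lambda>xs. LEAST n. g n (xs ! 0) = 0)"
proof -
  obtain p where p: "\<And>xs. length xs = 2 \<Longrightarrow> computes p xs (g (xs ! 0) (xs ! 1))"
    using assms(1) unfolding recursive_def by blast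
  have "computes (Mu p) [y] (LEAST n. g n y = 0)" for y
  proof (rule computes.mu)
    have "g (LEAST n. g n y = 0) y = 0" using assms(2) by (rule LeastI_ex)
    then show "computes p [LEAST n. g n y = 0, y] 0" using p[of "[LEAST n. g n y = 0, y]"] by simp
    show "\<forall>k<LEAST n. g n y = 0. \<exists>z. computes p [k, y] (Suc z)"
    proof (intro allI impI)
      fix k assume "k < (LEAST n. g n y = 0)"
      then have "g k y \<noteq> 0" using not_less_Least by blast
      then obtain z where "g k y = Suc z" using not0_implies_Suc by blast
      then show "\<exists>z. computes p [k, y] (Suc z)" using p[of "[k, y]"] by auto
    qed
  qed
  then show ?thesis
    unfolding recursive_def by (intro exI[of _ "Mu p"]) (auto simp: length_Suc_conv)
qed

lemma recursive_add: "recursive k h1 \<Longrightarrow> recursive k h2 \<Longrightarrow> recursive k (\<lambda>xs. h1 xs + h2 xs)"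
  by (rule recursive_comp2[of "(+)"])
    (rule recursive_prim[of "\<lambda>y. y" "\<lambda>n r y. Suc r"], auto intro!: recursive_Suc recursive_proj)

lemma recursive_mult: "recursive k h1 \<Longrightarrow> recursive k h2 \<Longrightarrow> recursive k (\<lambda>xs. h1 xs * h2 xs)"
  by (rule recursive_comp2[of "(*)"])
    (rule recursive_prim[of "\<lambda>y. 0" "\<lambda>n r y. r + y"],
     auto intro!: recursive_add recursive_proj recursive_const)

lemma recursive_power: "recursive k h1 \<Longrightarrow> recursive k h2 \<Longrightarrow> recursive k (\<lambda>xs. h1 xs ^ h2 xs)"
  by (rule recursive_comp2[of "\<lambda>n y. y ^ n"])
    (rule recursive_prim[of "\<lambda>y. 1" "\<lambda>n r y. r * y"],
     auto intro!: recursive_mult recursive_proj recursive_const)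

lemma recursive_pred: "recursive k h \<Longrightarrow> recursive k (\<lambda>xs. h xs - 1)"
  by (rule recursive_comp2[of "\<lambda>n y. n - 1" k h h])
    (rule recursive_prim[of "\<lambda>y. 0" "\<lambda>n r y. n"], auto intro!: recursive_proj recursive_const)

lemma recursive_diff:
  assumes "recursive k h1" "recursive k h2"
  shows "recursive k (\<lambda>xs. h1 xs - h2 xs)"
proof -
  have "recursive 2 (\<lambda>xs. xs ! 1 - xs ! 0)"
    by (rule recursive_prim[of "\<lambda>y. y" "\<lambda>n r y. r - 1"])
      (auto intro!: recursive_pred[unfolded One_nat_def] recursive_proj)
  then show ?thesis
    using recursive_comp2[of "\<lambda>n y. y - n" k h2 h1] assms by simp
qed

lemma recursive_triangle: "recursive k h \<Longrightarrow> recursive k (\<lambda>xs. triangle (h xs))"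
  by (rule recursive_comp2[of "\<lambda>n y. triangle n" k h h])
    (rule recursive_prim[of "\<lambda>y. 0" "\<lambda>n r y. r + Suc n"],
     auto intro!: recursive_proj recursive_const recursive_add recursive_Suc)

lemmas recursive_intros = recursive_Suc recursive_const recursive_add recursive_mult
  recursive_power recursive_proj recursive_diff recursive_triangle

lemma triangle_less: "m < n \<Longrightarrow> triangle (Suc m) \<le> triangle n"
  by (induction n) (auto simp: less_Suc_eq)

text \<open>
  The Cantor pairing runs through the diagonals \<open>x + y = s\<close>, which begin at the triangular numbers.
  So an unbounded search for the diagonal that contains \<open>c\<close> recovers the first component.
\<close>
lemma fst_prod_decode_eq:
  "fst (prod_decode c) = c - triangle (LEAST s. Suc c - triangle (Suc s) = 0)"
proof -
  obtain m n where mn: "prod_decode c = (m, n)" by force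
  have c: "c = triangle (m + n) + m"
    using prod_decode_inverse[of c] by (simp add: mn prod_encode_def)
  have "(LEAST s. Suc c - triangle (Suc s) = 0) = m + n"
  proof (rule Least_equality)
    fix s assume "Suc c - triangle (Suc s) = 0"
    then show "m + n \<le> s" using triangle_less[of s "m + n"] c by (cases "s < m + n") auto
  qed (simp add: c)
  with mn c show ?thesis by simp
qed

lemma recursive_fst_prod_decode:
  assumes "recursive k h"
  shows "recursive k (\<lambda>xs. fst (prod_decode (h xs)))"
proof -
  have ex: "\<exists>n. Suc y - triangle (Suc n) = 0" for y
    by (intro exI[of _ y]) (induction y, auto)
  have r2: "recursive 2 (\<lambda>xs. Suc (xs ! 1) - triangle (Suc (xs ! 0)))"
    by (intro recursive_intros) auto
  have r1: "recursive 1 (\<lambda>xs. LEAST s. Suc (xs ! 0) - triangle (Suc s) = 0)"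
    by (rule recursive_least[of "\<lambda>s c. Suc c - triangle (Suc s)"]) (rule r2, rule ex)
  have "recursive 1 (\<lambda>xs. xs ! 0 - triangle (LEAST s. Suc (xs ! 0) - triangle (Suc s) = 0))"
    by (intro recursive_diff recursive_triangle r1 recursive_proj) auto
  then have "recursive 1 (\<lambda>xs. fst (prod_decode (xs ! 0)))"
    unfolding fst_prod_decode_eq .
  then show ?thesis using assms by (rule recursive_comp1)
qed

section \<open>Integer linear systems\<close>

text \<open>
  The counting principle behind every existence statement below: \<open>N\<close> conditions on more than \<open>N\<close>
  unknowns have a nontrivial solution. "One condition" is expressed by saying that any two
  vectors of \<open>J t\<close> have a nontrivial combination in \<open>J (t + 1)\<close>. In this form it applies where
  the condition at one step depends on choices made for the earlier ones and no
  linear functional is at hand.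
\<close>
lemma nontrivial_combination_in_chain:
  fixes J :: "nat \<Rightarrow> ('i \<Rightarrow> 'k::field) set"
  assumes base: "J 0 = UNIV"
    and step: "\<And>t x y. t < N \<Longrightarrow> x \<in> J t \<Longrightarrow> y \<in> J t \<Longrightarrow>
      \<exists>a b. (a \<noteq> 0 \<or> b \<noteq> 0) \<and> (\<lambda>i. a * x i + b * y i) \<in> J (Suc t)"
    and "finite I" "card I > N"
  shows "\<exists>x\<in>J N. (\<exists>i\<in>I. x i \<noteq> 0) \<and> (\<forall>i. i \<notin> I \<longrightarrow> x i = 0)"
proof -
  have "\<exists>x\<in>J t. (\<exists>i\<in>I. x i \<noteq> 0) \<and> (\<forall>i. i \<notin> I \<longrightarrow> x i = 0)"
    if "t \<le> N" "finite I" "card I > t" for t and I :: "'i set"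
    using that
  proof (induction t arbitrary: I)
    case 0
    then obtain i where "i \<in> I" by (metis card.empty equals0I less_irrefl)
    then show ?case
      by (intro bexI[of _ "\<lambda>j. if j = i then 1 else 0"]) (auto simp: base)
  next
    case (Suc t)
    then obtain x i where x: "x \<in> J t" "i \<in> I" "x i \<noteq> 0" "\<forall>i. i \<notin> I \<longrightarrow> x i = 0"
      by (metis Suc_leD Suc_lessD)
    have "finite (I - {i})" "card (I - {i}) > t"
      using Suc.prems x(2) by auto
    with Suc obtain y j where y: "y \<in> J t" "j \<in> I - {i}" "y j \<noteq> 0"
        "\<forall>k. k \<notin> I - {i} \<longrightarrow> y k = 0"
      by (metis Suc_leD)
    \<comment> \<open>Since \<open>x i \<noteq> 0\<close> and \<open>y i = 0\<close>, a nontrivial combination of \<open>x\<close> and \<open>y\<close> is not zero.\<close>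
    obtain a b where ab: "a \<noteq> 0 \<or> b \<noteq> 0" "(\<lambda>i. a * x i + b * y i) \<in> J (Suc t)"
      using step[of t x y] Suc.prems(1) x(1) y(1) by auto
    have "\<exists>l\<in>I. a * x l + b * y l \<noteq> 0"
    proof (cases "a = 0")
      case True
      with ab y show ?thesis by (intro bexI[of _ j]) auto
    next
      case False
      with x y show ?thesis by (intro bexI[of _ i]) auto
    qed
    with ab x y show ?case by (intro bexI[of _ "\<lambda>i. a * x i + b * y i"]) auto
  qed
  from this[OF order_refl assms(3,4)] show ?thesis .
qed

lemma underdetermined_system_solvable:
  fixes c :: "'r \<Rightarrow> 'i \<Rightarrow> 'k::field"
  assumes "finite R" "finite I" "card R < card I"
  shows "\<exists>x. (\<exists>i\<in>I. x i \<noteq> 0) \<and> (\<forall>i. i \<notin> I \<longrightarrow> x i = 0) \<and> (\<forall>r\<in>R. (\<Sum>i\<in>I. c r i * x i) = 0)"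
proof -
  obtain h where h: "bij_betw h {0..<card R} R"
    using ex_bij_betw_nat_finite[OF assms(1)] by blast
  define ev where "ev r x = (\<Sum>i\<in>I. c r i * x i)" for r x
  define J where "J t = {x. \<forall>s<t. ev (h s) x = 0}" for t
  have lin: "ev r (\<lambda>i. a * x i + b * y i) = a * ev r x + b * ev r y" for r a b x y
    by (simp add: ev_def algebra_simps sum.distrib sum_distrib_left)
  have "\<exists>x\<in>J (card R). (\<exists>i\<in>I. x i \<noteq> 0) \<and> (\<forall>i. i \<notin> I \<longrightarrow> x i = 0)"
  proof (rule nontrivial_combination_in_chain)
    fix t x y assume xy: "x \<in> J t" "y \<in> J t"
    define a b where "a = (if ev (h t) x = 0 \<and> ev (h t) y = 0 then 1 else ev (h t) y)"
      and "b = - ev (h t) x"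
    have "a * ev (h s) x + b * ev (h s) y = 0" if "s < Suc t" for s
    proof (cases "s = t")
      case True
      then show ?thesis by (simp add: a_def b_def)
    next
      case False
      with that have "s < t" by simp
      with xy have "ev (h s) x = 0" "ev (h s) y = 0" unfolding J_def by blast+
      then show ?thesis by simp
    qed
    then have "(\<lambda>i. a * x i + b * y i) \<in> J (Suc t)"
      unfolding J_def mem_Collect_eq lin by simp
    moreover have "a \<noteq> 0 \<or> b \<noteq> 0" by (auto simp: a_def b_def)
    ultimately show "\<exists>a b. (a \<noteq> 0 \<or> b \<noteq> 0) \<and> (\<lambda>i. a * x i + b * y i) \<in> J (Suc t)"
      by (intro exI[of _ a] exI[of _ b] conjI)
  qed (use assms in \<open>auto simp: J_def\<close>)
  then obtain x where x: "x \<in> J (card R)" "\<exists>i\<in>I. x i \<noteq> 0" "\<forall>i. i \<notin> I \<longrightarrow> x i = 0" by blast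
  have "ev r x = 0" if "r \<in> R" for r
  proof -
    have "r \<in> h ` {0..<card R}"
      using that h by (simp add: bij_betw_def)
    then obtain s where "s < card R" "h s = r" by auto
    with x show ?thesis by (auto simp: J_def)
  qed
  with x show ?thesis by (auto simp: ev_def)
qed

text \<open>
  Each elimination step squares the entries, whence the tower of exponents.
\<close>
definition kernel_bound :: "nat \<Rightarrow> nat" where
  "kernel_bound Y = (2 * Y) ^ (4 ^ Y)"

text \<open>
  Fraction-free Gaussian elimination. A row \<open>a\<close> with \<open>a k \<noteq> 0\<close> eliminates the unknown \<open>k\<close> from the
  other rows and turns entries bounded by \<open>Y\<close> into entries bounded by \<open>2Y^2\<close>. A solution \<open>b\<close> of the
  smaller system lifts to an integer solution after multiplication by \<open>a k\<close>.
\<close>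
lemma integer_kernel_basis_aux:
  fixes R :: "('a \<Rightarrow> int) set"
  assumes "finite J" "card J \<le> Y" "1 \<le> Y"
    and "\<And>r j. r \<in> R \<Longrightarrow> j \<in> J \<Longrightarrow> \<bar>r j\<bar> \<le> int Y"
  shows "\<exists>B :: ('a \<Rightarrow> int) set. finite B \<and> card B \<le> card J \<and>
     (\<forall>b\<in>B. (\<forall>j. \<bar>b j\<bar> \<le> int ((2 * Y) ^ (4 ^ card J))) \<and> (\<forall>r\<in>R. (\<Sum>j\<in>J. r j * b j) = 0)) \<and>
     (\<forall>x :: 'a \<Rightarrow> complex. (\<forall>r\<in>R. (\<Sum>j\<in>J. of_int (r j) * x j) = 0) \<longrightarrow>
        (\<exists>c. \<forall>j\<in>J. x j = (\<Sum>b\<in>B. c b * of_int (b j))))"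
  using assms
proof (induction "card J" arbitrary: J R Y)
  case 0
  then show ?case by (intro exI[of _ "{}"]) auto
next
  case (Suc s)
  show ?case
  proof (cases "\<forall>r\<in>R. \<forall>j\<in>J. r j = 0")
    case True
    define e where "e j i = (if i = j then 1 else 0 :: int)" for j i :: 'a
    have inj: "inj_on e J"
      by (rule inj_onI) (metis e_def zero_neq_one)
    show ?thesis
    proof (intro exI[of _ "e ` J"] conjI ballI allI impI)
      show "card (e ` J) \<le> card J" by (simp add: card_image inj)
      show "\<bar>b j\<bar> \<le> int ((2 * Y) ^ (4 ^ card J))" if "b \<in> e ` J" for b j
      proof -
        have "\<bar>b j\<bar> \<le> 1" using that by (auto simp: e_def)
        also have "1 \<le> (2 * Y) ^ (4 ^ card J)" using Suc.prems by simp
        then have "1 \<le> int ((2 * Y) ^ (4 ^ card J))" by linarith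
        finally show ?thesis .
      qed
      show "(\<Sum>j\<in>J. r j * b j) = 0" if "r \<in> R" for b r
        using True that by (intro sum.neutral) auto
      fix x :: "'a \<Rightarrow> complex"
      have "x j = (\<Sum>i\<in>J. x i * of_int (e i j))" if "j \<in> J" for j
        using that Suc.prems(1) by (simp add: e_def if_distrib sum.delta cong: if_cong)
      then show "\<exists>c. \<forall>j\<in>J. x j = (\<Sum>b\<in>e ` J. c b * of_int (b j))"
        by (intro exI[of _ "\<lambda>b. x (inv_into J e b)"]) (simp add: sum.reindex inj)
    qed (use Suc.prems in auto)
  next
    case False
    then obtain a k where a: "a \<in> R" "k \<in> J" "a k \<noteq> 0" by blast
    define J' where "J' = J - {k}"
    have J: "J = insert k J'" "k \<notin> J'" "finite J'" "card J' = s"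
      using a Suc by (auto simp: J'_def)
    define el where "el r j = a k * r j - r k * a j" for r j
    have bnd: "\<bar>el r j\<bar> \<le> int (2 * Y ^ 2)" if "r \<in> R" "j \<in> J'" for r j
    proof -
      have "\<bar>el r j\<bar> \<le> \<bar>a k\<bar> * \<bar>r j\<bar> + \<bar>r k\<bar> * \<bar>a j\<bar>"
        unfolding el_def abs_mult[symmetric] by linarith
      also have "\<dots> \<le> int Y * int Y + int Y * int Y"
        using Suc.prems(4) that a J by (intro add_mono mult_mono) auto
      finally show ?thesis by (simp add: power2_eq_square)
    qed
    have "Y \<le> 2 * Y ^ 2" by (simp add: power2_eq_square)
    then have "s \<le> 2 * Y ^ 2" "1 \<le> 2 * Y ^ 2" using Suc.prems Suc.hyps(2) by linarith+
    have "\<And>r j. r \<in> el ` R \<Longrightarrow> j \<in> J' \<Longrightarrow> \<bar>r j\<bar> \<le> int (2 * Y ^ 2)"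
      using bnd by blast
    moreover have "s = card J'" "card J' \<le> 2 * Y ^ 2"
      using J \<open>s \<le> 2 * Y ^ 2\<close> by auto
    ultimately obtain B where
      B: "finite B" "card B \<le> card J'"
         "\<forall>b\<in>B. (\<forall>j. \<bar>b j\<bar> \<le> int ((2 * (2 * Y ^ 2)) ^ (4 ^ card J'))) \<and>
            (\<forall>r\<in>el ` R. (\<Sum>j\<in>J'. r j * b j) = 0)"
         "\<forall>x :: 'a \<Rightarrow> complex. (\<forall>r\<in>el ` R. (\<Sum>j\<in>J'. of_int (r j) * x j) = 0) \<longrightarrow>
            (\<exists>c. \<forall>j\<in>J'. x j = (\<Sum>b\<in>B. c b * of_int (b j)))"
      using Suc.hyps(1)[of J' "2 * Y ^ 2" "el ` R", OF _ J(3) _ \<open>1 \<le> 2 * Y ^ 2\<close>] by blast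
    have B3: "\<bar>b j\<bar> \<le> int ((2 * (2 * Y ^ 2)) ^ (4 ^ s))" if "b \<in> B" for b j
      using B(3) that unfolding J(4) by blast
    have B4: "(\<Sum>j\<in>J'. el r j * b j) = 0" if "b \<in> B" "r \<in> R" for b r
      using B(3) that by blast
    have B5: "\<exists>c. \<forall>j\<in>J'. x j = (\<Sum>b\<in>B. c b * of_int (b j))"
      if "\<And>r. r \<in> R \<Longrightarrow> (\<Sum>j\<in>J'. of_int (el r j) * x j) = 0" for x :: "'a \<Rightarrow> complex"
      using B(4)[rule_format, of x] that by blast
    define up where "up b j = (if j = k then - (\<Sum>i\<in>J'. a i * b i) else a k * b j)"
      for b :: "'a \<Rightarrow> int" and j
    have up: "(\<Sum>j\<in>J. r j * up b j) = (\<Sum>j\<in>J'. el r j * b j)" for r b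
    proof -
      have "(\<Sum>j\<in>J. r j * up b j) = r k * up b k + (\<Sum>j\<in>J'. r j * (a k * b j))"
        unfolding J(1) using J(2,3) by (auto simp: up_def intro!: sum.cong)
      also have "\<dots> = (\<Sum>j\<in>J'. el r j * b j)"
        by (simp add: up_def el_def algebra_simps sum_distrib_left sum_subtractf)
      finally show ?thesis .
    qed
    show ?thesis
    proof (intro exI[of _ "up ` B"] conjI ballI allI impI)
      show "finite (up ` B)" using B by simp
      show "card (up ` B) \<le> card J"
        using card_image_le[OF B(1), of up] B(2) J(4) Suc.hyps(2) by linarith
      fix b assume "b \<in> up ` B"
      then obtain b' where b': "b = up b'" "b' \<in> B" by blast
      define M where "M = (2 * (2 * Y ^ 2)) ^ (4 ^ s)"
      fix j
      have "\<bar>b j\<bar> \<le> int (Y * Y * M)"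
      proof (cases "j = k")
        case True
        have "\<bar>b j\<bar> \<le> (\<Sum>i\<in>J'. \<bar>a i * b' i\<bar>)"
          using True by (simp add: b' up_def sum_abs)
        also have "\<dots> \<le> (\<Sum>i\<in>J'. int (Y * M))"
          using Suc.prems(4)[OF a(1)] B3[OF b'(2)] J
          by (intro sum_mono) (auto simp: abs_mult M_def intro!: mult_mono)
        also have "\<dots> = int (s * (Y * M))" using J by simp
        also have "\<dots> \<le> int (Y * (Y * M))"
          using Suc.prems(2) Suc.hyps(2) by (intro of_nat_mono mult_right_mono) auto
        finally show ?thesis by (simp add: mult.assoc)
      next
        case False
        then have "\<bar>b j\<bar> = \<bar>a k\<bar> * \<bar>b' j\<bar>" by (simp add: b' up_def abs_mult)
        also have "\<dots> \<le> int Y * int M"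
          using Suc.prems(4)[OF a(1,2)] B3[OF b'(2)] by (intro mult_mono) (auto simp: M_def)
        also have "\<dots> \<le> int Y * (int Y * int M)"
          using Suc.prems(3) by (intro mult_left_mono) (auto simp: mult_le_cancel_right1)
        finally show ?thesis by (simp add: mult.assoc)
      qed
      also have "Y * Y * M \<le> (2 * Y) ^ (4 ^ card J)"
      proof -
        have "Y * Y \<le> (2 * Y) ^ 2" by (simp add: power2_eq_square)
        also have "\<dots> \<le> (2 * Y) ^ (2 * 4 ^ s)"
          using Suc.prems(3) by (intro power_increasing) auto
        finally have "Y * Y * M \<le> (2 * Y) ^ (2 * 4 ^ s) * M" by (rule mult_right_mono) simp
        also have M: "M = (2 * Y) ^ (2 * 4 ^ s)"
          unfolding M_def power_mult by (simp add: power2_eq_square algebra_simps)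
        have "(2 * Y) ^ (2 * 4 ^ s) * M = (2 * Y) ^ (4 ^ card J)"
          unfolding M Suc.hyps(2)[symmetric] power_add[symmetric] by simp
        finally show ?thesis .
      qed
      then have "int (Y * Y * M) \<le> int ((2 * Y) ^ (4 ^ card J))" unfolding of_nat_le_iff .
      finally show "\<bar>b j\<bar> \<le> int ((2 * Y) ^ (4 ^ card J))" .
    next
      fix b r assume "b \<in> up ` B" "r \<in> R"
      then obtain b' where "b = up b'" "b' \<in> B" by blast
      with B4[of b' r] \<open>r \<in> R\<close> show "(\<Sum>j\<in>J. r j * b j) = 0" by (simp only: up)
    next
      fix x :: "'a \<Rightarrow> complex"
      assume x: "\<forall>r\<in>R. (\<Sum>j\<in>J. of_int (r j) * x j) = 0"
      have xr: "of_int (r k) * x k = - (\<Sum>j\<in>J'. of_int (r j) * x j)" if "r \<in> R" for r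
      proof -
        have "of_int (r k) * x k + (\<Sum>j\<in>J'. of_int (r j) * x j) = 0"
          using x that J(2,3) unfolding J(1) by simp
        then show ?thesis by (rule eq_neg_iff_add_eq_0[THEN iffD2])
      qed
      have "(\<Sum>j\<in>J'. of_int (el r j) * x j) = 0" if "r \<in> R" for r
      proof -
        have "(\<Sum>j\<in>J'. of_int (el r j) * x j) =
            of_int (a k) * (\<Sum>j\<in>J'. of_int (r j) * x j) - of_int (r k) * (\<Sum>j\<in>J'. of_int (a j) * x j)"
          by (simp add: el_def algebra_simps sum_subtractf sum_distrib_left)
        also have "\<dots> = - of_int (a k) * (of_int (r k) * x k) + of_int (r k) * (of_int (a k) * x k)"
          using xr[OF that] xr[OF a(1)] by (simp add: algebra_simps)
        finally show ?thesis by (simp add: algebra_simps)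
      qed
      then obtain c where c: "\<And>j. j \<in> J' \<Longrightarrow> x j = (\<Sum>b\<in>B. c b * of_int (b j))"
        using B5[of x] by blast
      define c' where "c' b' = (\<Sum>b | b \<in> B \<and> up b = b'. c b / of_int (a k))" for b'
      have sum: "(\<Sum>b'\<in>up ` B. c' b' * of_int (b' j)) = (\<Sum>b\<in>B. c b / of_int (a k) * of_int (up b j))" for j
        unfolding c'_def sum_distrib_right
        by (subst sum.image_gen[OF B(1), of _ up]) (auto intro!: sum.cong)
      have "x j = (\<Sum>b\<in>B. c b / of_int (a k) * of_int (up b j))" if "j \<in> J" for j
      proof (cases "j = k")
        case False
        with that J c[of j] a(3) show ?thesis by (simp add: up_def)
      next
        case True
        have "of_int (a k) * x k = - (\<Sum>j\<in>J'. of_int (a j) * (\<Sum>b\<in>B. c b * of_int (b j)))"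
          using xr[OF a(1)] c by simp
        also have "\<dots> = - (\<Sum>j\<in>J'. \<Sum>b\<in>B. of_int (a j) * (c b * of_int (b j)))"
          by (simp add: sum_distrib_left)
        also have "\<dots> = - (\<Sum>b\<in>B. \<Sum>j\<in>J'. of_int (a j) * (c b * of_int (b j)))"
          by (subst sum.swap) simp
        also have "\<dots> = (\<Sum>b\<in>B. c b * of_int (up b k))"
          by (simp add: up_def sum_distrib_left algebra_simps sum_negf)
        finally have "x k = (\<Sum>b\<in>B. c b * of_int (up b k)) / of_int (a k)"
          using a(3) by (simp add: field_simps)
        with True show ?thesis by (simp add: sum_divide_distrib)
      qed
      with sum show "\<exists>c. \<forall>j\<in>J. x j = (\<Sum>b\<in>up ` B. c b * of_int (b j))"
        by (intro exI[of _ c']) simp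
    qed
  qed
qed

text \<open>
  Descent from \<open>\<complex>\<close> to \<open>\<int>\<close> with control of the size. Thanks to it, existence can be proved with
  complex polynomials, although only integer polynomials take discrete values at rational points.
\<close>
lemma integer_kernel_basis:
  fixes R :: "('a \<Rightarrow> int) set"
  assumes "finite J" "card J \<le> Y" "1 \<le> Y"
    and "\<forall>r\<in>R. \<forall>j\<in>J. \<bar>r j\<bar> \<le> int Y"
  obtains B :: "('a \<Rightarrow> int) set" where "finite B" "card B \<le> card J"
     "\<And>b j. b \<in> B \<Longrightarrow> \<bar>b j\<bar> \<le> int (kernel_bound Y)"
     "\<And>b r. b \<in> B \<Longrightarrow> r \<in> R \<Longrightarrow> (\<Sum>j\<in>J. r j * b j) = 0"
     "\<And>x :: 'a \<Rightarrow> complex. (\<And>r. r \<in> R \<Longrightarrow> (\<Sum>j\<in>J. of_int (r j) * x j) = 0) \<Longrightarrow>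
        \<exists>c. \<forall>j\<in>J. x j = (\<Sum>b\<in>B. c b * of_int (b j))"
proof -
  have "(2 * Y) ^ (4 ^ card J) \<le> kernel_bound Y"
    unfolding kernel_bound_def using assms by (intro power_increasing) auto
  then have le: "int ((2 * Y) ^ (4 ^ card J)) \<le> int (kernel_bound Y)" by (rule of_nat_mono)
  have "\<exists>B :: ('a \<Rightarrow> int) set. finite B \<and> card B \<le> card J \<and>
     (\<forall>b\<in>B. (\<forall>j. \<bar>b j\<bar> \<le> int ((2 * Y) ^ (4 ^ card J))) \<and> (\<forall>r\<in>R. (\<Sum>j\<in>J. r j * b j) = 0)) \<and>
     (\<forall>x :: 'a \<Rightarrow> complex. (\<forall>r\<in>R. (\<Sum>j\<in>J. of_int (r j) * x j) = 0) \<longrightarrow>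
        (\<exists>c. \<forall>j\<in>J. x j = (\<Sum>b\<in>B. c b * of_int (b j))))"
    by (rule integer_kernel_basis_aux[OF assms(1-3)]) (use assms(4) in blast)
  then obtain B where B: "finite B" "card B \<le> card J"
     "\<forall>b\<in>B. (\<forall>j. \<bar>b j\<bar> \<le> int ((2 * Y) ^ (4 ^ card J))) \<and> (\<forall>r\<in>R. (\<Sum>j\<in>J. r j * b j) = 0)"
     "\<forall>x :: 'a \<Rightarrow> complex. (\<forall>r\<in>R. (\<Sum>j\<in>J. of_int (r j) * x j) = 0) \<longrightarrow>
        (\<exists>c. \<forall>j\<in>J. x j = (\<Sum>b\<in>B. c b * of_int (b j)))"
    by (elim exE conjE)
  show ?thesis
  proof (rule that[OF B(1,2)])
    show "\<bar>b j\<bar> \<le> int (kernel_bound Y)" if "b \<in> B" for b j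
      using B(3)[rule_format, OF that] le order_trans by blast
    show "(\<Sum>j\<in>J. r j * b j) = 0" if "b \<in> B" "r \<in> R" for b r
      using B(3)[rule_format, OF that(1)] that(2) by blast
    show "\<exists>c. \<forall>j\<in>J. x j = (\<Sum>b\<in>B. c b * of_int (b j))"
      if "\<And>r. r \<in> R \<Longrightarrow> (\<Sum>j\<in>J. of_int (r j) * x j) = 0" for x :: "'a \<Rightarrow> complex"
      using B(4)[rule_format, of x] that by blast
  qed
qed

section \<open>Polynomials in two variables\<close>

type_synonym bpoly = "complex poly poly"

definition xycoeff :: "bpoly \<Rightarrow> nat \<Rightarrow> nat \<Rightarrow> complex" where
  "xycoeff P i j = coeff (coeff P j) i"

definition xyeval :: "bpoly \<Rightarrow> complex \<Rightarrow> complex \<Rightarrow> complex" where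
  "xyeval P x y = poly (poly P [:y:]) x"

definition tdeg_le :: "nat \<Rightarrow> bpoly \<Rightarrow> bool" where
  "tdeg_le n P \<longleftrightarrow> (\<forall>i j. xycoeff P i j \<noteq> 0 \<longrightarrow> i + j \<le> n)"

definition cscale :: "complex \<Rightarrow> bpoly \<Rightarrow> bpoly" where
  "cscale c P = [:[:c:]:] * P"

definition xy_monom :: "nat \<Rightarrow> nat \<Rightarrow> bpoly" where
  "xy_monom i j = monom (monom 1 i) j"

definition exponents_le :: "nat \<Rightarrow> (nat \<times> nat) set" where
  "exponents_le n = {(i, j). i + j \<le> n}"

lemma bpoly_eqI: "(\<And>i j. xycoeff P i j = xycoeff Q i j) \<Longrightarrow> P = Q"
  unfolding xycoeff_def by (intro poly_eqI) auto

lemma xycoeff_0 [simp]: "xycoeff 0 i j = 0"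
  and xycoeff_add [simp]: "xycoeff (P + Q) i j = xycoeff P i j + xycoeff Q i j"
  and xycoeff_diff [simp]: "xycoeff (P - Q) i j = xycoeff P i j - xycoeff Q i j"
  and xycoeff_cscale [simp]: "xycoeff (cscale c P) i j = c * xycoeff P i j"
  by (simp_all add: xycoeff_def cscale_def)

lemma xycoeff_sum: "xycoeff (\<Sum>a\<in>A. f a) i j = (\<Sum>a\<in>A. xycoeff (f a) i j)"
  by (induction A rule: infinite_finite_induct) auto

lemma xycoeff_xy_monom: "xycoeff (xy_monom k l) i j = (if i = k \<and> j = l then 1 else 0)"
  by (auto simp: xycoeff_def xy_monom_def coeff_monom)

lemma xycoeff_cscale_xy_monom: "xycoeff (cscale c (xy_monom k l)) i j = (if k = i \<and> l = j then c else 0)"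
  by (simp add: xycoeff_xy_monom)

lemma xycoeff_mult: "xycoeff (P * Q) i j = (\<Sum>b\<le>j. \<Sum>a\<le>i. xycoeff P a b * xycoeff Q (i - a) (j - b))"
  by (simp add: xycoeff_def coeff_mult coeff_sum)

lemma cscale_0 [simp]: "cscale 0 P = 0" "cscale c 0 = 0"
  and cscale_1 [simp]: "cscale 1 P = P"
  by (rule bpoly_eqI, simp)+

lemma cscale_cscale: "cscale a (cscale b P) = cscale (a * b) P"
  and cscale_add: "cscale c (P + Q) = cscale c P + cscale c Q"
  and cscale_diff: "cscale c (P - Q) = cscale c P - cscale c Q"
  and cscale_add_left: "cscale (a + b) P = cscale a P + cscale b P"
  by (rule bpoly_eqI, simp add: algebra_simps)+

lemma cscale_mult_left: "cscale c P * Q = cscale c (P * Q)"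
  and cscale_mult_right: "P * cscale c Q = cscale c (P * Q)"
  by (simp_all add: cscale_def)

lemma cscale_sum: "cscale c (\<Sum>a\<in>A. f a) = (\<Sum>a\<in>A. cscale c (f a))"
  by (rule bpoly_eqI) (simp add: xycoeff_sum sum_distrib_left)

lemma cscale_sum_left: "cscale (\<Sum>a\<in>A. f a) P = (\<Sum>a\<in>A. cscale (f a) P)"
  by (rule bpoly_eqI) (simp add: xycoeff_sum sum_distrib_right)

lemma xyeval_0 [simp]: "xyeval 0 x y = 0"
  and xyeval_add [simp]: "xyeval (P + Q) x y = xyeval P x y + xyeval Q x y"
  and xyeval_diff [simp]: "xyeval (P - Q) x y = xyeval P x y - xyeval Q x y"
  and xyeval_cscale [simp]: "xyeval (cscale c P) x y = c * xyeval P x y"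
  and xyeval_mult [simp]: "xyeval (P * Q) x y = xyeval P x y * xyeval Q x y"
  by (simp_all add: xyeval_def cscale_def)

lemma xyeval_sum: "xyeval (\<Sum>a\<in>A. f a) x y = (\<Sum>a\<in>A. xyeval (f a) x y)"
  by (induction A rule: infinite_finite_induct) auto

lemma xyeval_xy_monom [simp]: "xyeval (xy_monom i j) x y = x ^ i * y ^ j"
  by (simp add: xyeval_def xy_monom_def poly_monom)

lemma xy_monom_00 [simp]: "xy_monom 0 0 = 1"
  by (simp add: xy_monom_def)

lemma xycoeff_1: "xycoeff 1 i j = (if i = 0 \<and> j = 0 then 1 else 0)"
  using xycoeff_xy_monom[of 0 0 i j] by simp

lemma xyeval_1 [simp]: "xyeval 1 x y = 1"
  using xyeval_xy_monom[of 0 0 x y] by simp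

lemma xyeval_power [simp]: "xyeval (P ^ n) x y = xyeval P x y ^ n"
  by (induction n) auto

lemma xyeval_prod: "xyeval (\<Prod>a\<in>A. f a) x y = (\<Prod>a\<in>A. xyeval (f a) x y)"
  by (induction A rule: infinite_finite_induct) auto

lemma finite_exponents_le [simp]: "finite (exponents_le n)"
proof -
  have "exponents_le n \<subseteq> {..n} \<times> {..n}" by (auto simp: exponents_le_def)
  then show ?thesis by (rule finite_subset) simp
qed

lemma card_exponents_le_le: "card (exponents_le n) \<le> (n + 1) ^ 2"
proof -
  have "exponents_le n \<subseteq> {..n} \<times> {..n}" by (auto simp: exponents_le_def)
  then have "card (exponents_le n) \<le> card ({..n} \<times> {..n})" by (rule card_mono[rotated]) simp
  then show ?thesis by (simp add: power2_eq_square)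
qed

lemma card_exponents_le: "2 * card (exponents_le n) = (n + 1) * (n + 2)"
proof (induction n)
  case 0
  have "exponents_le 0 = {(0, 0)}" by (auto simp: exponents_le_def)
  then show ?case by simp
next
  case (Suc n)
  have "exponents_le (Suc n) = exponents_le n \<union> (\<lambda>i. (i, Suc n - i)) ` {..Suc n}"
    by (auto simp: exponents_le_def image_iff)
  moreover have "card ((\<lambda>i. (i, Suc n - i)) ` {..Suc n}) = n + 2"
    by (subst card_image) (auto simp: inj_on_def)
  moreover have "exponents_le n \<inter> (\<lambda>i. (i, Suc n - i)) ` {..Suc n} = {}"
    by (auto simp: exponents_le_def)
  ultimately have "card (exponents_le (Suc n)) = card (exponents_le n) + (n + 2)"
    by (simp add: card_Un_disjoint)
  with Suc show ?case by simp
qed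

lemma tdeg_le_altdef: "tdeg_le n P \<longleftrightarrow> (\<forall>i j. n < i + j \<longrightarrow> xycoeff P i j = 0)"
  unfolding tdeg_le_def using not_le by blast

lemma tdeg_le_0 [simp]: "tdeg_le n 0"
  and tdeg_le_add: "tdeg_le n P \<Longrightarrow> tdeg_le n Q \<Longrightarrow> tdeg_le n (P + Q)"
  and tdeg_le_diff: "tdeg_le n P \<Longrightarrow> tdeg_le n Q \<Longrightarrow> tdeg_le n (P - Q)"
  and tdeg_le_cscale: "tdeg_le n P \<Longrightarrow> tdeg_le n (cscale c P)"
  and tdeg_le_mono: "tdeg_le n P \<Longrightarrow> n \<le> n' \<Longrightarrow> tdeg_le n' P"
  by (auto simp: tdeg_le_altdef)

lemma tdeg_le_sum: "(\<And>a. a \<in> A \<Longrightarrow> tdeg_le n (f a)) \<Longrightarrow> tdeg_le n (\<Sum>a\<in>A. f a)"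
  by (induction A rule: infinite_finite_induct) (auto intro: tdeg_le_add)

lemma tdeg_le_xy_monom: "i + j \<le> n \<Longrightarrow> tdeg_le n (xy_monom i j)"
  by (auto simp: tdeg_le_def xycoeff_xy_monom)

lemma tdeg_le_1 [simp]: "tdeg_le n 1"
  using tdeg_le_xy_monom[of 0 0 n] by simp

lemma sum_nonzero_term: "sum f A \<noteq> (0 :: complex) \<Longrightarrow> \<exists>a\<in>A. f a \<noteq> 0"
  using sum.neutral[of A f] by blast

lemma tdeg_le_mult:
  assumes "tdeg_le m P" "tdeg_le n Q"
  shows "tdeg_le (m + n) (P * Q)"
  unfolding tdeg_le_def
proof (intro allI impI)
  fix i j assume "xycoeff (P * Q) i j \<noteq> 0"
  from sum_nonzero_term[OF this[unfolded xycoeff_mult]] obtain b where b: "b \<le> j" "(\<Sum>a\<le>i. xycoeff P a b * xycoeff Q (i - a) (j - b)) \<noteq> 0"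
    by auto
  then obtain a where a: "a \<le> i" "xycoeff P a b * xycoeff Q (i - a) (j - b) \<noteq> 0"
    using sum_nonzero_term[OF b(2)] by auto
  then have "xycoeff P a b \<noteq> 0" "xycoeff Q (i - a) (j - b) \<noteq> 0" by auto
  then have "a + b \<le> m" "(i - a) + (j - b) \<le> n"
    using assms unfolding tdeg_le_def by blast+
  with a b show "i + j \<le> m + n" by linarith
qed

lemma tdeg_le_power: "tdeg_le n P \<Longrightarrow> tdeg_le (k * n) (P ^ k)"
  by (induction k) (simp_all add: tdeg_le_mult)

lemma tdeg_le_prod:
  "finite A \<Longrightarrow> (\<And>a. a \<in> A \<Longrightarrow> tdeg_le 1 (f a)) \<Longrightarrow> tdeg_le (card A) (\<Prod>a\<in>A. f a)"
proof (induction A rule: finite_induct)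
  case (insert a A)
  then show ?case using tdeg_le_mult[of 1 "f a" "card A"] by simp
qed simp

lemma bpoly_expand:
  assumes "tdeg_le n P"
  shows "P = (\<Sum>(i, j)\<in>exponents_le n. cscale (xycoeff P i j) (xy_monom i j))"
proof (rule bpoly_eqI)
  fix a b
  have "xycoeff (\<Sum>(i, j)\<in>exponents_le n. cscale (xycoeff P i j) (xy_monom i j)) a b
      = (\<Sum>p\<in>exponents_le n. if p = (a, b) then xycoeff P a b else 0)"
    unfolding xycoeff_sum by (intro sum.cong) (auto simp: xycoeff_xy_monom split: if_splits)
  also have "\<dots> = xycoeff P a b"
    using assms by (subst sum.delta[OF finite_exponents_le]) (auto simp: exponents_le_def tdeg_le_def)
  finally show "xycoeff P a b = xycoeff (\<Sum>(i, j)\<in>exponents_le n. cscale (xycoeff P i j) (xy_monom i j)) a b" by simp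
qed

lemma ex_tdeg_le: "\<exists>n. tdeg_le n P"
proof -
  define N where "N = (\<Sum>j\<le>degree P. degree (coeff P j))"
  have "i + j \<le> N + degree P" if "xycoeff P i j \<noteq> 0" for i j
  proof -
    from that have j: "j \<le> degree P" unfolding xycoeff_def
      by (metis coeff_0 coeff_eq_0 not_le)
    have "i \<le> degree (coeff P j)" using that unfolding xycoeff_def by (metis coeff_eq_0 not_le)
    also have "\<dots> \<le> N" unfolding N_def using j by (intro member_le_sum) auto
    finally show ?thesis using j by simp
  qed
  then show ?thesis unfolding tdeg_le_def by blast
qed

lemma xyeval_expand:
  assumes "tdeg_le n P"
  shows "xyeval P x y = (\<Sum>(i, j)\<in>exponents_le n. xycoeff P i j * (x ^ i * y ^ j))"
  by (subst bpoly_expand[OF assms]) (auto simp: xyeval_sum intro!: sum.cong)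

lemma bpoly_xyeval_eqI:
  assumes "\<And>x y. xyeval P x y = xyeval Q x y"
  shows "P = Q"
proof -
  have "poly P [:y:] = poly Q [:y:]" for y
    by (rule poly_eq_poly_eq_iff[THEN iffD1]) (use assms in \<open>auto simp: xyeval_def fun_eq_iff\<close>)
  then have "range (\<lambda>y. [:y:]) \<subseteq> {z. poly (P - Q) z = 0}" by auto
  moreover have "infinite (range (\<lambda>y::complex. [:y:]))"
    using finite_imageD[of "\<lambda>y::complex. [:y:]" UNIV] by (auto simp: inj_def infinite_UNIV_char_0)
  ultimately have "infinite {z. poly (P - Q) z = 0}" by (rule infinite_super)
  then have "P - Q = 0" using poly_roots_finite by blast
  then show ?thesis by simp
qed

text \<open>
  The restriction to the line \<open>y = c x\<close>.
\<close>
definition on_line :: "complex \<Rightarrow> bpoly \<Rightarrow> complex poly" where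
  "on_line c P = poly P [:0, c:]"

lemma on_line_mult: "on_line c (P * Q) = on_line c P * on_line c Q"
  by (simp add: on_line_def)

lemma coeff_on_line:
  assumes "tdeg_le n P"
  shows "coeff (on_line c P) k = (\<Sum>(i, j)\<in>exponents_le n. if i + j = k then xycoeff P i j * c ^ j else 0)"
proof -
  have m: "on_line c (cscale u (xy_monom i j)) = monom (u * c ^ j) (i + j)" for u i j
  proof -
    have "[:0, c:] ^ j = monom (c ^ j) j"
      by (metis monom_0 monom_Suc monom_power mult.left_neutral power_one_right One_nat_def pCons_0_0 mult_1_right)
    then show ?thesis
      by (simp add: on_line_def cscale_def xy_monom_def poly_monom mult_monom Polynomial.smult_monom)
  qed
  have "on_line c P = (\<Sum>(i, j)\<in>exponents_le n. monom (xycoeff P i j * c ^ j) (i + j))"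
    by (subst bpoly_expand[OF assms]) (simp add: on_line_def poly_sum m[unfolded on_line_def] case_prod_beta)
  then show ?thesis
    by (auto simp: coeff_sum intro!: sum.cong)
qed

lemma degree_on_line_le: "tdeg_le n P \<Longrightarrow> degree (on_line c P) \<le> n"
  by (rule degree_le) (auto simp: coeff_on_line exponents_le_def intro!: sum.neutral)

lemma coeff_on_line_generic:
  assumes "tdeg_le n P" "i + j = n" "xycoeff P i j \<noteq> 0"
  shows "finite {c. coeff (on_line c P) n = 0}"
proof -
  define T where "T = (\<Sum>(i, j)\<in>exponents_le n. if i + j = n then monom (xycoeff P i j) j else 0)"
  have "coeff T j = (\<Sum>p\<in>exponents_le n. if p = (i, j) then xycoeff P i j else 0)"
    unfolding T_def coeff_sum using assms(2) by (intro sum.cong) (auto split: if_splits)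
  also have "\<dots> = xycoeff P i j" using assms by (subst sum.delta[OF finite_exponents_le]) (auto simp: exponents_le_def)
  finally have "T \<noteq> 0" using assms(3) by auto
  then have "finite {c. poly T c = 0}" by (rule poly_roots_finite)
  moreover have "poly T c = coeff (on_line c P) n" for c
    unfolding T_def coeff_on_line[OF assms(1)] poly_sum
    by (auto simp: poly_monom intro!: sum.cong)
  ultimately show ?thesis by simp
qed

lemma exact_tdeg:
  assumes "P \<noteq> 0"
  obtains n i j where "tdeg_le n P" "i + j = n" "xycoeff P i j \<noteq> 0"
proof -
  define n where "n = (LEAST n. tdeg_le n P)"
  have n: "tdeg_le n P" unfolding n_def using ex_tdeg_le by (rule LeastI_ex)
  have "\<exists>i j. i + j = n \<and> xycoeff P i j \<noteq> 0"
  proof (rule ccontr)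
    assume none: "\<not> ?thesis"
    obtain i j where ij: "xycoeff P i j \<noteq> 0" using assms bpoly_eqI[of P 0] by auto
    have "n > 0" using none ij n by (cases "n = 0") (auto simp: tdeg_le_def)
    have "tdeg_le (n - 1) P" unfolding tdeg_le_def
    proof (intro allI impI)
      fix i j assume "xycoeff P i j \<noteq> 0"
      with none n have "i + j \<le> n" "i + j \<noteq> n" by (auto simp: tdeg_le_def)
      then show "i + j \<le> n - 1" by simp
    qed
    then have "n \<le> n - 1" unfolding n_def by (rule Least_le)
    with \<open>n > 0\<close> show False by simp
  qed
  with n that show thesis by blast
qed

text \<open>
  The total degree of \<open>P\<close> is the degree of \<open>P(x, c x)\<close> for all but finitely many \<open>c\<close>. So the additivity
  of total degrees under products follows from the case of one variable, by restriction to a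
  line that is generic for both factors.
\<close>
lemma tdeg_le_cofactor:
  assumes "tdeg_le e (f * R)" "tdeg_le m f" "i + j = m" "xycoeff f i j \<noteq> 0" "R \<noteq> 0"
  shows "m \<le> e \<and> tdeg_le (e - m) R"
proof -
  obtain k i' j' where k: "tdeg_le k R" "i' + j' = k" "xycoeff R i' j' \<noteq> 0"
    using exact_tdeg[OF assms(5)] .
  have "finite ({c. coeff (on_line c f) m = 0} \<union> {c. coeff (on_line c R) k = 0})"
    using coeff_on_line_generic[OF assms(2-4)] coeff_on_line_generic[OF k] by simp
  from ex_new_if_finite[OF infinite_UNIV_char_0 this] obtain c
    where c: "coeff (on_line c f) m \<noteq> 0" "coeff (on_line c R) k \<noteq> 0"
    by auto
  have "degree (on_line c f) = m"
    using degree_on_line_le[OF assms(2)] le_degree[OF c(1)] by (metis le_antisym)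
  moreover have "degree (on_line c R) = k"
    using degree_on_line_le[OF k(1)] le_degree[OF c(2)] by (metis le_antisym)
  moreover have "on_line c f \<noteq> 0" "on_line c R \<noteq> 0" using c by auto
  ultimately have "degree (on_line c (f * R)) = m + k"
    by (simp add: on_line_mult degree_mult_eq)
  with degree_on_line_le[OF assms(1)] have "m + k \<le> e" by metis
  with k(1) show ?thesis by (auto intro: tdeg_le_mono)
qed

text \<open>
  The Taylor expansion at \<open>(s, t)\<close>, that is \<open>P(x + s, y + t)\<close>.
\<close>
definition shift :: "complex \<Rightarrow> complex \<Rightarrow> bpoly \<Rightarrow> bpoly" where
  "shift s t P = pcompose (map_poly (\<lambda>c. pcompose c [:s, 1:]) P) [:[:t:], 1:]"

lemma xyeval_shift: "xyeval (shift s t P) x y = xyeval P (x + s) (y + t)"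
proof -
  have "poly (map_poly (\<lambda>c. pcompose c [:s, 1:]) P) [:w:] = pcompose (poly P [:w:]) [:s, 1:]" for w
    by (induction P) (auto simp: map_poly_pCons pcompose_add pcompose_mult pcompose_pCons pcompose_smult)
  then show ?thesis
    by (simp add: xyeval_def shift_def poly_pcompose add.commute)
qed

lemma shift_add [simp]: "shift s t (P + Q) = shift s t P + shift s t Q"
  and shift_diff [simp]: "shift s t (P - Q) = shift s t P - shift s t Q"
  and shift_mult [simp]: "shift s t (P * Q) = shift s t P * shift s t Q"
  and shift_cscale [simp]: "shift s t (cscale c P) = cscale c (shift s t P)"
  and shift_0 [simp]: "shift s t 0 = 0"
  and shift_shift: "shift s t (shift s' t' P) = shift (s + s') (t + t') P"
  and shift_id [simp]: "shift 0 0 P = P"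
  by (rule bpoly_xyeval_eqI, simp add: xyeval_shift add.assoc)+

lemma shift_sum: "shift s t (\<Sum>a\<in>A. f a) = (\<Sum>a\<in>A. shift s t (f a))"
  by (induction A rule: infinite_finite_induct) auto

text \<open>
  The coefficient of \<open>u^a v^b\<close> in \<open>(s + u)^i (t + v)^j\<close>, that is, the value at \<open>(s, t)\<close> of a divided
  partial derivative of \<open>x^i y^j\<close>.
\<close>
definition hasse :: "nat \<Rightarrow> nat \<Rightarrow> nat \<Rightarrow> nat \<Rightarrow> complex \<Rightarrow> complex \<Rightarrow> complex" where
  "hasse i j a b s t = of_nat ((i choose a) * (j choose b)) * (s ^ (i - a) * t ^ (j - b))"

lemma xycoeff_shift_xy_monom: "xycoeff (shift s t (xy_monom i j)) a b = hasse i j a b s t"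
proof -
  have "shift s t (xy_monom i j) =
      (\<Sum>a\<le>i. \<Sum>b\<le>j. cscale (hasse i j a b s t) (xy_monom a b))"
    by (rule bpoly_xyeval_eqI)
      (simp add: xyeval_shift xyeval_sum binomial_ring sum_product hasse_def mult_ac)
  then have "xycoeff (shift s t (xy_monom i j)) a b =
      (\<Sum>a'\<le>i. \<Sum>b'\<le>j. if a' = a \<and> b' = b then hasse i j a b s t else 0)"
    by (auto simp: xycoeff_sum xycoeff_xy_monom intro!: sum.cong)
  also have "\<dots> = (\<Sum>a'\<le>i. if a' = a then (\<Sum>b'\<le>j. if b' = b then hasse i j a b s t else 0) else 0)"
    by (intro sum.cong) (auto intro!: sum.neutral sum.cong)
  also have "\<dots> = hasse i j a b s t"
    by (auto simp: hasse_def binomial_eq_0)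
  finally show ?thesis .
qed

lemma xycoeff_shift:
  assumes "tdeg_le n P"
  shows "xycoeff (shift s t P) a b = (\<Sum>(i, j)\<in>exponents_le n. xycoeff P i j * hasse i j a b s t)"
  by (subst bpoly_expand[OF assms]) (auto simp: shift_sum xycoeff_sum xycoeff_shift_xy_monom intro!: sum.cong)

lemma tdeg_le_shift:
  assumes "tdeg_le n P"
  shows "tdeg_le n (shift s t P)"
  unfolding tdeg_le_def
proof (intro allI impI)
  fix a b assume "xycoeff (shift s t P) a b \<noteq> 0"
  then obtain p where "p \<in> exponents_le n" "(case p of (i, j) \<Rightarrow> xycoeff P i j * hasse i j a b s t) \<noteq> 0"
    using sum_nonzero_term unfolding xycoeff_shift[OF assms] by blast
  then obtain i j where ij: "i + j \<le> n" "hasse i j a b s t \<noteq> 0"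
    by (cases p) (auto simp: exponents_le_def)
  then have "a \<le> i" "b \<le> j" by (auto simp: hasse_def binomial_eq_0_iff not_less)
  with ij(1) show "a + b \<le> n" by linarith
qed

text \<open>
  Membership in the \<open>n\<close>-th power of the maximal ideal of the point \<open>s\<close>.
\<close>
definition vanish_order :: "nat \<Rightarrow> complex \<times> complex \<Rightarrow> bpoly \<Rightarrow> bool" where
  "vanish_order n s P \<longleftrightarrow> (\<forall>a b. a + b < n \<longrightarrow> xycoeff (shift (fst s) (snd s) P) a b = 0)"

lemma vanish_order_0 [simp]: "vanish_order 0 s P"
  and vanish_order_zero [simp]: "vanish_order n s 0"
  and vanish_order_add: "vanish_order n s P \<Longrightarrow> vanish_order n s Q \<Longrightarrow> vanish_order n s (P + Q)"
  and vanish_order_diff: "vanish_order n s P \<Longrightarrow> vanish_order n s Q \<Longrightarrow> vanish_order n s (P - Q)"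
  and vanish_order_cscale: "vanish_order n s P \<Longrightarrow> vanish_order n s (cscale c P)"
  and vanish_order_mono: "vanish_order n s P \<Longrightarrow> n' \<le> n \<Longrightarrow> vanish_order n' s P"
  by (auto simp: vanish_order_def)

lemma vanish_order_mult:
  assumes "vanish_order m s P" "vanish_order n s Q"
  shows "vanish_order (m + n) s (P * Q)"
  unfolding vanish_order_def shift_mult
proof (intro allI impI)
  fix i j :: nat assume ij: "i + j < m + n"
  show "xycoeff (shift (fst s) (snd s) P * shift (fst s) (snd s) Q) i j = 0"
    unfolding xycoeff_mult
  proof (intro sum.neutral ballI)
    fix b a assume ba: "b \<in> {..j}" "a \<in> {..i}"
    have "a + b < m \<or> (i - a) + (j - b) < n" using ij ba by auto
    then show "xycoeff (shift (fst s) (snd s) P) a b * xycoeff (shift (fst s) (snd s) Q) (i - a) (j - b) = 0"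
      using assms by (auto simp: vanish_order_def)
  qed
qed

lemma vanish_order_power: "vanish_order 1 s P \<Longrightarrow> vanish_order n s (P ^ n)"
  by (induction n) (auto dest: vanish_order_mult)

lemma xycoeff_shift_00: "xycoeff (shift s t P) 0 0 = xyeval P s t"
proof -
  have "xycoeff Q 0 0 = xyeval Q 0 0" for Q by (simp add: xycoeff_def xyeval_def poly_0_coeff_0)
  then show ?thesis by (simp add: xyeval_shift)
qed

lemma vanish_order_1: "vanish_order 1 s P \<longleftrightarrow> xyeval P (fst s) (snd s) = 0"
  by (auto simp: vanish_order_def xycoeff_shift_00)

lemma vanish_order_shift:
  "vanish_order n (s, t) (shift u v P) \<longleftrightarrow> vanish_order n (s + u, t + v) P"
  by (simp add: vanish_order_def shift_shift)

definition swap_xy :: "bpoly \<Rightarrow> bpoly" where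
  "swap_xy P = (\<Sum>j\<le>degree P. \<Sum>i\<le>degree (coeff P j). cscale (xycoeff P i j) (xy_monom j i))"

lemma xycoeff_swap_xy [simp]: "xycoeff (swap_xy P) a b = xycoeff P b a"
proof -
  have z: "xycoeff P i j = 0" if "degree P < j \<or> degree (coeff P j) < i" for i j
    using that by (auto simp: xycoeff_def coeff_eq_0)
  have "xycoeff (swap_xy P) a b = (\<Sum>j\<le>degree P. \<Sum>i\<le>degree (coeff P j).
      if j = a \<and> i = b then xycoeff P i j else 0)"
    unfolding swap_xy_def xycoeff_sum xycoeff_cscale_xy_monom ..
  also have "\<dots> = (\<Sum>j\<le>degree P. if j = a then
      (\<Sum>i\<le>degree (coeff P a). if i = b then xycoeff P b a else 0) else 0)"
    by (intro sum.cong) (auto intro!: sum.cong)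
  also have "\<dots> = xycoeff P b a"
    using z[of a b] z[of b a] by (auto simp: not_le)
  finally show ?thesis .
qed

lemma swap_xy_swap_xy [simp]: "swap_xy (swap_xy P) = P"
  by (rule bpoly_eqI) simp

lemma swap_xy_mult: "swap_xy (P * Q) = swap_xy P * swap_xy Q"
  by (rule bpoly_eqI) (simp add: xycoeff_mult, rule sum.swap)

lemma swap_xy_add: "swap_xy (P + Q) = swap_xy P + swap_xy Q"
  by (rule bpoly_eqI) simp

lemma tdeg_le_swap_xy [simp]: "tdeg_le n (swap_xy P) \<longleftrightarrow> tdeg_le n P"
  unfolding tdeg_le_def xycoeff_swap_xy by (metis add.commute)

lemma swap_xy_eq_0 [simp]: "swap_xy P = 0 \<longleftrightarrow> P = 0"
  by (metis bpoly_eqI xycoeff_0 xycoeff_swap_xy swap_xy_swap_xy)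

lemma swap_xy_dvd [simp]: "swap_xy P dvd swap_xy Q \<longleftrightarrow> P dvd Q"
  by (metis dvd_def swap_xy_mult swap_xy_swap_xy)

lemma swap_xy_1 [simp]: "swap_xy 1 = 1"
  by (rule bpoly_eqI) (metis xycoeff_swap_xy xycoeff_xy_monom xy_monom_00)

lemma irreducible_swap_xy:
  assumes "irreducible P"
  shows "irreducible (swap_xy P)"
proof -
  have u: "swap_xy Q dvd 1 \<longleftrightarrow> Q dvd 1" for Q
    using swap_xy_dvd[of Q 1] by simp
  show ?thesis
  proof (rule irreducibleI)
    fix a b assume "swap_xy P = a * b"
    then have "P = swap_xy a * swap_xy b" by (metis swap_xy_mult swap_xy_swap_xy)
    then show "a dvd 1 \<or> b dvd 1" using assms u by (metis irreducibleD)
  qed (use assms u in \<open>auto simp: irreducible_def\<close>)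
qed

lemma xyeval_swap_xy: "xyeval (swap_xy P) x y = xyeval P y x"
proof -
  obtain n where n: "tdeg_le n P" using ex_tdeg_le by blast
  have "swap_xy P = (\<Sum>p\<in>exponents_le n. cscale (xycoeff P (fst p) (snd p)) (xy_monom (snd p) (fst p)))"
  proof (rule bpoly_eqI)
    fix i j
    have "xycoeff (swap_xy P) i j = xycoeff (\<Sum>p\<in>exponents_le n. cscale (xycoeff P (fst p) (snd p)) (xy_monom (fst p) (snd p))) j i"
      using bpoly_expand[OF n] by (simp add: case_prod_beta)
    then show "xycoeff (swap_xy P) i j = xycoeff (\<Sum>p\<in>exponents_le n. cscale (xycoeff P (fst p) (snd p)) (xy_monom (snd p) (fst p))) i j"
      by (simp add: xycoeff_sum xycoeff_xy_monom conj_commute)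
  qed
  then show ?thesis
    unfolding xyeval_expand[OF n] by (simp add: xyeval_sum case_prod_beta mult_ac)
qed

definition const_y :: "int poly \<Rightarrow> bpoly" where
  "const_y p = [:map_poly of_int p:]"

lemma xycoeff_const_y: "xycoeff (const_y p) i j = (if j = 0 then of_int (coeff p i) else 0)"
  by (simp add: xycoeff_def const_y_def coeff_pCons coeff_map_poly split: nat.split)

lemma xyeval_const_y: "xyeval (const_y p) x y = poly (map_poly of_int p) x"
  by (simp add: xyeval_def const_y_def)

section \<open>Plane curves: vanishing orders and elimination\<close>

lemma homogeneous3_alt:
  "homogeneous3 m F \<longleftrightarrow> (\<forall>i j k. xycoeff (coeff F k) i j \<noteq> 0 \<longrightarrow> i + j + k = m)"
  by (simp add: homogeneous3_def xycoeff_def)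

lemma xycoeff_dehomogenize:
  assumes "homogeneous3 m F"
  shows "xycoeff (poly F 1) i j = (if i + j \<le> m then xycoeff (coeff F (m - i - j)) i j else 0)"
proof -
  have "xycoeff (poly F 1) i j = (\<Sum>k\<le>degree F. xycoeff (coeff F k) i j)"
    by (simp add: poly_altdef xycoeff_sum)
  also have "\<dots> = (\<Sum>k\<le>degree F. if k = m - i - j \<and> i + j \<le> m then xycoeff (coeff F (m - i - j)) i j else 0)"
    using assms unfolding homogeneous3_alt by (intro sum.cong refl) (force split: if_splits)
  also have "\<dots> = (if i + j \<le> m then xycoeff (coeff F (m - i - j)) i j else 0)"
    by (cases "m - i - j \<le> degree F") (auto simp: coeff_eq_0)
  finally show ?thesis .
qed

lemma homogeneous3_eqI:
  assumes "homogeneous3 n G" "homogeneous3 n H" "poly G 1 = poly H 1"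
  shows "G = H"
proof (rule poly_eqI, rule bpoly_eqI)
  fix k i j
  show "xycoeff (coeff G k) i j = xycoeff (coeff H k) i j"
  proof (cases "i + j + k = n")
    case True
    then have "k = n - i - j" "i + j \<le> n" by auto
    then show ?thesis
      using xycoeff_dehomogenize[OF assms(1), of i j] xycoeff_dehomogenize[OF assms(2), of i j] assms(3) by simp
  next
    case False
    then have "xycoeff (coeff G k) i j = 0" "xycoeff (coeff H k) i j = 0"
      using assms(1,2) unfolding homogeneous3_alt by blast+
    then show ?thesis by simp
  qed
qed

lemma homogeneous3_mult:
  assumes "homogeneous3 m G" "homogeneous3 n H"
  shows "homogeneous3 (m + n) (G * H)"
  unfolding homogeneous3_alt
proof (intro allI impI)
  fix i j k assume "xycoeff (coeff (G * H) k) i j \<noteq> 0"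
  from sum_nonzero_term[OF this[unfolded coeff_mult xycoeff_sum]] obtain k'
    where k': "k' \<le> k" "xycoeff (coeff G k' * coeff H (k - k')) i j \<noteq> 0" by auto
  from sum_nonzero_term[OF k'(2)[unfolded xycoeff_mult]] obtain b
    where b: "b \<le> j" "(\<Sum>a\<le>i. xycoeff (coeff G k') a b * xycoeff (coeff H (k - k')) (i - a) (j - b)) \<noteq> 0"
    by auto
  from sum_nonzero_term[OF b(2)] obtain a where a: "a \<le> i"
    "xycoeff (coeff G k') a b \<noteq> 0" "xycoeff (coeff H (k - k')) (i - a) (j - b) \<noteq> 0" by auto
  then have "a + b + k' = m" "(i - a) + (j - b) + (k - k') = n"
    using assms unfolding homogeneous3_alt by blast+
  with k'(1) b(1) a(1) show "i + j + k = m + n" by linarith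
qed

text \<open>
  The homogenization of \<open>g\<close> to degree \<open>n\<close>, meaningful if \<open>g\<close> has total degree at most \<open>n\<close>.
\<close>
definition homogenize :: "nat \<Rightarrow> bpoly \<Rightarrow> poly3" where
  "homogenize n g = (\<Sum>(i, j)\<in>exponents_le n. monom (cscale (xycoeff g i j) (xy_monom i j)) (n - i - j))"

lemma homogeneous3_homogenize: "homogeneous3 n (homogenize n g)"
  unfolding homogeneous3_alt
proof (intro allI impI)
  fix i j k assume "xycoeff (coeff (homogenize n g) k) i j \<noteq> 0"
  then have "(\<Sum>p\<in>exponents_le n. xycoeff (coeff (case p of (i, j) \<Rightarrow>
      monom (cscale (xycoeff g i j) (xy_monom i j)) (n - i - j)) k) i j) \<noteq> 0"
    by (simp add: homogenize_def coeff_sum xycoeff_sum)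
  from sum_nonzero_term[OF this] obtain p where p: "p \<in> exponents_le n"
    "xycoeff (coeff (case p of (i, j) \<Rightarrow> monom (cscale (xycoeff g i j) (xy_monom i j)) (n - i - j)) k) i j \<noteq> 0"
    by blast
  then show "i + j + k = n"
    by (cases p) (auto simp: exponents_le_def coeff_monom xycoeff_xy_monom split: if_splits)
qed

lemma dehomogenize_homogenize:
  assumes "tdeg_le n g"
  shows "poly (homogenize n g) 1 = g"
proof -
  have "poly (homogenize n g) 1 = (\<Sum>(i, j)\<in>exponents_le n. cscale (xycoeff g i j) (xy_monom i j))"
    by (simp add: homogenize_def poly_sum poly_monom case_prod_beta)
  then show ?thesis using bpoly_expand[OF assms] by simp
qed

lemma dehomogenize_unit: "G dvd 1 \<Longrightarrow> poly G 1 dvd (1 :: bpoly)"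
  by (metis dvd_def poly_1 poly_mult)

text \<open>
  A factorization of the affine equation lifts to a factorization of \<open>F\<close> by homogenizing the
  factors to complementary degrees. The affine equation keeps the full degree \<open>m\<close>, since
  otherwise \<open>z\<close> divides \<open>F\<close>; then \<open>F\<close> is the line at infinity, which has no affine point.
\<close>
lemma irreducible_dehomogenize:
  assumes F: "irreducible F" "homogeneous3 m F" and root: "poly3_eval F x0 y0 1 = 0"
  defines "f \<equiv> poly F 1"
  shows "irreducible f" "tdeg_le m f" "\<exists>i j. i + j = m \<and> xycoeff f i j \<noteq> 0" "1 \<le> m"
proof -
  have ev0: "xyeval f x0 y0 = 0"
    using root by (simp add: poly3_eval_def f_def xyeval_def one_pCons)
  have nonunit: "\<not> f dvd 1"
  proof
    assume "f dvd 1"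
    then obtain k where k: "1 = f * k" by (rule dvdE)
    have "xyeval (f * k) x0 y0 = 0" using ev0 by simp
    then show False unfolding k[symmetric] by (simp add: xyeval_def)
  qed
  show tf: "tdeg_le m f"
    unfolding tdeg_le_altdef f_def xycoeff_dehomogenize[OF F(2)] by auto
  have F_hom: "F = homogenize m f"
    using homogeneous3_eqI[OF F(2) homogeneous3_homogenize] dehomogenize_homogenize[OF tf]
    unfolding f_def by simp
  have "F \<noteq> 0" using F(1) by (simp add: irreducible_def)
  then have f0: "f \<noteq> 0" unfolding F_hom by (auto simp: homogenize_def)
  show "irreducible f"
  proof (rule irreducibleI)
    fix g h assume gh: "f = g * h"
    with f0 have "g \<noteq> 0" "h \<noteq> 0" by auto
    obtain a i j where a: "tdeg_le a g" "i + j = a" "xycoeff g i j \<noteq> 0"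
      using exact_tdeg[OF \<open>g \<noteq> 0\<close>] .
    have ah: "a \<le> m" "tdeg_le (m - a) h"
      using tdeg_le_cofactor[OF tf[unfolded gh] a \<open>h \<noteq> 0\<close>] by auto
    have "F = homogenize a g * homogenize (m - a) h"
    proof (rule homogeneous3_eqI[OF F(2)])
      show "homogeneous3 m (homogenize a g * homogenize (m - a) h)"
        using homogeneous3_mult[OF homogeneous3_homogenize[of a g] homogeneous3_homogenize[of "m - a" h]] ah
        by simp
      show "poly F 1 = poly (homogenize a g * homogenize (m - a) h) 1"
        using a ah gh by (simp add: dehomogenize_homogenize f_def)
    qed
    then have "homogenize a g dvd 1 \<or> homogenize (m - a) h dvd 1"
      using F(1) by (rule irreducibleD[rotated])
    then show "g dvd 1 \<or> h dvd 1"
      using dehomogenize_unit dehomogenize_homogenize[OF a(1)] dehomogenize_homogenize[OF ah(2)]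
      by metis
  qed (use f0 nonunit in auto)
  show exact: "\<exists>i j. i + j = m \<and> xycoeff f i j \<noteq> 0"
  proof (rule ccontr)
    assume none: "\<not> ?thesis"
    then have none': "xycoeff f i j = 0" if "i + j = m" for i j using that by blast
    have "m \<noteq> 0"
    proof
      assume "m = 0"
      then have "xycoeff f i j = 0" for i j
        using none'[of i j] tf[unfolded tdeg_le_altdef] by (cases "i + j = 0") auto
      then show False using f0 bpoly_eqI[of f 0] by simp
    qed
    have t1: "tdeg_le (m - 1) f"
      using tf none' \<open>m \<noteq> 0\<close> unfolding tdeg_le_altdef
      by (metis Suc_diff_1 linorder_neqE_nat not_less_eq not_gr_zero)
    have "homogeneous3 1 [:0, 1:]"
      by (auto simp: homogeneous3_alt coeff_pCons xycoeff_1 split: nat.splits if_splits)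
    then have "homogeneous3 (1 + (m - 1)) ([:0, 1:] * homogenize (m - 1) f)"
      by (rule homogeneous3_mult[OF _ homogeneous3_homogenize])
    then have "F = [:0, 1:] * homogenize (m - 1) f"
      using \<open>m \<noteq> 0\<close> dehomogenize_homogenize[OF t1]
      by (intro homogeneous3_eqI[OF F(2)]) (simp_all add: f_def)
    then have "[:0, 1:] dvd (1 :: poly3) \<or> homogenize (m - 1) f dvd 1"
      using F(1) by (rule irreducibleD[rotated])
    then show False
    proof
      assume "[:0, 1:] dvd (1 :: poly3)"
      then obtain q :: poly3 where "1 = [:0, 1:] * q" by (rule dvdE)
      then have "poly (1 :: poly3) 0 = poly ([:0, 1:] * q) 0" by metis
      then show False by simp
    next
      assume "homogenize (m - 1) f dvd 1"
      then show False using dehomogenize_unit dehomogenize_homogenize[OF t1] nonunit by metis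
    qed
  qed
  show "1 \<le> m"
  proof (rule ccontr)
    assume "\<not> 1 \<le> m"
    then have m: "m = 0" by simp
    have "f = cscale (xycoeff f 0 0) 1"
      by (rule bpoly_eqI) (use tf m in \<open>auto simp: tdeg_le_altdef xycoeff_xy_monom xy_monom_00[symmetric] simp del: xy_monom_00\<close>)
    moreover have "xycoeff f 0 0 \<noteq> 0" using exact m by auto
    ultimately have "xyeval f x0 y0 \<noteq> 0" by (metis xyeval_cscale xyeval_xy_monom mult_1_right power_0 xy_monom_00)
    with ev0 show False by simp
  qed
qed

definition smooth_at :: "bpoly \<Rightarrow> complex \<times> complex \<Rightarrow> bool" where
  "smooth_at f s \<longleftrightarrow> xycoeff (shift (fst s) (snd s) f) 1 0 \<noteq> 0 \<or> xycoeff (shift (fst s) (snd s) f) 0 1 \<noteq> 0"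

lemma vanish_order_origin: "vanish_order n (0, 0) P \<longleftrightarrow> (\<forall>i j. i + j < n \<longrightarrow> xycoeff P i j = 0)"
  by (simp add: vanish_order_def)

text \<open>
  The algebraic form of the fact that vanishing order along a smooth branch rises by one at the
  cost of one condition. The forms of degree \<open>k\<close> modulo the multiples of the linear part \<open>L\<close> of \<open>f\<close>
  have dimension one: \<open>\<mu>1\<close>, \<open>\<mu>2\<close> and the \<open>k\<close> coefficients of a form \<open>B\<close> of degree \<open>k - 1\<close> are
  \<open>k + 2\<close> unknowns for the \<open>k + 1\<close> coefficients of degree \<open>k\<close>. A solution with \<open>\<mu>1 = \<mu>2 = 0\<close> would
  give \<open>B L = 0\<close> with \<open>B \<noteq> 0\<close>, which is impossible because \<open>L \<noteq> 0\<close> by smoothness.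
\<close>
lemma leading_form_elimination:
  assumes Q: "vanish_order k (0, 0) Q1" "vanish_order k (0, 0) Q2"
    and f: "vanish_order 1 (0, 0) f" "xycoeff f 1 0 \<noteq> 0 \<or> xycoeff f 0 1 \<noteq> 0"
  shows "\<exists>\<mu>1 \<mu>2 B. (\<mu>1 \<noteq> 0 \<or> \<mu>2 \<noteq> 0) \<and> tdeg_le k B \<and> vanish_order (k - 1) (0, 0) B \<and>
           vanish_order (Suc k) (0, 0) (cscale \<mu>1 Q1 + cscale \<mu>2 Q2 - B * f)"
proof -
  define c where "c r i = (case i of 0 \<Rightarrow> xycoeff Q1 r (k - r) | Suc 0 \<Rightarrow> xycoeff Q2 r (k - r)
     | Suc (Suc i) \<Rightarrow> - xycoeff (xy_monom i (k - 1 - i) * f) r (k - r))" for r i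
  have "\<exists>x. (\<exists>i\<in>{..<Suc (Suc k)}. x i \<noteq> 0) \<and> (\<forall>i. i \<notin> {..<Suc (Suc k)} \<longrightarrow> x i = 0) \<and>
      (\<forall>r\<in>{..k}. (\<Sum>i<Suc (Suc k). c r i * x i) = 0)"
    by (rule underdetermined_system_solvable) auto
  then obtain x where x: "\<exists>i\<in>{..<Suc (Suc k)}. x i \<noteq> 0"
    "\<And>r. r \<le> k \<Longrightarrow> (\<Sum>i<Suc (Suc k). c r i * x i) = 0" by (metis atMost_iff)
  define B where "B = (\<Sum>i<k. cscale (x (Suc (Suc i))) (xy_monom i (k - 1 - i)))"
  have cfB: "xycoeff B i j = (if i + j + 1 = k then x (Suc (Suc i)) else 0)" for i j
  proof -
    have "xycoeff B i j = (\<Sum>l<k. if l = i then (if i + j + 1 = k then x (Suc (Suc i)) else 0) else 0)"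
      unfolding B_def xycoeff_sum xycoeff_cscale_xy_monom by (intro sum.cong) auto
    also have "\<dots> = (if i + j + 1 = k then x (Suc (Suc i)) else 0)"
      by (subst sum.delta) auto
    finally show ?thesis .
  qed
  have B1: "tdeg_le (k - 1) B" "vanish_order (k - 1) (0, 0) B"
    by (auto simp: tdeg_le_altdef vanish_order_origin cfB)
  have Bf: "vanish_order k (0, 0) (B * f)"
  proof (cases k)
    case 0
    then show ?thesis by simp
  next
    case (Suc k')
    then show ?thesis using vanish_order_mult[OF B1(2) f(1)] by simp
  qed
  have Bf_eq: "B * f = (\<Sum>i<k. cscale (x (Suc (Suc i))) (xy_monom i (k - 1 - i) * f))"
    by (simp add: B_def sum_distrib_right cscale_mult_left)
  define W where "W = cscale (x 0) Q1 + cscale (x 1) Q2 - B * f"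
  have W1: "vanish_order k (0, 0) W"
    unfolding W_def using Q Bf by (intro vanish_order_diff vanish_order_add vanish_order_cscale)
  have W2: "xycoeff W r j = 0" if "r + j = k" for r j
  proof -
    have j: "j = k - r" "r \<le> k" using that by auto
    have "xycoeff W r (k - r) = (\<Sum>i<Suc (Suc k). c r i * x i)"
      by (subst sum.lessThan_Suc_shift, subst sum.lessThan_Suc_shift)
        (simp add: W_def c_def Bf_eq xycoeff_sum sum_negf mult.commute)
    with x(2) j show ?thesis by simp
  qed
  have W: "vanish_order (Suc k) (0, 0) W"
    using W1 W2 by (auto simp: vanish_order_origin less_Suc_eq)
  have "x 0 \<noteq> 0 \<or> x 1 \<noteq> 0"
  proof (rule ccontr)
    assume "\<not> ?thesis"
    then have x0: "x 0 = 0" "x 1 = 0" by auto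
    then have "vanish_order (Suc k) (0, 0) (0 - W)" "0 - W = B * f"
      using vanish_order_diff[OF vanish_order_zero W] by (auto simp: W_def)
    then have Bf': "vanish_order (Suc k) (0, 0) (B * f)" by simp
    have "B \<noteq> 0"
    proof -
      obtain i where i: "i < Suc (Suc k)" "x i \<noteq> 0" using x(1) by auto
      with x0 obtain i' where "i = Suc (Suc i')"
        by (metis One_nat_def not0_implies_Suc)
      with i have "i' + (k - 1 - i') + 1 = k" "x (Suc (Suc i')) \<noteq> 0" by auto
      then have "xycoeff B i' (k - 1 - i') \<noteq> 0" by (simp add: cfB)
      then show ?thesis by auto
    qed
    then have k: "k \<noteq> 0" by (auto simp: B_def)
    define L where "L = cscale (xycoeff f 1 0) (xy_monom 1 0) + cscale (xycoeff f 0 1) (xy_monom 0 1)"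
    have cfL: "xycoeff L i j = (if i = 1 \<and> j = 0 then xycoeff f 1 0 else if i = 0 \<and> j = 1 then xycoeff f 0 1 else 0)" for i j
      by (simp add: L_def xycoeff_xy_monom)
    have "xycoeff (f - L) i j = 0" if "i + j < 2" for i j
    proof -
      from that have "(i = 0 \<and> j = 0) \<or> (i = 1 \<and> j = 0) \<or> (i = 0 \<and> j = 1)" by auto
      then show ?thesis using f(1) by (auto simp: cfL vanish_order_origin)
    qed
    then have "vanish_order 2 (0, 0) (f - L)" by (simp add: vanish_order_origin)
    from vanish_order_mult[OF B1(2) this] have "vanish_order (Suc k) (0, 0) (B * (f - L))"
      using k by simp
    from vanish_order_diff[OF Bf' this] have v: "vanish_order (Suc k) (0, 0) (B * L)"
      by (simp add: algebra_simps)
    have "tdeg_le 1 L" by (auto simp: tdeg_le_altdef cfL)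
    from tdeg_le_mult[OF B1(1) this] have "tdeg_le k (B * L)" using k by simp
    with v have "xycoeff (B * L) i j = 0" for i j
      unfolding vanish_order_origin tdeg_le_altdef by (metis less_Suc_eq_le not_less)
    then have "B * L = 0" by (intro bpoly_eqI) simp
    with \<open>B \<noteq> 0\<close> have "L = 0" by simp
    then have "xycoeff L 1 0 = 0" "xycoeff L 0 1 = 0" by simp_all
    with f(2) show False by (simp add: cfL)
  qed
  moreover have "tdeg_le k B" using B1(1) by (rule tdeg_le_mono) simp
  ultimately show ?thesis using B1(2) W unfolding W_def by blast
qed

lemma leading_form_elimination_at:
  assumes Q: "vanish_order k s Q1" "vanish_order k s Q2"
    and f: "vanish_order 1 s f" "smooth_at f s"
  shows "\<exists>\<mu>1 \<mu>2 B. (\<mu>1 \<noteq> 0 \<or> \<mu>2 \<noteq> 0) \<and> tdeg_le k B \<and> vanish_order (k - 1) s B \<and>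
           vanish_order (Suc k) s (cscale \<mu>1 Q1 + cscale \<mu>2 Q2 - B * f)"
proof -
  obtain u v where s: "s = (u, v)" by force
  have tr: "vanish_order n (0, 0) (shift u v P) \<longleftrightarrow> vanish_order n s P" for n P
    by (simp add: vanish_order_shift s)
  obtain \<mu>1 \<mu>2 B where B: "\<mu>1 \<noteq> 0 \<or> \<mu>2 \<noteq> 0" "tdeg_le k B" "vanish_order (k - 1) (0, 0) B"
     "vanish_order (Suc k) (0, 0) (cscale \<mu>1 (shift u v Q1) + cscale \<mu>2 (shift u v Q2) - B * shift u v f)"
    using leading_form_elimination[of k "shift u v Q1" "shift u v Q2" "shift u v f"] assms
    by (auto simp: tr smooth_at_def s)
  define C where "C = shift (- u) (- v) B"
  have C: "B = shift u v C" by (simp add: C_def shift_shift)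
  have "vanish_order (Suc k) s (cscale \<mu>1 Q1 + cscale \<mu>2 Q2 - C * f)"
    using B(4) unfolding tr[symmetric] C by simp
  moreover have "vanish_order (k - 1) s C" using B(3) unfolding C tr .
  moreover have "tdeg_le k C" unfolding C_def using B(2) by (rule tdeg_le_shift)
  ultimately show ?thesis using B(1) by blast
qed

text \<open>
  A product of linear polynomials, one for each of the other points.
\<close>
lemma separating_polynomial:
  fixes S :: "(complex \<times> complex) set"
  assumes "finite S" "s \<in> S"
  obtains E where "tdeg_le (card S) E" "xyeval E (fst s) (snd s) = 1"
    "\<And>t. t \<in> S \<Longrightarrow> t \<noteq> s \<Longrightarrow> xyeval E (fst t) (snd t) = 0"
proof -
  define l where "l t = (if fst t \<noteq> fst s
      then cscale (1 / (fst s - fst t)) (xy_monom 1 0 - cscale (fst t) 1)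
      else cscale (1 / (snd s - snd t)) (xy_monom 0 1 - cscale (snd t) 1))" for t
  define E where "E = (\<Prod>t\<in>S - {s}. l t)"
  have l: "xyeval (l t) (fst s) (snd s) = 1" if "t \<noteq> s" for t
    using that by (auto simp: l_def prod_eq_iff)
  have l0: "xyeval (l t) (fst t) (snd t) = 0" for t
    by (auto simp: l_def)
  have "tdeg_le 1 (l t)" for t
    by (auto simp: l_def intro!: tdeg_le_cscale tdeg_le_diff tdeg_le_xy_monom)
  then have "tdeg_le (card (S - {s})) E"
    unfolding E_def using assms by (intro tdeg_le_prod) auto
  then have "tdeg_le (card S) E"
    by (rule tdeg_le_mono) (simp add: card_mono assms)
  moreover have "xyeval E (fst s) (snd s) = 1"
    unfolding E_def xyeval_prod by (intro prod.neutral) (auto simp: l)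
  moreover have "xyeval E (fst t) (snd t) = 0" if "t \<in> S" "t \<noteq> s" for t
    unfolding E_def xyeval_prod using that assms l0 by (intro prod_zero bexI[of _ t]) auto
  ultimately show thesis by (rule that)
qed

text \<open>
  By \<open>leading_form_elimination\<close> the \<open>d\<close> points impose \<open>n d\<close> conditions modulo \<open>f\<close>. They are added
  one at a time: in the proof, \<open>K t\<close> consists of the polynomials whose order modulo \<open>f\<close> is at least
  \<open>n\<close> at the first \<open>t div n\<close> points, \<open>t mod n\<close> at the next one and \<open>0\<close> at the others, so
  that each step of the chain imposes one condition. If every element of \<open>K (n * d)\<close> were a
  multiple \<open>f R\<close>, then the chain could be continued by killing the coefficients of \<open>R\<close> one by one; by
  \<open>count\<close> a nonzero polynomial would survive, although its cofactor \<open>R\<close> is zero.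
\<close>
lemma auxiliary_curve:
  fixes S :: "(complex \<times> complex) set"
  assumes S: "finite S" "card S = d"
    and f: "tdeg_le m f" "i0 + j0 = m" "xycoeff f i0 j0 \<noteq> 0"
    and fS: "\<And>s. s \<in> S \<Longrightarrow> xyeval f (fst s) (snd s) = 0" "\<And>s. s \<in> S \<Longrightarrow> smooth_at f s"
    and count: "n * d + card (exponents_le (e - m)) < card (exponents_le e)" and n: "1 \<le> n"
  shows "\<exists>h A. tdeg_le e h \<and> \<not> f dvd h \<and> tdeg_le (n * (d + 1)) A \<and>
           (\<forall>s\<in>S. vanish_order n s (h - A * f))"
proof (rule ccontr)
  assume contr: "\<not> ?thesis"
  have f0: "f \<noteq> 0" using f(3) by auto
  obtain g where g: "bij_betw g {0..<d} S"
    using ex_bij_betw_nat_finite[OF S(1)] S(2) by blast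
  have gS: "g i \<in> S" if "i < d" for i using g that by (auto simp: bij_betw_def)
  have ginj: "g i \<noteq> g j" if "i < d" "j < d" "i \<noteq> j" for i j
    using g that by (auto simp: bij_betw_def inj_on_def)
  have gsurj: "\<exists>i<d. g i = s" if "s \<in> S" for s
    using g that by (auto simp: bij_betw_def image_iff)
  obtain q where q: "bij_betw q {0..<card (exponents_le (e - m))} (exponents_le (e - m))"
    using ex_bij_betw_nat_finite[OF finite_exponents_le] by blast
  define D where "D = n * (d + 1)"
  define Pc where "Pc c = (\<Sum>p\<in>exponents_le e. cscale (c p) (xy_monom (fst p) (snd p)))"
    for c :: "nat \<times> nat \<Rightarrow> complex"
  have Pc_lin: "Pc (\<lambda>p. a * x p + b * y p) = cscale a (Pc x) + cscale b (Pc y)" for a b x y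
    by (simp add: Pc_def cscale_sum cscale_cscale cscale_add_left sum.distrib)
  have Pc_deg: "tdeg_le e (Pc c)" for c
    unfolding Pc_def by (intro tdeg_le_sum tdeg_le_cscale tdeg_le_xy_monom) (auto simp: exponents_le_def)
  have Pc_xycoeff: "xycoeff (Pc c) i j = c (i, j)" if "(i, j) \<in> exponents_le e" for c i j
  proof -
    have "xycoeff (Pc c) i j = (\<Sum>p\<in>exponents_le e. if p = (i, j) then c (i, j) else 0)"
      unfolding Pc_def xycoeff_sum xycoeff_cscale_xy_monom by (intro sum.cong) (auto simp: prod_eq_iff)
    then show ?thesis using that by simp
  qed
  define K where "K t = {c. \<exists>A. tdeg_le D A \<and>
      (\<forall>i<d. vanish_order (min n (t - n * i)) (g i) (Pc c - A * f))}" for t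
  define J where "J t = (if t \<le> n * d then K t else {c. \<exists>R. Pc c = f * R \<and>
      (\<forall>l<t - n * d. xycoeff R (fst (q l)) (snd (q l)) = 0)})" for t
  have Kdvd: "f dvd Pc c" if "c \<in> K (n * d)" for c
  proof -
    from that obtain A where A: "tdeg_le D A"
      "\<forall>i<d. vanish_order (min n (n * d - n * i)) (g i) (Pc c - A * f)" by (auto simp: K_def)
    have "vanish_order n s (Pc c - A * f)" if "s \<in> S" for s
    proof -
      obtain i where i: "i < d" "g i = s" using gsurj \<open>s \<in> S\<close> by blast
      have "n * d - n * i = n * (d - i)" by (simp add: diff_mult_distrib2)
      moreover have "n * 1 \<le> n * (d - i)" using i(1) by (intro mult_left_mono) auto
      ultimately have "min n (n * d - n * i) = n" by simp
      with A(2) i show ?thesis by metis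
    qed
    with contr A(1) Pc_deg show ?thesis unfolding D_def by blast
  qed
  have "\<exists>c\<in>J (n * d + card (exponents_le (e - m))). (\<exists>p\<in>exponents_le e. c p \<noteq> 0) \<and>
      (\<forall>p. p \<notin> exponents_le e \<longrightarrow> c p = 0)"
  proof (rule nontrivial_combination_in_chain)
    show "J 0 = UNIV"
      by (auto simp: J_def K_def intro!: exI[of _ 0])
    fix t x y
    assume t: "t < n * d + card (exponents_le (e - m))" and xy: "x \<in> J t" "y \<in> J t"
    show "\<exists>a b. (a \<noteq> 0 \<or> b \<noteq> 0) \<and> (\<lambda>p. a * x p + b * y p) \<in> J (Suc t)"
    proof (cases "t < n * d")
      case True
      then have "x \<in> K t" "y \<in> K t" using xy by (auto simp: J_def)
      then obtain A1 A2 where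
        A1: "tdeg_le D A1" "\<And>i. i < d \<Longrightarrow> vanish_order (min n (t - n * i)) (g i) (Pc x - A1 * f)" and
        A2: "tdeg_le D A2" "\<And>i. i < d \<Longrightarrow> vanish_order (min n (t - n * i)) (g i) (Pc y - A2 * f)"
        by (auto simp: K_def)
      define l k where "l = t div n" and "k = t mod n"
      have tlk: "t = n * l + k" "k < n" using n by (auto simp: l_def k_def)
      have "l < d" using True n unfolding l_def by (simp add: less_mult_imp_div_less mult.commute)
      define Q1 Q2 where "Q1 = Pc x - A1 * f" and "Q2 = Pc y - A2 * f"
      have kl: "min n (t - n * l) = k" using tlk by simp
      have fs: "vanish_order 1 (g l) f" "smooth_at f (g l)"
        unfolding vanish_order_1 using fS[OF gS[OF \<open>l < d\<close>]] by blast+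
      obtain \<mu>1 \<mu>2 B where B: "\<mu>1 \<noteq> 0 \<or> \<mu>2 \<noteq> 0" "tdeg_le k B" "vanish_order (k - 1) (g l) B"
          "vanish_order (Suc k) (g l) (cscale \<mu>1 Q1 + cscale \<mu>2 Q2 - B * f)"
        using leading_form_elimination_at[OF _ _ fs, of k Q1 Q2] A1(2)[OF \<open>l < d\<close>] A2(2)[OF \<open>l < d\<close>]
        unfolding kl Q1_def[symmetric] Q2_def[symmetric] by blast
      obtain E where E: "tdeg_le (card S) E" "xyeval E (fst (g l)) (snd (g l)) = 1"
          "\<And>s. s \<in> S \<Longrightarrow> s \<noteq> g l \<Longrightarrow> xyeval E (fst s) (snd s) = 0"
        using separating_polynomial[OF S(1) gS[OF \<open>l < d\<close>]] by blast
      \<comment> \<open>The factor \<open>E^n\<close> confines the correction \<open>B\<close> to the point \<open>g l\<close>: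
        it vanishes to order \<open>n\<close> at the other points and is \<open>1\<close> at \<open>g l\<close>.\<close>
      define A where "A = cscale \<mu>1 A1 + cscale \<mu>2 A2 + B * E ^ n"
      have "tdeg_le (k + n * d) (B * E ^ n)"
        using tdeg_le_mult[OF B(2) tdeg_le_power[OF E(1), of n]] S(2) by simp
      then have "tdeg_le D (B * E ^ n)"
        by (rule tdeg_le_mono) (use tlk in \<open>simp add: D_def\<close>)
      then have A: "tdeg_le D A"
        unfolding A_def using A1(1) A2(1) by (intro tdeg_le_add tdeg_le_cscale)
      have eq: "Pc (\<lambda>p. \<mu>1 * x p + \<mu>2 * y p) - A * f = (cscale \<mu>1 Q1 + cscale \<mu>2 Q2) - B * E ^ n * f"
        unfolding Pc_lin A_def Q1_def Q2_def cscale_diff by (simp add: algebra_simps cscale_mult_left cscale_mult_right)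
      have "vanish_order (min n (Suc t - n * i)) (g i) ((cscale \<mu>1 Q1 + cscale \<mu>2 Q2) - B * E ^ n * f)"
        if "i < d" for i
      proof (cases "i = l")
        case True
        have "vanish_order 1 (g l) (E ^ n - 1)" unfolding vanish_order_1 using E(2) by simp
        from vanish_order_mult[OF vanish_order_mult[OF B(3) this] fs(1)]
        have "vanish_order (Suc k) (g l) (B * (E ^ n - 1) * f)"
          by (rule vanish_order_mono) simp
        from vanish_order_diff[OF B(4) this]
        have "vanish_order (Suc k) (g l) ((cscale \<mu>1 Q1 + cscale \<mu>2 Q2) - B * E ^ n * f)"
          by (simp add: algebra_simps)
        then show ?thesis unfolding True by (rule vanish_order_mono) (use tlk in simp)
      next
        case False
        have "vanish_order 1 (g i) E"
          unfolding vanish_order_1 using E(3)[OF gS[OF that]] ginj[OF that \<open>l < d\<close> False] by simp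
        then have "vanish_order n (g i) (E ^ n)" by (rule vanish_order_power)
        then have "vanish_order (0 + n + 0) (g i) (B * E ^ n * f)"
          by (intro vanish_order_mult) auto
        then have 1: "vanish_order (min n (t - n * i)) (g i) (B * E ^ n * f)"
          by (rule vanish_order_mono) simp
        have "vanish_order (min n (t - n * i)) (g i) ((cscale \<mu>1 Q1 + cscale \<mu>2 Q2) - B * E ^ n * f)"
          using A1(2)[OF that] A2(2)[OF that] 1 unfolding Q1_def[symmetric] Q2_def[symmetric]
          by (intro vanish_order_diff vanish_order_add vanish_order_cscale)
        moreover have "min n (Suc t - n * i) \<le> min n (t - n * i)"
        proof (cases "i < l")
          case True
          then have "n * (i + 1) \<le> n * l" by (intro mult_left_mono) auto
          then have "n \<le> t - n * i" using tlk by (simp add: algebra_simps)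
          then show ?thesis by simp
        next
          case False
          then have "n * (l + 1) \<le> n * i" using \<open>i \<noteq> l\<close> by (intro mult_left_mono) auto
          then have "Suc t \<le> n * i" using tlk by (simp add: algebra_simps)
          then show ?thesis by simp
        qed
        ultimately show ?thesis by (rule vanish_order_mono)
      qed
      then have "(\<lambda>p. \<mu>1 * x p + \<mu>2 * y p) \<in> K (Suc t)"
        unfolding K_def eq[symmetric] using A by blast
      then have "(\<lambda>p. \<mu>1 * x p + \<mu>2 * y p) \<in> J (Suc t)" using True by (simp add: J_def)
      with B(1) show ?thesis by blast
    next
      case False
      have "\<exists>R. Pc c = f * R \<and> (\<forall>l<t - n * d. xycoeff R (fst (q l)) (snd (q l)) = 0)" if "c \<in> J t" for c
      proof (cases "t = n * d")
        case True
        then show ?thesis using that Kdvd[of c] by (auto simp: J_def elim: dvdE)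
      qed (use that False in \<open>auto simp: J_def\<close>)
      from this[OF xy(1)] this[OF xy(2)] obtain R1 R2 where
        R1: "Pc x = f * R1" "\<forall>l<t - n * d. xycoeff R1 (fst (q l)) (snd (q l)) = 0" and
        R2: "Pc y = f * R2" "\<forall>l<t - n * d. xycoeff R2 (fst (q l)) (snd (q l)) = 0" by blast
      define u v where "u = xycoeff R1 (fst (q (t - n * d))) (snd (q (t - n * d)))"
        and "v = xycoeff R2 (fst (q (t - n * d))) (snd (q (t - n * d)))"
      obtain a b where ab: "a \<noteq> 0 \<or> b \<noteq> 0" "a * u + b * v = 0"
      proof (cases "u = 0 \<and> v = 0")
        case True
        then show thesis using that[of 1 0] by simp
      next
        case False
        then show thesis using that[of v "- u"] by auto
      qed
      have "Pc (\<lambda>p. a * x p + b * y p) = f * (cscale a R1 + cscale b R2)"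
        unfolding Pc_lin R1(1) R2(1) by (simp add: algebra_simps cscale_mult_right)
      moreover have "xycoeff (cscale a R1 + cscale b R2) (fst (q l)) (snd (q l)) = 0" if "l < Suc t - n * d" for l
      proof (cases "l = t - n * d")
        case True
        then show ?thesis using ab(2) by (simp add: u_def v_def)
      next
        case False
        with that have "l < t - n * d" by simp
        with R1(2) R2(2) show ?thesis by simp
      qed
      ultimately have "(\<lambda>p. a * x p + b * y p) \<in> J (Suc t)"
        using False by (auto simp: J_def)
      with ab(1) show ?thesis by blast
    qed
  qed (use count in auto)
  then obtain c where c: "c \<in> J (n * d + card (exponents_le (e - m)))" "\<exists>p\<in>exponents_le e. c p \<noteq> 0" by blast
  have "\<exists>R. Pc c = f * R \<and> (\<forall>l<card (exponents_le (e - m)). xycoeff R (fst (q l)) (snd (q l)) = 0)"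
  proof -
    have "(0, 0) \<in> exponents_le (e - m)" by (simp add: exponents_le_def)
    then have "card (exponents_le (e - m)) \<noteq> 0" by auto
    with c(1) show ?thesis by (auto simp: J_def)
  qed
  then obtain R where R: "Pc c = f * R" "\<And>l. l < card (exponents_le (e - m)) \<Longrightarrow> xycoeff R (fst (q l)) (snd (q l)) = 0"
    by blast
  have "R = 0"
  proof (rule ccontr)
    assume "R \<noteq> 0"
    from tdeg_le_cofactor[OF Pc_deg[of c, unfolded R(1)] f this]
    have tR: "tdeg_le (e - m) R" by simp
    have "xycoeff R i j = 0" for i j
    proof (cases "(i, j) \<in> exponents_le (e - m)")
      case True
      then have "(i, j) \<in> q ` {0..<card (exponents_le (e - m))}" using q by (simp add: bij_betw_def)
      then obtain l where "l < card (exponents_le (e - m))" "q l = (i, j)" by auto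
      with R(2)[of l] show ?thesis by simp
    next
      case False
      then show ?thesis using tR by (auto simp: exponents_le_def tdeg_le_altdef)
    qed
    then have "R = 0" by (intro bpoly_eqI) simp
    with \<open>R \<noteq> 0\<close> show False by simp
  qed
  then have "Pc c = 0" using R(1) by simp
  with c(2) Pc_xycoeff show False by (metis xycoeff_0 prod.collapse)
qed

text \<open>
  A resultant in disguise, obtained by counting: the unknowns are the coefficients of
  cofactors \<open>A\<close> and \<open>B\<close> with \<open>deg_y A \<le> e\<close>, \<open>deg_y B < deg_y f\<close> and degree at most \<open>N\<close> in \<open>x\<close>, the
  conditions are that all coefficients of \<open>A f + B h\<close> with a positive power of \<open>y\<close> vanish. For \<open>N\<close> as
  large as \<open>(m + e)^2\<close> the unknowns outnumber the conditions. The result is nonzero: \<open>A f = - B h\<close>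
  would imply that \<open>f\<close> divides \<open>B\<close>, against \<open>deg_y B < deg_y f\<close>. The count also bounds the degrees of
  the cofactors, which is what makes the elimination effective.
\<close>
lemma eliminate_y:
  assumes f: "irreducible f" "tdeg_le m f" and h: "\<not> f dvd h" "tdeg_le e h"
  shows "\<exists>A B. tdeg_le ((m + e + 1) ^ 2) A \<and> tdeg_le ((m + e + 1) ^ 2) B \<and> A * f + B * h \<noteq> 0 \<and>
           (\<forall>i j. 0 < j \<longrightarrow> xycoeff (A * f + B * h) i j = 0)"
proof -
  have f0: "f \<noteq> 0" using f(1) by (simp add: irreducible_def)
  have prime: "prime_elem f" using f(1) by (rule irreducible_imp_prime_elem)
  define df N where "df = degree f" and "N = (m + e) ^ 2"
  have xycoeff_deg: "xycoeff P i j = 0" if "degree P < j" for P i j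
    using that by (simp add: xycoeff_def coeff_eq_0)
  have dfm: "df \<le> m"
  proof -
    have "coeff f df \<noteq> 0" using f0 by (simp add: df_def)
    then obtain i where "xycoeff f i df \<noteq> 0" unfolding xycoeff_def by (metis coeff_0 poly_eqI)
    then show ?thesis using f(2) unfolding tdeg_le_def by fastforce
  qed
  show ?thesis
  proof (cases "df = 0")
    case True
    then show ?thesis
      by (intro exI[of _ 1] exI[of _ 0]) (auto simp: f0 df_def xycoeff_deg)
  next
    case False
    define IA IB where "IA = {..N} \<times> {..e}" and "IB = {..N} \<times> {..<df}"
    define I where "I = IA <+> IB"
    define R where "R = {..N + m + e} \<times> {1..df + e}"
    define c where "c r p = (case p of Inl ab \<Rightarrow> xycoeff (xy_monom (fst ab) (snd ab) * f) (fst r) (snd r)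
       | Inr ab \<Rightarrow> xycoeff (xy_monom (fst ab) (snd ab) * h) (fst r) (snd r))" for r p
    have "card R < card I"
    proof -
      have "(df + e) * (m + e) \<le> N"
        using dfm by (simp add: N_def power2_eq_square)
      then have "(N + m + e + 1) * (df + e) < (N + 1) * (e + 1) + (N + 1) * df"
        by (simp add: algebra_simps)
      then show ?thesis by (simp add: R_def I_def IA_def IB_def card_Plus)
    qed
    then obtain x where x: "\<exists>p\<in>I. x p \<noteq> 0" "\<And>r. r \<in> R \<Longrightarrow> (\<Sum>p\<in>I. c r p * x p) = 0"
      using underdetermined_system_solvable[of R I c]
      by (auto simp: R_def I_def IA_def IB_def)
    define A where "A = (\<Sum>ab\<in>IA. cscale (x (Inl ab)) (xy_monom (fst ab) (snd ab)))"
    define B where "B = (\<Sum>ab\<in>IB. cscale (x (Inr ab)) (xy_monom (fst ab) (snd ab)))"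
    have fin: "finite IA" "finite IB" by (auto simp: IA_def IB_def)
    have xycoeff_sum_mono: "xycoeff (\<Sum>ab\<in>X. cscale (y ab) (xy_monom (fst ab) (snd ab))) i j =
        (if (i, j) \<in> X then y (i, j) else 0)" if "finite X" for X y i j
    proof -
      have "xycoeff (\<Sum>ab\<in>X. cscale (y ab) (xy_monom (fst ab) (snd ab))) i j =
          (\<Sum>ab\<in>X. if ab = (i, j) then y (i, j) else 0)"
        unfolding xycoeff_sum xycoeff_cscale_xy_monom by (intro sum.cong) (auto simp: prod_eq_iff)
      then show ?thesis using that by simp
    qed
    have cfA: "xycoeff A i j = (if (i, j) \<in> IA then x (Inl (i, j)) else 0)" for i j
      unfolding A_def by (rule xycoeff_sum_mono[OF fin(1)])
    have cfB: "xycoeff B i j = (if (i, j) \<in> IB then x (Inr (i, j)) else 0)" for i j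
      unfolding B_def by (rule xycoeff_sum_mono[OF fin(2)])
    have cfr: "xycoeff (A * f + B * h) i j = (\<Sum>p\<in>I. c (i, j) p * x p)" for i j
      unfolding I_def sum.Plus[OF fin] c_def A_def B_def
      by (simp add: sum_distrib_right xycoeff_sum cscale_mult_left mult.commute[of "x _"])
    have N2: "N + m + e \<le> (m + e + 1) ^ 2" by (simp add: N_def power2_eq_square)
    have tA: "tdeg_le (N + e) A" and tB: "tdeg_le (N + df) B"
      by (auto simp: tdeg_le_altdef cfA cfB IA_def IB_def)
    have A: "tdeg_le ((m + e + 1) ^ 2) A" by (rule tdeg_le_mono[OF tA]) (use N2 in linarith)
    have B: "tdeg_le ((m + e + 1) ^ 2) B" by (rule tdeg_le_mono[OF tB]) (use N2 dfm in linarith)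
    have zero: "xycoeff (A * f + B * h) i j = 0" if "0 < j" for i j
    proof (cases "(i, j) \<in> R")
      case True
      then show ?thesis unfolding cfr by (rule x(2))
    next
      case False
      with that have big: "i > N + m + e \<or> j > df + e" by (auto simp: R_def)
      have "xycoeff (A * f) i j = 0"
        unfolding xycoeff_mult
      proof (intro sum.neutral ballI)
        fix b a assume ba: "b \<in> {..j}" "a \<in> {..i}"
        have "(a, b) \<notin> IA \<or> df < j - b \<or> m < (i - a) + (j - b)"
          using big ba by (auto simp: IA_def)
        then show "xycoeff A a b * xycoeff f (i - a) (j - b) = 0"
          using f(2) xycoeff_deg[of f] by (auto simp: cfA df_def tdeg_le_altdef)
      qed
      moreover have "xycoeff (B * h) i j = 0"
        unfolding xycoeff_mult
      proof (intro sum.neutral ballI)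
        fix b a assume ba: "b \<in> {..j}" "a \<in> {..i}"
        have "(a, b) \<notin> IB \<or> e < (i - a) + (j - b)"
          using big ba by (auto simp: IB_def)
        then show "xycoeff B a b * xycoeff h (i - a) (j - b) = 0"
          using h(2) by (auto simp: cfB tdeg_le_altdef)
      qed
      ultimately show ?thesis by simp
    qed
    have "A * f + B * h \<noteq> 0"
    proof
      assume r0: "A * f + B * h = 0"
      have "f dvd A * f + B * h" unfolding r0 by simp
      then have "f dvd B * h" by (simp add: dvd_add_right_iff)
      with prime h(1) have "f dvd B" by (simp add: prime_elem_dvd_mult_iff)
      have "B = 0"
      proof (rule ccontr)
        assume "B \<noteq> 0"
        from dvd_imp_degree_le[OF \<open>f dvd B\<close> this] have dB: "df \<le> degree B" by (simp add: df_def)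
        have "coeff B (degree B) \<noteq> 0" using \<open>B \<noteq> 0\<close> by simp
        then obtain i where "xycoeff B i (degree B) \<noteq> 0" unfolding xycoeff_def by (metis coeff_0 poly_eqI)
        then have "degree B < df" by (auto simp: cfB IB_def split: if_splits)
        with dB show False by simp
      qed
      with r0 f0 have "A = 0" by simp
      have "x p = 0" if "p \<in> I" for p
        using that cfA cfB \<open>A = 0\<close> \<open>B = 0\<close> by (auto simp: I_def) (metis xycoeff_0)+
      with x(1) show False by blast
    qed
    with A B zero show ?thesis by blast
  qed
qed

lemma eliminate_x:
  assumes f: "irreducible f" "tdeg_le m f" and h: "\<not> f dvd h" "tdeg_le e h"
  shows "\<exists>A B. tdeg_le ((m + e + 1) ^ 2) A \<and> tdeg_le ((m + e + 1) ^ 2) B \<and> A * f + B * h \<noteq> 0 \<and>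
           (\<forall>i j. 0 < i \<longrightarrow> xycoeff (A * f + B * h) i j = 0)"
proof -
  obtain A B where AB: "tdeg_le ((m + e + 1) ^ 2) A" "tdeg_le ((m + e + 1) ^ 2) B"
    "A * swap_xy f + B * swap_xy h \<noteq> 0"
    "\<forall>i j. 0 < j \<longrightarrow> xycoeff (A * swap_xy f + B * swap_xy h) i j = 0"
    using eliminate_y[OF irreducible_swap_xy[OF f(1)], of m "swap_xy h" e] f h by auto
  have eq: "swap_xy A * f + swap_xy B * h = swap_xy (A * swap_xy f + B * swap_xy h)"
    by (simp add: swap_xy_add swap_xy_mult)
  show ?thesis
    by (intro exI[of _ "swap_xy A"] exI[of _ "swap_xy B"]) (use AB in \<open>simp add: eq\<close>)
qed

section \<open>Polynomials over the rationals and primitive elements\<close>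

definition qpoly :: "rat poly \<Rightarrow> complex \<Rightarrow> complex" where
  "qpoly h z = poly (map_poly of_rat h) z"

lemma map_of_rat_add: "map_poly of_rat (p + q) = (map_poly of_rat p + map_poly of_rat q :: complex poly)"
  and map_of_rat_mult: "map_poly of_rat (p * q) = (map_poly of_rat p * map_poly of_rat q :: complex poly)"
  and map_of_rat_diff: "map_poly of_rat (p - q) = (map_poly of_rat p - map_poly of_rat q :: complex poly)"
  and map_of_rat_pderiv: "map_poly of_rat (pderiv p) = (pderiv (map_poly of_rat p) :: complex poly)"
  by (rule poly_eqI, simp add: coeff_map_poly coeff_mult of_rat_add of_rat_mult of_rat_diff of_rat_sum coeff_pderiv)+

lemma map_of_rat_const: "map_poly of_rat [:c:] = [:of_rat c :: complex:]"
  by (rule poly_eqI) (simp add: coeff_map_poly coeff_pCons split: nat.split)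

lemma qpoly_add: "qpoly (p + q) z = qpoly p z + qpoly q z"
  and qpoly_mult: "qpoly (p * q) z = qpoly p z * qpoly q z"
  and qpoly_diff: "qpoly (p - q) z = qpoly p z - qpoly q z"
  and qpoly_0 [simp]: "qpoly 0 z = 0"
  and qpoly_const [simp]: "qpoly [:c:] z = of_rat c"
  and qpoly_monom: "qpoly (monom c n) z = of_rat c * z ^ n"
  by (simp_all add: qpoly_def map_of_rat_add map_of_rat_mult map_of_rat_diff map_of_rat_const
      map_poly_monom poly_monom)

lemma qpoly_1 [simp]: "qpoly 1 z = 1"
  by (simp add: one_pCons del: one_poly_eq_simps)

lemma qpoly_sum: "qpoly (\<Sum>a\<in>A. f a) z = (\<Sum>a\<in>A. qpoly (f a) z)"
  by (induction A rule: infinite_finite_induct) (auto simp: qpoly_add)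

lemma qpoly_eq_sum:
  assumes "degree h < n"
  shows "qpoly h z = (\<Sum>i<n. of_rat (coeff h i) * z ^ i)"
proof -
  have "h = (\<Sum>i<n. monom (coeff h i) i)"
  proof (rule poly_eqI)
    fix k
    have "coeff (\<Sum>i<n. monom (coeff h i) i) k = (\<Sum>i<n. if i = k then coeff h k else 0)"
      by (simp add: coeff_sum coeff_monom cong: if_cong)
    then show "coeff h k = coeff (\<Sum>i<n. monom (coeff h i) i) k"
      using assms by (auto simp: coeff_eq_0)
  qed
  then have "qpoly h z = qpoly (\<Sum>i<n. monom (coeff h i) i) z" by simp
  then show ?thesis by (simp add: qpoly_sum qpoly_monom)
qed

lemma irreducible_bezout:
  fixes g h :: "rat poly"
  assumes "irreducible g" "\<not> g dvd h"
  obtains u v where "u * g + v * h = 1"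
proof -
  have "prime_elem g" using assms(1) by (rule irreducible_imp_prime_elem)
  then have "coprime g h" using assms(2) by (rule prime_elem_imp_coprime)
  then show thesis
    using that bezout_coefficients_fst_snd[of g h] by (metis coprime_iff_gcd_eq_1)
qed

lemma irreducible_dvd_of_root:
  assumes "irreducible g" "qpoly g z = 0" "qpoly h z = 0"
  shows "g dvd h"
proof (rule ccontr)
  assume "\<not> g dvd h"
  with assms(1) obtain u v where uv: "u * g + v * h = 1" by (rule irreducible_bezout)
  have "qpoly (u * g + v * h) z = 0" using assms by (simp add: qpoly_add qpoly_mult)
  then show False unfolding uv by simp
qed

lemma qpoly_dvd_root: "g dvd h \<Longrightarrow> qpoly g z = 0 \<Longrightarrow> qpoly h z = 0"
  by (auto simp: qpoly_mult elim!: dvdE)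

lemma irreducible_degree_pos: "irreducible (g :: rat poly) \<Longrightarrow> 0 < degree g"
  by (metis gr0I irreducible_def is_unit_iff_degree)

lemma rsquarefree_irreducible:
  assumes "irreducible (g :: rat poly)"
  shows "rsquarefree (map_poly of_rat g :: complex poly)"
  unfolding rsquarefree_roots
proof (intro allI notI)
  fix a :: complex assume "poly (map_poly of_rat g) a = 0 \<and> poly (pderiv (map_poly of_rat g)) a = 0"
  then have "qpoly g a = 0" "qpoly (pderiv g) a = 0"
    by (auto simp: qpoly_def map_of_rat_pderiv)
  with assms have "g dvd pderiv g" by (rule irreducible_dvd_of_root)
  moreover have "0 < degree g" using assms by (rule irreducible_degree_pos)
  then have "pderiv g \<noteq> 0" by (simp add: pderiv_eq_0_iff)
  ultimately have "degree g \<le> degree (pderiv g)" by (rule dvd_imp_degree_le)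
  with \<open>0 < degree g\<close> show False by (simp add: degree_pderiv)
qed

lemma degree_map_of_rat: "degree (map_poly of_rat g :: complex poly) = degree g"
  by (rule degree_map_poly) simp

lemma map_of_rat_factor:
  assumes "irreducible (g :: rat poly)"
  shows "map_poly of_rat g = [:of_rat (lead_coeff g):] * (\<Prod>z | qpoly g z = 0. [:- z, 1:])"
  using complex_poly_decompose_rsquarefree[OF rsquarefree_irreducible[OF assms]]
  by (simp add: qpoly_def degree_map_of_rat coeff_map_poly)

lemma finite_qpoly_roots:
  assumes "g \<noteq> 0"
  shows "finite {z. qpoly g z = 0}"
proof -
  have "map_poly of_rat g \<noteq> (0 :: complex poly)"
    using assms by (subst map_poly_eq_0_iff) auto
  then show ?thesis unfolding qpoly_def by (rule poly_roots_finite)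
qed

lemma degree_prod_linear: "finite A \<Longrightarrow> degree (\<Prod>z\<in>A. [:- z, 1 :: complex:]) = card A"
  by (subst degree_prod_eq_sum_degree) auto

lemma card_qpoly_roots:
  assumes "irreducible g"
  shows "card {z. qpoly g z = 0} = degree g"
proof -
  have g0: "g \<noteq> 0" using assms by (simp add: irreducible_def)
  have "degree (map_poly of_rat g :: complex poly) = degree (\<Prod>z | qpoly g z = 0. [:- z, 1 :: complex:])"
    unfolding map_of_rat_factor[OF assms] using g0 by simp
  then show ?thesis
    using degree_prod_linear[OF finite_qpoly_roots[OF g0]] by (simp add: degree_map_of_rat)
qed

lemma ex_irreducible_annihilator:
  assumes "p0 \<noteq> 0" "qpoly p0 z = 0"
  shows "\<exists>g. irreducible g \<and> qpoly g z = 0"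
proof -
  obtain g where g: "g \<noteq> 0" "qpoly g z = 0" and least: "\<And>p. p \<noteq> 0 \<Longrightarrow> qpoly p z = 0 \<Longrightarrow> degree g \<le> degree p"
    using ex_has_least_nat[of "\<lambda>p. p \<noteq> 0 \<and> qpoly p z = 0" p0 degree] assms by blast
  have "irreducible g"
  proof (rule irreducibleI)
    show "\<not> g dvd 1"
    proof
      assume "g dvd 1"
      then have "qpoly 1 z = 0" using g(2) by (rule qpoly_dvd_root)
      then show False by simp
    qed
    fix a b assume ab: "g = a * b"
    with g(1) have nz: "a \<noteq> 0" "b \<noteq> 0" by auto
    then have deg: "degree g = degree a + degree b" by (simp add: ab degree_mult_eq)
    from g(2) have "qpoly a z = 0 \<or> qpoly b z = 0" by (simp add: ab qpoly_mult)
    then show "a dvd 1 \<or> b dvd 1"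
    proof
      assume "qpoly a z = 0"
      with least[OF nz(1)] deg have "degree b = 0" by simp
      with nz show ?thesis by (simp add: is_unit_iff_degree)
    next
      assume "qpoly b z = 0"
      with least[OF nz(2)] deg have "degree a = 0" by simp
      with nz show ?thesis by (simp add: is_unit_iff_degree)
    qed
  qed (use g in auto)
  with g show ?thesis by blast
qed

lemma algebraic_imp_irreducible:
  assumes "algebraic z"
  shows "\<exists>g. irreducible g \<and> qpoly g z = 0"
proof -
  obtain p :: "int poly" where p: "p \<noteq> 0" "poly (map_poly of_int p) z = 0"
    using assms by (rule algebraicE')
  have "map_poly of_rat (map_poly of_int p :: rat poly) = (map_poly of_int p :: complex poly)"
    by (rule poly_eqI) (simp add: coeff_map_poly)
  then have "qpoly (map_poly of_int p) z = 0" using p by (simp add: qpoly_def)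
  moreover have "map_poly of_int p \<noteq> (0 :: rat poly)"
    using p(1) by (subst map_poly_eq_0_iff) auto
  ultimately show ?thesis by (rule ex_irreducible_annihilator[rotated])
qed

text \<open>
  Lagrange interpolation: if \<open>r\<close> is the remainder of \<open>h g'\<close> modulo \<open>g\<close>, then \<open>r(z) = h(z) g'(z)\<close> at
  each root \<open>z\<close>, hence \<open>r\<close> is the sum of the polynomials \<open>h(z) g / (X - z)\<close>. Its coefficient in
  degree \<open>deg g - 1\<close> is the leading coefficient of \<open>g\<close> times the trace.
\<close>
lemma trace_rational:
  assumes g: "irreducible g"
  shows "(\<Sum>z | qpoly g z = 0. qpoly h z) \<in> \<rat>"
proof -
  define \<Gamma> where "\<Gamma> = {z. qpoly g z = 0}"
  define c where "c = (of_rat (lead_coeff g) :: complex)"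
  have g0: "g \<noteq> 0" using g by (simp add: irreducible_def)
  have fin: "finite \<Gamma>" unfolding \<Gamma>_def using g0 by (rule finite_qpoly_roots)
  have card: "card \<Gamma> = degree g" unfolding \<Gamma>_def using g by (rule card_qpoly_roots)
  have d0: "0 < degree g" using g by (rule irreducible_degree_pos)
  have c0: "c \<noteq> 0" using g0 by (simp add: c_def)
  define P where "P z = (\<Prod>w\<in>\<Gamma> - {z}. [:- w, 1 :: complex:])" for z
  have G: "map_poly of_rat g = [:c:] * (\<Prod>w\<in>\<Gamma>. [:- w, 1:])"
    unfolding c_def \<Gamma>_def using g by (rule map_of_rat_factor)
  have degP: "degree (P z) = degree g - 1" if "z \<in> \<Gamma>" for z
    unfolding P_def using degree_prod_linear[of "\<Gamma> - {z}"] fin that card by simp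
  have leadP: "coeff (P z) (degree g - 1) = 1" if "z \<in> \<Gamma>" for z
  proof -
    have "lead_coeff (P z) = 1" unfolding P_def by (simp add: lead_coeff_prod)
    then show ?thesis by (simp add: degP[OF that])
  qed
  have P0: "poly (P z) w = 0" if "w \<in> \<Gamma>" "w \<noteq> z" for z w
    unfolding P_def poly_prod using that fin by (intro prod_zero bexI[of _ w]) auto
  have G': "qpoly (pderiv g) z = c * poly (P z) z" if "z \<in> \<Gamma>" for z
  proof -
    have "pderiv (map_poly of_rat g) = [:c:] * (\<Sum>w\<in>\<Gamma>. P w * pderiv [:- w, 1:])"
      unfolding G by (simp add: pderiv_smult pderiv_prod P_def)
    then have "qpoly (pderiv g) z = c * (\<Sum>w\<in>\<Gamma>. poly (P w) z)"
      by (simp add: qpoly_def map_of_rat_pderiv poly_sum pderiv_pCons)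
    also have "(\<Sum>w\<in>\<Gamma>. poly (P w) z) = (\<Sum>w\<in>\<Gamma>. if w = z then poly (P z) z else 0)"
      using that P0 by (intro sum.cong) auto
    also have "\<dots> = poly (P z) z" using fin that by simp
    finally show ?thesis .
  qed
  define r where "r = (h * pderiv g) mod g"
  have r: "qpoly r z = qpoly h z * qpoly (pderiv g) z" if "z \<in> \<Gamma>" for z
  proof -
    have "h * pderiv g = (h * pderiv g) div g * g + r" by (simp add: r_def)
    then have "qpoly (h * pderiv g) z = qpoly ((h * pderiv g) div g * g + r) z" by simp
    then show ?thesis using that by (simp add: qpoly_mult qpoly_add \<Gamma>_def)
  qed
  have degr: "degree r < degree g"
    unfolding r_def using g0 d0 by (metis degree_0 degree_mod_less)
  define L where "L = (\<Sum>z\<in>\<Gamma>. [:qpoly h z * c:] * P z)"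
  have "map_poly of_rat r = L"
  proof (rule poly_eqI_degree[of \<Gamma>])
    fix z assume z: "z \<in> \<Gamma>"
    have "poly L z = (\<Sum>w\<in>\<Gamma>. if w = z then qpoly h z * c * poly (P z) z else 0)"
      unfolding L_def poly_sum using z P0 by (intro sum.cong) auto
    also have "\<dots> = qpoly h z * c * poly (P z) z" using fin z by simp
    also have "\<dots> = poly (map_poly of_rat r) z"
      using r[OF z] G'[OF z] by (simp add: qpoly_def)
    finally show "poly (map_poly of_rat r) z = poly L z" by simp
  next
    show "degree (map_poly of_rat r :: complex poly) < card \<Gamma>"
      using degr card by (simp add: degree_map_of_rat)
    have "degree L \<le> degree g - 1"
      unfolding L_def using fin degP
      by (intro degree_sum_le) (auto intro!: order_trans[OF degree_smult_le])
    then show "degree L < card \<Gamma>" using d0 card by simp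
  qed
  then have "of_rat (coeff r (degree g - 1)) = coeff L (degree g - 1)"
    by (metis (no_types) coeff_map_poly[of of_rat, OF of_rat_0])
  also have "\<dots> = (\<Sum>z\<in>\<Gamma>. qpoly h z * c)"
    unfolding L_def coeff_sum by (intro sum.cong) (auto simp: leadP[unfolded One_nat_def])
  finally have "(\<Sum>z\<in>\<Gamma>. qpoly h z) = of_rat (coeff r (degree g - 1) / lead_coeff g)"
    using c0 by (simp add: of_rat_divide sum_distrib_right[symmetric] c_def field_simps)
  then show ?thesis unfolding \<Gamma>_def by (metis Rats_of_rat)
qed

text \<open>
  On pairs of roots of two polynomials of degrees \<open>n1\<close> and \<open>n2\<close>, every polynomial with rational
  coefficients agrees with a combination of the \<open>n1 n2\<close> monomials \<open>x^i y^j\<close> with \<open>i < n1\<close> and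
  \<open>j < n2\<close>. Working with values on this grid replaces the tensor product of two number fields.
\<close>
definition grid_poly :: "nat \<Rightarrow> nat \<Rightarrow> complex set \<Rightarrow> complex set \<Rightarrow> (complex \<Rightarrow> complex \<Rightarrow> complex) \<Rightarrow> bool" where
  "grid_poly n1 n2 E1 E2 u \<longleftrightarrow> (\<exists>c :: nat \<times> nat \<Rightarrow> rat. \<forall>x\<in>E1. \<forall>y\<in>E2.
     u x y = (\<Sum>p\<in>{..<n1} \<times> {..<n2}. of_rat (c p) * (x ^ fst p * y ^ snd p)))"

lemma grid_poly_add:
  assumes "grid_poly n1 n2 E1 E2 u" "grid_poly n1 n2 E1 E2 v"
  shows "grid_poly n1 n2 E1 E2 (\<lambda>x y. u x y + v x y)"
proof -
  from assms obtain c d :: "nat \<times> nat \<Rightarrow> rat" where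
    "\<forall>x\<in>E1. \<forall>y\<in>E2. u x y = (\<Sum>p\<in>{..<n1} \<times> {..<n2}. of_rat (c p) * (x ^ fst p * y ^ snd p))"
    "\<forall>x\<in>E1. \<forall>y\<in>E2. v x y = (\<Sum>p\<in>{..<n1} \<times> {..<n2}. of_rat (d p) * (x ^ fst p * y ^ snd p))"
    unfolding grid_poly_def by blast
  then show ?thesis
    unfolding grid_poly_def
    by (intro exI[of _ "\<lambda>p. c p + d p"]) (simp add: of_rat_add ring_distribs sum.distrib)
qed

lemma grid_poly_scale:
  assumes "grid_poly n1 n2 E1 E2 u"
  shows "grid_poly n1 n2 E1 E2 (\<lambda>x y. of_rat r * u x y)"
proof -
  from assms obtain c :: "nat \<times> nat \<Rightarrow> rat" where
    "\<forall>x\<in>E1. \<forall>y\<in>E2. u x y = (\<Sum>p\<in>{..<n1} \<times> {..<n2}. of_rat (c p) * (x ^ fst p * y ^ snd p))"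
    unfolding grid_poly_def by blast
  moreover have "of_rat r * (\<Sum>p\<in>A. of_rat (c p) * M p) = (\<Sum>p\<in>A. of_rat (r * c p) * M p)"
    for A and M :: "nat \<times> nat \<Rightarrow> complex"
    unfolding sum_distrib_left by (intro sum.cong refl) (simp add: of_rat_mult)
  ultimately have "\<forall>x\<in>E1. \<forall>y\<in>E2. of_rat r * u x y =
      (\<Sum>p\<in>{..<n1} \<times> {..<n2}. of_rat (r * c p) * (x ^ fst p * y ^ snd p))"
    by simp
  then show ?thesis
    unfolding grid_poly_def by (rule exI[of _ "\<lambda>p. r * c p"])
qed

lemma grid_poly_zero: "grid_poly n1 n2 E1 E2 (\<lambda>x y. 0)"
  unfolding grid_poly_def by (intro exI[of _ "\<lambda>_. 0"]) simp

lemma grid_poly_sum: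
  "finite A \<Longrightarrow> (\<And>a. a \<in> A \<Longrightarrow> grid_poly n1 n2 E1 E2 (u a)) \<Longrightarrow>
     grid_poly n1 n2 E1 E2 (\<lambda>x y. \<Sum>a\<in>A. u a x y)"
  by (induction A rule: finite_induct) (auto intro: grid_poly_zero grid_poly_add)

lemma root_power_reduce:
  assumes "irreducible P"
  shows "\<exists>c. \<forall>x. qpoly P x = 0 \<longrightarrow> x ^ j = (\<Sum>i<degree P. of_rat (c i) * x ^ i)"
proof -
  define r where "r = monom 1 j mod P"
  have P0: "P \<noteq> 0" using assms by (simp add: irreducible_def)
  have d0: "0 < degree P" using assms by (rule irreducible_degree_pos)
  have degr: "degree r < degree P"
    unfolding r_def using P0 d0 by (metis degree_0 degree_mod_less)
  have "x ^ j = (\<Sum>i<degree P. of_rat (coeff r i) * x ^ i)" if "qpoly P x = 0" for x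
  proof -
    have "monom 1 j = monom 1 j div P * P + r" by (simp add: r_def)
    then have "qpoly (monom 1 j) x = qpoly (monom 1 j div P * P + r) x" by simp
    then show ?thesis
      using that qpoly_eq_sum[OF degr, of x] by (simp add: qpoly_mult qpoly_add qpoly_monom)
  qed
  then show ?thesis by blast
qed

lemma grid_poly_monom:
  assumes P: "irreducible P1" "irreducible P2"
  shows "grid_poly (degree P1) (degree P2) {x. qpoly P1 x = 0} {x. qpoly P2 x = 0} (\<lambda>x y. x ^ i * y ^ j)"
proof -
  obtain c where c: "\<And>x. qpoly P1 x = 0 \<Longrightarrow> x ^ i = (\<Sum>i<degree P1. of_rat (c i) * x ^ i)"
    using root_power_reduce[OF P(1)] by blast
  obtain d where d: "\<And>x. qpoly P2 x = 0 \<Longrightarrow> x ^ j = (\<Sum>i<degree P2. of_rat (d i) * x ^ i)"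
    using root_power_reduce[OF P(2)] by blast
  have "x ^ i * y ^ j = (\<Sum>p\<in>{..<degree P1} \<times> {..<degree P2}.
      of_rat (c (fst p) * d (snd p)) * (x ^ fst p * y ^ snd p))"
    if "qpoly P1 x = 0" "qpoly P2 y = 0" for x y
    unfolding c[OF that(1)] d[OF that(2)] sum_product sum.cartesian_product
    by (intro sum.cong) (auto simp: of_rat_mult)
  then show ?thesis
    unfolding grid_poly_def by (intro exI[of _ "\<lambda>p. c (fst p) * d (snd p)"]) blast
qed

lemma grid_relation:
  assumes "\<And>j. j \<le> n1 * n2 \<Longrightarrow> grid_poly n1 n2 E1 E2 (u j)"
  shows "\<exists>x :: nat \<Rightarrow> rat. (\<exists>j\<le>n1 * n2. x j \<noteq> 0) \<and>
    (\<forall>a\<in>E1. \<forall>b\<in>E2. (\<Sum>j\<le>n1 * n2. of_rat (x j) * u j a b) = 0)"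
proof -
  have ex: "\<forall>j. \<exists>c :: nat \<times> nat \<Rightarrow> rat. j \<le> n1 * n2 \<longrightarrow> (\<forall>x\<in>E1. \<forall>y\<in>E2.
     u j x y = (\<Sum>p\<in>{..<n1} \<times> {..<n2}. of_rat (c p) * (x ^ fst p * y ^ snd p)))"
    using assms unfolding grid_poly_def by blast
  from choice[OF ex] obtain c :: "nat \<Rightarrow> nat \<times> nat \<Rightarrow> rat" where
    c0: "\<forall>j. j \<le> n1 * n2 \<longrightarrow> (\<forall>x\<in>E1. \<forall>y\<in>E2.
     u j x y = (\<Sum>p\<in>{..<n1} \<times> {..<n2}. of_rat (c j p) * (x ^ fst p * y ^ snd p)))" ..
  have c: "u j a b = (\<Sum>p\<in>{..<n1} \<times> {..<n2}. of_rat (c j p) * (a ^ fst p * b ^ snd p))"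
    if "j \<le> n1 * n2" "a \<in> E1" "b \<in> E2" for j a b
    using c0[rule_format, OF that] .
  have "\<exists>x. (\<exists>i\<in>{..n1 * n2}. x i \<noteq> 0) \<and> (\<forall>i. i \<notin> {..n1 * n2} \<longrightarrow> x i = 0) \<and>
     (\<forall>p\<in>{..<n1} \<times> {..<n2}. (\<Sum>j\<in>{..n1 * n2}. c j p * x j) = 0)"
    by (rule underdetermined_system_solvable) auto
  then obtain x where x: "\<exists>i\<in>{..n1 * n2}. x i \<noteq> 0"
    "\<And>p. p \<in> {..<n1} \<times> {..<n2} \<Longrightarrow> (\<Sum>j\<le>n1 * n2. c j p * x j) = 0" by blast
  show ?thesis
  proof (intro exI[of _ x] conjI ballI)
    show "\<exists>j\<le>n1 * n2. x j \<noteq> 0" using x(1) by auto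
    fix a b assume ab: "a \<in> E1" "b \<in> E2"
    have "(\<Sum>j\<le>n1 * n2. of_rat (x j) * u j a b) =
        (\<Sum>j\<le>n1 * n2. \<Sum>p\<in>{..<n1} \<times> {..<n2}. of_rat (x j) * (of_rat (c j p) * (a ^ fst p * b ^ snd p)))"
      using c[OF _ ab] by (simp add: sum_distrib_left)
    also have "\<dots> = (\<Sum>p\<in>{..<n1} \<times> {..<n2}. \<Sum>j\<le>n1 * n2. of_rat (x j) * (of_rat (c j p) * (a ^ fst p * b ^ snd p)))"
      by (rule sum.swap)
    also have "\<dots> = (\<Sum>p\<in>{..<n1} \<times> {..<n2}. of_rat (\<Sum>j\<le>n1 * n2. c j p * x j) * (a ^ fst p * b ^ snd p))"
      by (simp add: of_rat_sum of_rat_mult sum_distrib_left sum_distrib_right mult_ac)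
    also have "\<dots> = 0" using x(2) by (intro sum.neutral ballI) (simp only: of_rat_0 mult_zero_left)
    finally show "(\<Sum>j\<le>n1 * n2. of_rat (x j) * u j a b) = 0" .
  qed
qed

text \<open>
  The number \<open>k\<close> is chosen such that \<open>w = x + k y\<close> takes \<open>N = n1 n2\<close> distinct values on the grid of
  pairs of conjugates. The \<open>N + 1\<close> functions \<open>1, w, \<dots>, w^(N-1), y\<close> satisfy a rational relation on
  the grid. It involves \<open>y\<close>, since a nonzero polynomial of degree less than \<open>N\<close> cannot vanish at the
  \<open>N\<close> values of \<open>w\<close>. At \<open>(\<alpha>1, \<alpha>2)\<close> the relation expresses \<open>\<alpha>2\<close> by \<open>\<gamma>\<close>.
\<close>
lemma primitive_element:
  assumes "algebraic \<alpha>1" "algebraic \<alpha>2"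
  obtains g h1 h2 \<gamma> k where "irreducible g" "qpoly g \<gamma> = 0" "qpoly h1 \<gamma> = \<alpha>1" "qpoly h2 \<gamma> = \<alpha>2"
    "\<gamma> = \<alpha>1 + of_nat k * \<alpha>2"
proof -
  obtain P1 P2 where P: "irreducible P1" "qpoly P1 \<alpha>1 = 0" "irreducible P2" "qpoly P2 \<alpha>2 = 0"
    using algebraic_imp_irreducible assms by metis
  define E1 E2 n1 n2 where "E1 = {x. qpoly P1 x = 0}" and "E2 = {x. qpoly P2 x = 0}"
    and "n1 = degree P1" and "n2 = degree P2"
  have P0: "P1 \<noteq> 0" "P2 \<noteq> 0" using P by (auto simp: irreducible_def)
  have fin: "finite E1" "finite E2" unfolding E1_def E2_def using P0 by (auto intro: finite_qpoly_roots)
  have card: "card E1 = n1" "card E2 = n2"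
    unfolding E1_def E2_def n1_def n2_def using P by (auto intro: card_qpoly_roots)
  have \<alpha>: "\<alpha>1 \<in> E1" "\<alpha>2 \<in> E2" using P by (auto simp: E1_def E2_def)
  \<comment> \<open>The values of \<open>k\<close> for which \<open>x + k y\<close> does not separate two points of the grid.\<close>
  define bad where "bad = (\<lambda>((a, b), (a', b')). (a - a') / (b' - b)) ` ((E1 \<times> E2) \<times> (E1 \<times> E2))"
  have "finite bad" unfolding bad_def using fin by simp
  moreover have "\<not> finite (range (of_nat :: nat \<Rightarrow> complex))"
  proof
    assume "finite (range (of_nat :: nat \<Rightarrow> complex))"
    then have "finite (UNIV :: nat set)" by (rule finite_imageD) (simp add: inj_on_def)
    then show False by simp
  qed
  ultimately have "\<not> range (of_nat :: nat \<Rightarrow> complex) \<subseteq> bad" using finite_subset by blast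
  then obtain k :: nat where k: "of_nat k \<notin> bad" by blast
  define w where "w a b = a + of_nat k * b" for a b :: complex
  have w_inj: "a = a' \<and> b = b'" if "w a b = w a' b'" "a \<in> E1" "b \<in> E2" "a' \<in> E1" "b' \<in> E2" for a b a' b'
  proof (cases "b = b'")
    case True
    with that(1) show ?thesis by (simp add: w_def)
  next
    case False
    with that(1) have "of_nat k = (a - a') / (b' - b)" by (simp add: w_def field_simps)
    then have "of_nat k \<in> bad"
      unfolding bad_def using that by (intro image_eqI[of _ _ "((a, b), (a', b'))"]) auto
    with k show ?thesis by blast
  qed
  have card_w: "card ((\<lambda>(a, b). w a b) ` (E1 \<times> E2)) = n1 * n2"
  proof (subst card_image)
    show "inj_on (\<lambda>(a, b). w a b) (E1 \<times> E2)"
    proof (rule inj_onI)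
      fix p q assume "p \<in> E1 \<times> E2" "q \<in> E1 \<times> E2" "(\<lambda>(a, b). w a b) p = (\<lambda>(a, b). w a b) q"
      then show "p = q" using w_inj[of "fst p" "snd p" "fst q" "snd q"]
        by (simp add: case_prod_beta mem_Times_iff prod_eq_iff)
    qed
  qed (simp add: card_cartesian_product card)
  have gm: "grid_poly n1 n2 E1 E2 (\<lambda>x y. x ^ i * y ^ j)" for i j
    unfolding n1_def n2_def E1_def E2_def using P by (intro grid_poly_monom)
  have gw: "grid_poly n1 n2 E1 E2 (\<lambda>x y. w x y ^ j)" for j
  proof -
    have "grid_poly n1 n2 E1 E2 (\<lambda>x y. \<Sum>i\<le>j. of_rat (of_nat ((j choose i) * k ^ (j - i))) * (x ^ i * y ^ (j - i)))"
      by (intro grid_poly_sum grid_poly_scale gm) auto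
    moreover have "(\<Sum>i\<le>j. of_rat (of_nat ((j choose i) * k ^ (j - i))) * (x ^ i * y ^ (j - i))) = w x y ^ j" for x y
      unfolding w_def binomial_ring by (intro sum.cong refl) (simp add: power_mult_distrib of_rat_mult of_rat_power)
    ultimately show ?thesis by simp
  qed
  define \<gamma> where "\<gamma> = w \<alpha>1 \<alpha>2"
  define N where "N = n1 * n2"
  have "\<exists>q. q \<noteq> 0 \<and> qpoly q \<gamma> = 0"
  proof -
    obtain x :: "nat \<Rightarrow> rat" where x: "\<exists>j\<le>n1 * n2. x j \<noteq> 0"
      "\<And>a b. a \<in> E1 \<Longrightarrow> b \<in> E2 \<Longrightarrow> (\<Sum>j\<le>n1 * n2. of_rat (x j) * w a b ^ j) = 0"
      using grid_relation[of n1 n2 E1 E2 "\<lambda>j a b. w a b ^ j", OF gw] by blast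
    define q where "q = (\<Sum>j\<le>N. monom (x j) j)"
    have "coeff q j = x j" if "j \<le> N" for j
    proof -
      have "coeff q j = (\<Sum>i\<le>N. if i = j then x j else 0)"
        by (auto simp: q_def coeff_sum coeff_monom intro!: sum.cong)
      then show ?thesis using that by simp
    qed
    with x(1) have "q \<noteq> 0" unfolding N_def[symmetric] by (metis coeff_0)
    moreover have "qpoly q \<gamma> = 0"
      using x(2)[OF \<alpha>] by (simp add: q_def qpoly_sum qpoly_monom N_def \<gamma>_def)
    ultimately show ?thesis by blast
  qed
  then obtain g where g: "irreducible g" "qpoly g \<gamma> = 0" using ex_irreducible_annihilator by blast
  define u where "u j = (if j < N then (\<lambda>x y. w x y ^ j) else (\<lambda>x y. x ^ 0 * y ^ 1))" for j
  have gu: "grid_poly n1 n2 E1 E2 (u j)" for j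
    unfolding u_def using gw gm[of 0 1] by (cases "j < N") simp_all
  obtain x :: "nat \<Rightarrow> rat" where x: "\<exists>j\<le>n1 * n2. x j \<noteq> 0"
      "\<And>a b. a \<in> E1 \<Longrightarrow> b \<in> E2 \<Longrightarrow> (\<Sum>j\<le>n1 * n2. of_rat (x j) * u j a b) = 0"
    using grid_relation[of n1 n2 E1 E2 u, OF gu] by blast
  define q where "q = (\<Sum>j<N. monom (x j) j)"
  have cq: "coeff q j = (if j < N then x j else 0)" for j
  proof -
    have "coeff q j = (\<Sum>i<N. if i = j then x j else 0)"
      by (auto simp: q_def coeff_sum coeff_monom intro!: sum.cong)
    then show ?thesis by simp
  qed
  have rel: "qpoly q (w a b) + of_rat (x N) * b = 0" if "a \<in> E1" "b \<in> E2" for a b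
  proof -
    have "(\<Sum>j\<le>N. of_rat (x j) * u j a b) = (\<Sum>j<N. of_rat (x j) * u j a b) + of_rat (x N) * u N a b"
      by (simp only: lessThan_Suc_atMost[symmetric] sum.lessThan_Suc)
    then show ?thesis
      using x(2)[OF that] by (simp add: N_def[symmetric] q_def qpoly_sum qpoly_monom u_def)
  qed
  have "x N \<noteq> 0"
  proof
    assume xN: "x N = 0"
    have "map_poly of_rat q = (0 :: complex poly)"
    proof (rule poly_eqI_degree[of "(\<lambda>(a, b). w a b) ` (E1 \<times> E2)"])
      show "poly (map_poly of_rat q) z = poly 0 z" if "z \<in> (\<lambda>(a, b). w a b) ` (E1 \<times> E2)" for z :: complex
      proof -
        from that obtain a b where "a \<in> E1" "b \<in> E2" "z = w a b" by auto
        with rel[of a b] xN show ?thesis by (simp add: qpoly_def)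
      qed
      have "0 < N" using irreducible_degree_pos[OF P(1)] irreducible_degree_pos[OF P(3)]
        by (simp add: N_def n1_def n2_def)
      moreover have "degree q \<le> N - 1" by (rule degree_le) (auto simp: cq)
      ultimately show "degree (map_poly of_rat q :: complex poly) < card ((\<lambda>(a, b). w a b) ` (E1 \<times> E2))"
        "degree (0 :: complex poly) < card ((\<lambda>(a, b). w a b) ` (E1 \<times> E2))"
        unfolding card_w N_def[symmetric] by (simp_all add: degree_map_of_rat)
    qed
    then have "q = 0" by (subst (asm) map_poly_eq_0_iff) auto
    then have "x j = 0" if "j < N" for j using cq[of j] that by simp
    moreover obtain j where "j \<le> N" "x j \<noteq> 0" using x(1) unfolding N_def[symmetric] by blast
    ultimately show False using xN by (cases "j = N") auto
  qed
  define h2 where "h2 = [:- 1 / x N:] * q"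
  define h1 where "h1 = monom 1 1 - [:of_nat k:] * h2"
  have "qpoly q \<gamma> = - of_rat (x N) * \<alpha>2"
    using rel[OF \<alpha>] by (simp add: \<gamma>_def eq_neg_iff_add_eq_0)
  then have h2: "qpoly h2 \<gamma> = \<alpha>2"
    using \<open>x N \<noteq> 0\<close> unfolding h2_def qpoly_mult qpoly_const by (simp add: of_rat_divide of_rat_minus)
  have h1: "qpoly h1 \<gamma> = \<alpha>1"
    unfolding h1_def qpoly_diff qpoly_mult qpoly_const qpoly_monom h2 by (simp add: \<gamma>_def w_def)
  show thesis
    by (rule that[OF g h1 h2, of k]) (simp add: \<gamma>_def w_def)
qed

section \<open>The conjugates of a point\<close>

definition qfun :: "(complex \<Rightarrow> complex) \<Rightarrow> bool" where
  "qfun u \<longleftrightarrow> (\<exists>h. \<forall>z. u z = qpoly h z)"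

lemma qfun_qpoly: "qfun (qpoly h)"
  unfolding qfun_def by blast

lemma qfun_const: "qfun (\<lambda>_. of_rat c)"
  unfolding qfun_def by (rule exI[of _ "[:c:]"]) simp

lemma qfun_add: "qfun u \<Longrightarrow> qfun v \<Longrightarrow> qfun (\<lambda>z. u z + v z)"
  unfolding qfun_def by (metis qpoly_add)

lemma qfun_mult: "qfun u \<Longrightarrow> qfun v \<Longrightarrow> qfun (\<lambda>z. u z * v z)"
  unfolding qfun_def by (metis qpoly_mult)

lemma qfun_power: "qfun u \<Longrightarrow> qfun (\<lambda>z. u z ^ n)"
proof (induction n)
  case 0
  show ?case using qfun_const[of 1] by simp
next
  case (Suc n)
  then show ?case using qfun_mult by simp
qed

lemma qfun_sum: "finite A \<Longrightarrow> (\<And>a. a \<in> A \<Longrightarrow> qfun (u a)) \<Longrightarrow> qfun (\<lambda>z. \<Sum>a\<in>A. u a z)"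
proof (induction A rule: finite_induct)
  case empty
  show ?case using qfun_const[of 0] by simp
qed (simp add: qfun_add)

lemma subfield_contains_qpoly:
  assumes K: "subfield_of_complex K" and z: "z \<in> K"
  shows "qpoly h z \<in> K"
proof -
  have one: "1 \<in> K" and diff: "x - y \<in> K" and mult: "x * y \<in> K" and inv: "inverse x \<in> K"
    if "x \<in> K" "y \<in> K" for x y
    using K that unfolding subfield_of_complex_def by blast+
  have zero: "0 \<in> K" using diff[OF z z] by simp
  have add: "x + y \<in> K" if "x \<in> K" "y \<in> K" for x y
    using diff[OF that(1) diff[OF zero that(2)]] by simp
  have nat: "of_nat n \<in> K" for n
    by (induction n) (use zero add one[OF z z] in auto)
  have int: "of_int n \<in> K" for n
    using nat diff[OF zero nat] by (cases n rule: int_cases2) auto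
  have rat: "of_rat r \<in> K" for r
  proof (cases r)
    case (Fract a b)
    then have "of_rat r = (of_int a * inverse (of_int b) :: complex)"
      by (simp add: of_rat_rat divide_inverse)
    then show ?thesis using mult[OF int inv[OF int int]] by simp
  qed
  have pow: "z ^ i \<in> K" for i
    by (induction i) (use one[OF z z] mult[OF z] in auto)
  have sum: "(\<Sum>i<n. of_rat (coeff h i) * z ^ i) \<in> K" for n
    by (induction n) (use zero add mult rat pow in auto)
  show ?thesis unfolding qpoly_eq_sum[of h "Suc (degree h)", OF lessI] by (rule sum)
qed

lemma rat_adjoin_eq:
  assumes g: "irreducible g" "qpoly g \<gamma> = 0" and h: "qpoly h1 \<gamma> = \<alpha>1" "qpoly h2 \<gamma> = \<alpha>2"
    and \<gamma>: "\<gamma> = \<alpha>1 + of_nat k * \<alpha>2"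
  shows "rat_adjoin \<alpha>1 \<alpha>2 = range (\<lambda>h. qpoly h \<gamma>)"
proof
  have "subfield_of_complex (range (\<lambda>h. qpoly h \<gamma>))"
    unfolding subfield_of_complex_def
  proof (intro conjI ballI)
    show "1 \<in> range (\<lambda>h. qpoly h \<gamma>)" by (metis qpoly_1 rangeI)
    fix x assume "x \<in> range (\<lambda>h. qpoly h \<gamma>)"
    then obtain p where p: "x = qpoly p \<gamma>" by blast
    show "inverse x \<in> range (\<lambda>h. qpoly h \<gamma>)"
    proof (cases "x = 0")
      case True
      then show ?thesis by (metis inverse_zero qpoly_0 rangeI)
    next
      case False
      then have "\<not> g dvd p" using g(2) p qpoly_dvd_root by blast
      with g(1) obtain u v where uv: "u * g + v * p = 1" by (rule irreducible_bezout)
      have "qpoly (u * g + v * p) \<gamma> = 1" unfolding uv by simp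
      then have "qpoly v \<gamma> * x = 1" by (simp add: qpoly_add qpoly_mult g(2) p)
      then have "inverse x = qpoly v \<gamma>" using False by (simp add: field_simps)
      then show ?thesis by blast
    qed
    fix y assume "y \<in> range (\<lambda>h. qpoly h \<gamma>)"
    then obtain q where q: "y = qpoly q \<gamma>" by blast
    show "x - y \<in> range (\<lambda>h. qpoly h \<gamma>)" unfolding p q qpoly_diff[symmetric] by blast
    show "x * y \<in> range (\<lambda>h. qpoly h \<gamma>)" unfolding p q qpoly_mult[symmetric] by blast
  qed
  moreover have "{\<alpha>1, \<alpha>2} \<subseteq> range (\<lambda>h. qpoly h \<gamma>)" using h by blast
  ultimately show "rat_adjoin \<alpha>1 \<alpha>2 \<subseteq> range (\<lambda>h. qpoly h \<gamma>)"
    unfolding rat_adjoin_def by (intro hull_minimal)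
next
  show "range (\<lambda>h. qpoly h \<gamma>) \<subseteq> rat_adjoin \<alpha>1 \<alpha>2"
    unfolding rat_adjoin_def hull_def
  proof (clarify, rename_tac p K)
    fix p K assume K: "subfield_of_complex K" "{\<alpha>1, \<alpha>2} \<subseteq> K"
    have "qpoly (monom (of_nat k) 1) \<alpha>2 \<in> K" using K by (intro subfield_contains_qpoly) auto
    then have k2: "of_nat k * \<alpha>2 \<in> K" by (simp add: qpoly_monom)
    have "0 - of_nat k * \<alpha>2 \<in> K" "\<alpha>1 - (0 - of_nat k * \<alpha>2) \<in> K"
      using K k2 unfolding subfield_of_complex_def by (metis diff_self insert_subset)+
    then have "\<gamma> \<in> K" by (simp add: \<gamma>)
    with K(1) show "qpoly p \<gamma> \<in> K" by (rule subfield_contains_qpoly)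
  qed
qed

lemma dim_range_qpoly:
  assumes g: "irreducible g" "qpoly g \<gamma> = 0"
  shows "rat_vs.dim (range (\<lambda>h. qpoly h \<gamma>)) = degree g"
proof -
  define d where "d = degree g"
  have small: "h = 0" if "qpoly h \<gamma> = 0" "degree h < d" for h
  proof (rule ccontr)
    assume "h \<noteq> 0"
    from dvd_imp_degree_le[OF irreducible_dvd_of_root[OF g that(1)] this] that(2)
    show False by (simp add: d_def)
  qed
  have zero: "c i = 0" if "(\<Sum>i<d. of_rat (c i) * \<gamma> ^ i) = 0" "i < d" for c i
  proof -
    define h where "h = (\<Sum>i<d. monom (c i) i)"
    have ch: "coeff h j = (if j < d then c j else 0)" for j
    proof -
      have "coeff h j = (\<Sum>i<d. if i = j then c j else 0)"
        by (auto simp: h_def coeff_sum coeff_monom intro!: sum.cong)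
      then show ?thesis by simp
    qed
    have "degree h \<le> d - 1" by (rule degree_le) (auto simp: ch)
    moreover have "0 < d" using that(2) by simp
    moreover have "qpoly h \<gamma> = 0" using that(1) by (simp add: h_def qpoly_sum qpoly_monom)
    ultimately have "h = 0" by (intro small) auto
    then show ?thesis using ch[of i] that(2) by simp
  qed
  have inj: "inj_on (\<lambda>i. \<gamma> ^ i) {..<d}"
  proof (rule inj_onI, rule ccontr)
    fix i j assume ij: "i \<in> {..<d}" "j \<in> {..<d}" "\<gamma> ^ i = \<gamma> ^ j" "i \<noteq> j"
    define c where "c l = (if l = i then 1 else if l = j then - 1 else 0 :: rat)" for l
    have "(\<Sum>l<d. of_rat (c l) * \<gamma> ^ l) = (\<Sum>l<d. (if l = i then \<gamma> ^ i else 0) - (if l = j then \<gamma> ^ j else 0))"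
      using ij(4) by (intro sum.cong) (auto simp: c_def of_rat_minus)
    also have "\<dots> = 0" using ij by (simp add: sum_subtractf)
    finally have "c i = 0" using ij(1) by (intro zero) auto
    then show False by (simp add: c_def)
  qed
  show ?thesis
    unfolding d_def[symmetric]
  proof (rule rat_vs.dim_unique)
    show "(\<lambda>i. \<gamma> ^ i) ` {..<d} \<subseteq> range (\<lambda>h. qpoly h \<gamma>)"
    proof clarify
      fix i
      show "\<gamma> ^ i \<in> range (\<lambda>h. qpoly h \<gamma>)"
        by (rule image_eqI[of _ _ "monom 1 i"]) (simp_all add: qpoly_monom)
    qed
    show "range (\<lambda>h. qpoly h \<gamma>) \<subseteq> rat_vs.span ((\<lambda>i. \<gamma> ^ i) ` {..<d})"
    proof clarify
      fix h
      define r where "r = h mod g"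
      have g0: "g \<noteq> 0" using g(1) by (simp add: irreducible_def)
      have degr: "degree r < d"
        unfolding r_def d_def using g0 irreducible_degree_pos[OF g(1)] by (metis degree_0 degree_mod_less)
      have "h = h div g * g + r" by (simp add: r_def)
      then have "qpoly h \<gamma> = qpoly (h div g * g + r) \<gamma>" by simp
      then have "qpoly h \<gamma> = (\<Sum>i<d. of_rat (coeff r i) * \<gamma> ^ i)"
        using qpoly_eq_sum[OF degr] by (simp add: qpoly_add qpoly_mult g(2))
      also have "\<dots> \<in> rat_vs.span ((\<lambda>i. \<gamma> ^ i) ` {..<d})"
        by (intro rat_vs.span_sum rat_vs.span_scale rat_vs.span_base) auto
      finally show "qpoly h \<gamma> \<in> rat_vs.span ((\<lambda>i. \<gamma> ^ i) ` {..<d})" .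
    qed
    show "rat_vs.independent ((\<lambda>i. \<gamma> ^ i) ` {..<d})"
    proof (rule rat_vs.independent_if_scalars_zero)
      fix u x assume u: "(\<Sum>x\<in>(\<lambda>i. \<gamma> ^ i) ` {..<d}. of_rat (u x) * x) = 0" "x \<in> (\<lambda>i. \<gamma> ^ i) ` {..<d}"
      have "(\<Sum>i<d. of_rat (u (\<gamma> ^ i)) * \<gamma> ^ i) = 0" using u(1) inj by (simp add: sum.reindex)
      with u(2) zero[of "\<lambda>i. u (\<gamma> ^ i)"] show "u x = 0" by auto
    qed simp
    show "card ((\<lambda>i. \<gamma> ^ i) ` {..<d}) = d" using inj by (simp add: card_image)
  qed
qed

text \<open>
  The Galois theory used below. With \<open>\<alpha>1 = h1(\<gamma>)\<close> and \<open>\<alpha>2 = h2(\<gamma>)\<close>, the set \<open>S\<close> consists of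
  the points \<open>(h1(z), h2(z))\<close>, where \<open>z\<close> runs through the roots of the minimal polynomial of \<open>\<gamma>\<close>. A
  rational relation that holds for one root holds for all, and sums over the roots are traces.
\<close>
theorem conjugate_point_set:
  assumes "algebraic \<alpha>1" "algebraic \<alpha>2"
  obtains S where "finite S" "(\<alpha>1, \<alpha>2) \<in> S" "S \<subseteq> conjugate_points \<alpha>1 \<alpha>2"
    "card S = rat_adjoin_degree \<alpha>1 \<alpha>2"
    "\<And>H s s'. (\<forall>i j. xycoeff H i j \<in> \<rat>) \<Longrightarrow> s \<in> S \<Longrightarrow> s' \<in> S \<Longrightarrow> xyeval H (fst s) (snd s) = 0 \<Longrightarrow>
       xyeval H (fst s') (snd s') = 0"
    "\<And>k l. (\<Sum>s\<in>S. fst s ^ k * snd s ^ l) \<in> \<rat>"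
proof -
  obtain g h1 h2 \<gamma> k where g: "irreducible g" "qpoly g \<gamma> = 0"
    and h: "qpoly h1 \<gamma> = \<alpha>1" "qpoly h2 \<gamma> = \<alpha>2" and \<gamma>: "\<gamma> = \<alpha>1 + of_nat k * \<alpha>2"
    using primitive_element[OF assms] by metis
  define \<Gamma> where "\<Gamma> = {z. qpoly g z = 0}"
  define pt where "pt z = (qpoly h1 z, qpoly h2 z)" for z
  define S where "S = pt ` \<Gamma>"
  have g0: "g \<noteq> 0" using g(1) by (simp add: irreducible_def)
  have fin: "finite \<Gamma>" unfolding \<Gamma>_def using g0 by (rule finite_qpoly_roots)
  have \<gamma>\<Gamma>: "\<gamma> \<in> \<Gamma>" using g by (simp add: \<Gamma>_def)
  have transfer: "qpoly p z' = 0" if "qpoly p z = 0" "z \<in> \<Gamma>" "z' \<in> \<Gamma>" for p z z'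
    using irreducible_dvd_of_root[OF g(1), of z p] qpoly_dvd_root[of g p z'] that by (simp add: \<Gamma>_def)
  have transfer_eq: "qpoly p z' = qpoly q z'" if "qpoly p z = qpoly q z" "z \<in> \<Gamma>" "z' \<in> \<Gamma>" for p q z z'
    using transfer[of "p - q" z z'] that by (simp add: qpoly_diff)
  have inj: "inj_on pt \<Gamma>"
  proof (rule inj_onI)
    fix z w assume zw: "z \<in> \<Gamma>" "w \<in> \<Gamma>" "pt z = pt w"
    have "qpoly (h1 + [:of_nat k:] * h2) \<gamma> = qpoly (monom 1 1) \<gamma>"
      unfolding qpoly_add qpoly_mult qpoly_monom qpoly_const h by (simp add: \<gamma>)
    from transfer_eq[OF this \<gamma>\<Gamma>]
    have rel: "qpoly h1 u + of_nat k * qpoly h2 u = u" if "u \<in> \<Gamma>" for u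
      using that unfolding qpoly_add qpoly_mult qpoly_monom qpoly_const by simp
    have "z = qpoly h1 z + of_nat k * qpoly h2 z" using rel[OF zw(1)] by (rule sym)
    also have "\<dots> = qpoly h1 w + of_nat k * qpoly h2 w" using zw(3) by (simp add: pt_def)
    also have "\<dots> = w" by (rule rel[OF zw(2)])
    finally show "z = w" .
  qed
  have adj: "rat_adjoin \<alpha>1 \<alpha>2 = range (\<lambda>h. qpoly h \<gamma>)"
    by (rule rat_adjoin_eq[OF g h \<gamma>])
  show thesis
  proof (rule that[of S])
    show "finite S" using fin by (simp add: S_def)
    show "(\<alpha>1, \<alpha>2) \<in> S" unfolding S_def using \<gamma>\<Gamma> h by (intro image_eqI[of _ _ \<gamma>]) (simp_all add: pt_def)
    have "card S = degree g"
      unfolding S_def using inj card_qpoly_roots[OF g(1)] by (simp add: card_image \<Gamma>_def)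
    then show "card S = rat_adjoin_degree \<alpha>1 \<alpha>2"
      unfolding rat_adjoin_degree_def adj dim_range_qpoly[OF g] .
    show "S \<subseteq> conjugate_points \<alpha>1 \<alpha>2"
    proof
      fix s assume "s \<in> S"
      then obtain w where w: "w \<in> \<Gamma>" "s = pt w" by (auto simp: S_def)
      define \<sigma> where "\<sigma> z = qpoly (SOME p. qpoly p \<gamma> = z) w" for z
      have \<sigma>: "\<sigma> (qpoly p \<gamma>) = qpoly p w" for p
      proof -
        have "qpoly (SOME q. qpoly q \<gamma> = qpoly p \<gamma>) \<gamma> = qpoly p \<gamma>"
          by (rule someI[of "\<lambda>q. qpoly q \<gamma> = qpoly p \<gamma>" p]) simp
        then show ?thesis unfolding \<sigma>_def by (rule transfer_eq[OF _ \<gamma>\<Gamma> w(1)])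
      qed
      have "field_embedding (rat_adjoin \<alpha>1 \<alpha>2) \<sigma>"
        unfolding field_embedding_def adj
      proof (intro conjI ballI)
        show "\<sigma> 1 = 1" using \<sigma>[of 1] by simp
        fix x y assume "x \<in> range (\<lambda>h. qpoly h \<gamma>)" "y \<in> range (\<lambda>h. qpoly h \<gamma>)"
        then obtain p q where pq: "x = qpoly p \<gamma>" "y = qpoly q \<gamma>" by blast
        show "\<sigma> (x + y) = \<sigma> x + \<sigma> y"
          unfolding pq qpoly_add[symmetric] \<sigma> by (simp add: qpoly_add)
        show "\<sigma> (x * y) = \<sigma> x * \<sigma> y"
          unfolding pq qpoly_mult[symmetric] \<sigma> by (simp add: qpoly_mult)
      qed
      moreover have "s = (\<sigma> \<alpha>1, \<sigma> \<alpha>2)"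
        unfolding w(2) pt_def h[symmetric] \<sigma> ..
      ultimately show "s \<in> conjugate_points \<alpha>1 \<alpha>2"
        unfolding conjugate_points_def by blast
    qed
  next
    fix H s s' assume H: "\<forall>i j. xycoeff H i j \<in> \<rat>" and s: "s \<in> S" "s' \<in> S" and 0: "xyeval H (fst s) (snd s) = 0"
    obtain n where n: "tdeg_le n H" using ex_tdeg_le by blast
    have "qfun (\<lambda>z. \<Sum>p\<in>exponents_le n. xycoeff H (fst p) (snd p) * (qpoly h1 z ^ fst p * qpoly h2 z ^ snd p))"
    proof (intro qfun_sum qfun_mult qfun_power qfun_qpoly finite_exponents_le)
      fix p
      have "xycoeff H (fst p) (snd p) \<in> \<rat>" using H by blast
      then obtain r where "xycoeff H (fst p) (snd p) = of_rat r" by (auto elim: Rats_cases)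
      then show "qfun (\<lambda>_. xycoeff H (fst p) (snd p))" using qfun_const by simp
    qed
    then obtain p where p: "\<And>z. xyeval H (qpoly h1 z) (qpoly h2 z) = qpoly p z"
      unfolding qfun_def xyeval_expand[OF n] case_prod_beta by blast
    from s obtain z z' where "z \<in> \<Gamma>" "s = pt z" "z' \<in> \<Gamma>" "s' = pt z'" by (auto simp: S_def)
    with 0 transfer[of p z z'] show "xyeval H (fst s') (snd s') = 0" by (simp add: pt_def p)
  next
    fix k l
    have "qfun (\<lambda>z. qpoly h1 z ^ k * qpoly h2 z ^ l)" by (intro qfun_mult qfun_power qfun_qpoly)
    then obtain p where p: "\<And>z. qpoly h1 z ^ k * qpoly h2 z ^ l = qpoly p z" unfolding qfun_def by blast
    have "(\<Sum>s\<in>S. fst s ^ k * snd s ^ l) = (\<Sum>z\<in>\<Gamma>. qpoly p z)"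
      unfolding S_def sum.reindex[OF inj] by (simp add: pt_def p)
    then show "(\<Sum>s\<in>S. fst s ^ k * snd s ^ l) \<in> \<rat>"
      using trace_rational[OF g(1), of p] by (simp add: \<Gamma>_def)
  qed
qed

section \<open>Algebraic integers and integer polynomials\<close>

text \<open>
  An eigenvalue of an integer matrix is a root of its characteristic polynomial, which is monic
  with integer coefficients.
\<close>
lemma integer_eigenvalue_algebraic_int:
  fixes v :: "'i \<Rightarrow> complex" and M :: "'i \<Rightarrow> 'i \<Rightarrow> int"
  assumes I: "finite I" and v: "\<exists>i\<in>I. v i \<noteq> 0"
    and M: "\<And>i. i \<in> I \<Longrightarrow> z * v i = (\<Sum>j\<in>I. of_int (M i j) * v j)"
  shows "algebraic_int z"
proof -
  define n where "n = card I"
  obtain h where h: "bij_betw h {0..<n} I"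
    using ex_bij_betw_nat_finite[OF I] unfolding n_def by blast
  have hI: "h i \<in> I" if "i < n" for i using h that by (auto simp: bij_betw_def)
  define A :: "int mat" where "A = mat n n (\<lambda>(i, j). M (h i) (h j))"
  define A' :: "complex mat" where "A' = map_mat of_int A"
  define w where "w = vec n (\<lambda>i. v (h i))"
  have A: "A \<in> carrier_mat n n" "A' \<in> carrier_mat n n" by (auto simp: A_def A'_def)
  have "eigenvector A' w z"
    unfolding eigenvector_def
  proof (intro conjI)
    show "w \<in> carrier_vec (dim_row A')" by (simp add: w_def A'_def A_def)
    obtain i where i: "i \<in> I" "v i \<noteq> 0" using v by blast
    then have "i \<in> h ` {0..<n}" using h by (simp add: bij_betw_def)
    then obtain k where k: "k < n" "h k = i" by auto
    show "w \<noteq> 0\<^sub>v (dim_row A')"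
    proof
      assume "w = 0\<^sub>v (dim_row A')"
      then have "w $ k = 0\<^sub>v (dim_row A') $ k" by simp
      then show False using k i by (simp add: w_def A'_def A_def)
    qed
    show "A' *\<^sub>v w = z \<cdot>\<^sub>v w"
    proof (rule eq_vecI)
      fix i assume "i < dim_vec (z \<cdot>\<^sub>v w)"
      then have i: "i < n" by (simp add: w_def)
      have "(A' *\<^sub>v w) $ i = (\<Sum>j\<in>{0..<n}. of_int (M (h i) (h j)) * v (h j))"
        using i by (simp add: A'_def A_def w_def scalar_prod_def)
      also have "\<dots> = (\<Sum>j\<in>I. of_int (M (h i) j) * v j)"
        by (rule sum.reindex_bij_betw[OF h])
      also have "\<dots> = z * v (h i)" using M[OF hI[OF i]] by simp
      finally show "(A' *\<^sub>v w) $ i = (z \<cdot>\<^sub>v w) $ i" using i by (simp add: w_def)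
    qed (simp add: w_def A'_def A_def)
  qed
  then have "eigenvalue A' z" unfolding eigenvalue_def by blast
  then have "poly (char_poly A') z = 0" using eigenvalue_root_char_poly[OF A(2)] by simp
  moreover have "char_poly A' = map_poly of_int (char_poly A)"
    unfolding A'_def by (rule of_int_hom.char_poly_hom[OF A(1)])
  moreover have "lead_coeff (char_poly A) = 1" using degree_monic_char_poly[OF A(1)] by simp
  ultimately show ?thesis unfolding algebraic_int_altdef_ipoly by auto
qed

lemma poly_of_int_const [simp]: "poly (map_poly of_int [:c:]) (x :: complex) = of_int c"
proof -
  have "map_poly of_int [:c:] = [:of_int c :: complex:]"
    by (rule poly_eqI) (simp add: coeff_map_poly coeff_pCons split: nat.split)
  then show ?thesis by simp
qed

lemma algebraic_int_power_reduce:
  assumes "algebraic_int (x :: complex)"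
  obtains n where "0 < n" "\<And>a. \<exists>c :: nat \<Rightarrow> int. x ^ a = (\<Sum>i<n. of_int (c i) * x ^ i)"
proof -
  obtain p :: "int poly" where p: "poly (map_poly of_int p) x = 0" "lead_coeff p = 1"
    using assms unfolding algebraic_int_altdef_ipoly by auto
  define n where "n = degree p"
  have "n \<noteq> 0"
  proof
    assume "n = 0"
    then obtain c where "p = [:c:]" using degree_eq_zeroE[of p] n_def by metis
    then show False using p poly_of_int_const[of c x] by simp
  qed
  have "0 = (\<Sum>i\<le>n. of_int (coeff p i) * x ^ i)"
    using p(1) by (simp add: poly_altdef n_def coeff_map_poly degree_map_poly)
  then have xn: "x ^ n = (\<Sum>i<n. of_int (- coeff p i) * x ^ i)"
    using p(2) by (simp add: lessThan_Suc_atMost[symmetric] n_def[symmetric] sum_negf eq_neg_iff_add_eq_0 add.commute)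
  have "\<exists>c :: nat \<Rightarrow> int. x ^ a = (\<Sum>i<n. of_int (c i) * x ^ i)" for a
  proof (induction a)
    case 0
    have "(\<Sum>i<n. of_int (if i = 0 then 1 else 0) * x ^ i) = (\<Sum>i<n. if i = 0 then 1 else 0)"
      by (intro sum.cong) auto
    also have "\<dots> = x ^ 0" using \<open>n \<noteq> 0\<close> by simp
    finally show ?case by metis
  next
    case (Suc a)
    then obtain c :: "nat \<Rightarrow> int" where c: "x ^ a = (\<Sum>i<n. of_int (c i) * x ^ i)" by blast
    obtain n' where n': "n = Suc n'" using \<open>n \<noteq> 0\<close> not0_implies_Suc by blast
    define d where "d i = (if i = 0 then 0 else c (i - 1)) - c n' * coeff p i" for i
    have shift: "(\<Sum>i<n. of_int (if i = 0 then 0 else c (i - 1)) * x ^ i) = (\<Sum>i<n'. of_int (c i) * x ^ Suc i)"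
      unfolding n' by (subst sum.lessThan_Suc_shift) simp
    have "x ^ Suc a = (\<Sum>i<n. of_int (c i) * x ^ Suc i)"
      by (simp add: c sum_distrib_left mult_ac)
    also have "\<dots> = (\<Sum>i<n'. of_int (c i) * x ^ Suc i) + of_int (c n') * x ^ n"
      by (simp add: n')
    also have "\<dots> = (\<Sum>i<n. of_int (d i) * x ^ i)"
      unfolding xn shift[symmetric]
      by (simp add: d_def sum_distrib_left left_diff_distrib sum_subtractf sum_negf mult.assoc)
    finally show ?case by blast
  qed
  with \<open>n \<noteq> 0\<close> show thesis by (intro that[of n]) auto
qed

text \<open>
  Multiplication by \<open>x + y\<close> and by \<open>x y\<close> acts with integer coefficients on the finitely many products
  \<open>x^i y^j\<close> with \<open>i < m\<close> and \<open>j < n\<close>.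
\<close>
lemma algebraic_int_add_mult:
  fixes x y :: complex
  assumes "algebraic_int x" "algebraic_int y"
  shows "algebraic_int (x + y)" "algebraic_int (x * y)"
proof -
  obtain m where m: "0 < m" "\<And>a. \<exists>c :: nat \<Rightarrow> int. x ^ a = (\<Sum>i<m. of_int (c i) * x ^ i)"
    using algebraic_int_power_reduce[OF assms(1)] by blast
  obtain n where n: "0 < n" "\<And>a. \<exists>c :: nat \<Rightarrow> int. y ^ a = (\<Sum>i<n. of_int (c i) * y ^ i)"
    using algebraic_int_power_reduce[OF assms(2)] by blast
  define I where "I = {..<m} \<times> {..<n}"
  define v where "v p = x ^ fst p * y ^ snd p" for p
  have fin: "finite I" by (simp add: I_def)
  have v: "\<exists>i\<in>I. v i \<noteq> 0" using m n by (intro bexI[of _ "(0, 0)"]) (auto simp: I_def v_def)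
  have red: "\<exists>c :: nat \<times> nat \<Rightarrow> int. x ^ a * y ^ b = (\<Sum>p\<in>I. of_int (c p) * v p)" for a b
  proof -
    obtain c d :: "nat \<Rightarrow> int" where
      cd: "x ^ a = (\<Sum>i<m. of_int (c i) * x ^ i)" "y ^ b = (\<Sum>i<n. of_int (d i) * y ^ i)"
      using m(2) n(2) by metis
    have "x ^ a * y ^ b = (\<Sum>p\<in>I. of_int (c (fst p) * d (snd p)) * v p)"
      unfolding cd sum_product sum.cartesian_product I_def v_def
      by (intro sum.cong) (auto simp: mult_ac)
    then show ?thesis by (rule exI[of _ "\<lambda>p. c (fst p) * d (snd p)"])
  qed
  have "\<forall>p. \<exists>c :: nat \<times> nat \<Rightarrow> int. x * y * v p = (\<Sum>q\<in>I. of_int (c q) * v q)"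
    using red[of "Suc (fst p)" "Suc (snd p)" for p] by (simp add: v_def mult_ac)
  from choice[OF this] obtain M :: "nat \<times> nat \<Rightarrow> nat \<times> nat \<Rightarrow> int" where
    "\<forall>p. x * y * v p = (\<Sum>q\<in>I. of_int (M p q) * v q)" ..
  then show "algebraic_int (x * y)"
    by (intro integer_eigenvalue_algebraic_int[OF fin v, of _ M]) blast
  have "\<forall>p. \<exists>c :: nat \<times> nat \<Rightarrow> int. (x + y) * v p = (\<Sum>q\<in>I. of_int (c q) * v q)"
  proof
    fix p
    obtain c d :: "nat \<times> nat \<Rightarrow> int" where
      cd: "x ^ Suc (fst p) * y ^ snd p = (\<Sum>q\<in>I. of_int (c q) * v q)"
        "x ^ fst p * y ^ Suc (snd p) = (\<Sum>q\<in>I. of_int (d q) * v q)"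
      using red by metis
    have "(x + y) * v p = x ^ Suc (fst p) * y ^ snd p + x ^ fst p * y ^ Suc (snd p)"
      by (simp add: v_def algebra_simps)
    also have "\<dots> = (\<Sum>q\<in>I. of_int (c q + d q) * v q)"
      unfolding cd by (simp add: distrib_right sum.distrib)
    finally show "\<exists>c :: nat \<times> nat \<Rightarrow> int. (x + y) * v p = (\<Sum>q\<in>I. of_int (c q) * v q)"
      by (rule exI[of _ "\<lambda>q. c q + d q"])
  qed
  from choice[OF this] obtain M :: "nat \<times> nat \<Rightarrow> nat \<times> nat \<Rightarrow> int" where
    "\<forall>p. (x + y) * v p = (\<Sum>q\<in>I. of_int (M p q) * v q)" ..
  then show "algebraic_int (x + y)"
    by (intro integer_eigenvalue_algebraic_int[OF fin v, of _ M]) blast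
qed

lemma algebraic_int_power_complex: "algebraic_int (x :: complex) \<Longrightarrow> algebraic_int (x ^ n)"
  by (induction n) (auto intro: algebraic_int_add_mult(2))

lemma algebraic_int_sum_complex:
  "(\<And>a. a \<in> A \<Longrightarrow> algebraic_int (f a :: complex)) \<Longrightarrow> algebraic_int (sum f A)"
  by (induction A rule: infinite_finite_induct) (auto intro: algebraic_int_add_mult(1))

lemma algebraic_int_lead_coeff_mult:
  fixes x :: complex
  assumes "p \<noteq> 0" "poly (map_poly of_int p) x = 0"
  shows "algebraic_int (of_int (lead_coeff p) * x)"
proof -
  define n a where "n = degree p" and "a = lead_coeff p"
  have n0: "n \<noteq> 0"
  proof
    assume "n = 0"
    then obtain c where "p = [:c:]" using degree_eq_zeroE[of p] n_def by metis
    then show False using assms poly_of_int_const[of c x] by simp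
  qed
  have root: "(\<Sum>i<n. of_int (coeff p i) * x ^ i) + of_int a * x ^ n = 0"
    using assms(2)
    by (simp add: poly_altdef n_def a_def coeff_map_poly degree_map_poly lessThan_Suc_atMost[symmetric])
  define z where "z = of_int a * x"
  \<comment> \<open>The companion matrix of the polynomial for \<open>z = a x\<close>.\<close>
  define M where "M i j = (if Suc i < n then (if j = Suc i then 1 else 0)
      else - (coeff p j * a ^ (n - 1 - j)))" for i j
  show ?thesis
    unfolding a_def[symmetric] z_def[symmetric]
  proof (rule integer_eigenvalue_algebraic_int[of "{..<n}" "\<lambda>i. z ^ i" z M])
    show "\<exists>i\<in>{..<n}. z ^ i \<noteq> 0" using n0 by (intro bexI[of _ 0]) auto
    fix i assume i: "i \<in> {..<n}"
    show "z * z ^ i = (\<Sum>j\<in>{..<n}. of_int (M i j) * z ^ j)"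
    proof (cases "Suc i < n")
      case True
      then have "(\<Sum>j<n. of_int (M i j) * z ^ j) = (\<Sum>j<n. if j = Suc i then z ^ Suc i else 0)"
        by (intro sum.cong) (auto simp: M_def)
      then show ?thesis using True by simp
    next
      case False
      with i have ni: "n = Suc i" by auto
      have "of_int (M i j) * z ^ j = - (of_int a ^ i * (of_int (coeff p j) * x ^ j))" if "j < n" for j
      proof -
        have "of_int a ^ i = (of_int a ^ (i - j) * of_int a ^ j :: complex)"
          using that ni by (simp flip: power_add)
        then show ?thesis using False ni by (simp add: M_def z_def power_mult_distrib)
      qed
      then have "(\<Sum>j<n. of_int (M i j) * z ^ j) = - (of_int a ^ i * (\<Sum>j<n. of_int (coeff p j) * x ^ j))"
        by (simp add: sum_distrib_left sum_negf)
      also have "\<dots> = of_int a ^ i * (of_int a * x ^ n)"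
        using root by (simp add: add_eq_0_iff)
      also have "\<dots> = z * z ^ i" by (simp add: z_def ni power_mult_distrib)
      finally show ?thesis by simp
    qed
  qed simp
qed

lemma rational_algebraic_int_complex:
  assumes "algebraic_int (z :: complex)" "z \<in> \<rat>"
  shows "z \<in> \<int>"
  using assms rational_algebraic_int_is_int by blast

text \<open>
  A form of Gauss's lemma. Let \<open>w\<close> be an integer polynomial of minimal degree that vanishes at \<open>\<alpha>\<close>.
  Pseudo-division by \<open>w\<close> shows that \<open>w\<close> divides a nonzero integer multiple of each
  polynomial that vanishes at \<open>\<alpha>\<close>. As \<open>r\<close> is prime, it divides \<open>w\<close>, and then the given polynomial.
\<close>
lemma irreducible_int_poly_dvd:
  fixes r h :: "int poly" and \<alpha> :: complex
  assumes r: "irreducible r" "poly (map_poly of_int r) \<alpha> = 0" and h: "poly (map_poly of_int h) \<alpha> = 0"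
  shows "r dvd h"
proof -
  define rt where "rt h \<longleftrightarrow> poly (map_poly of_int h) \<alpha> = 0" for h :: "int poly"
  have rt_mult: "rt (a * b) \<longleftrightarrow> rt a \<or> rt b" for a b
    by (simp add: rt_def of_int_poly_hom.hom_mult)
  have rt_add: "rt (a + b) \<Longrightarrow> rt a \<Longrightarrow> rt b" for a b
    by (simp add: rt_def of_int_poly_hom.hom_add)
  have rt_const: "c = 0" if "rt [:c:]" for c using that poly_of_int_const[of c \<alpha>] unfolding rt_def by simp
  have rt_deg: "0 < degree h" if "rt h" "h \<noteq> 0" for h
  proof (rule ccontr)
    assume "\<not> 0 < degree h"
    then obtain c where "h = [:c:]" using degree_eq_zeroE[of h] by auto
    with that rt_const show False by auto
  qed
  have r0: "r \<noteq> 0" using r(1) by (auto simp: irreducible_def)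
  have prime: "prime_elem r" using r(1) by (rule irreducible_imp_prime_elem)
  obtain w where w: "w \<noteq> 0" "rt w" and least: "\<And>h. h \<noteq> 0 \<Longrightarrow> rt h \<Longrightarrow> degree w \<le> degree h"
    using ex_has_least_nat[of "\<lambda>h. h \<noteq> 0 \<and> rt h" r degree] r r0 unfolding rt_def by blast
  have key: "\<exists>c s. c \<noteq> 0 \<and> [:c:] * h = w * s" if "rt h" for h
  proof -
    obtain s t where st: "pseudo_divmod h w = (s, t)" by force
    define c where "c = lead_coeff w ^ (Suc (degree h) - degree w)"
    have c0: "c \<noteq> 0" using w(1) by (simp add: c_def)
    from pseudo_divmod[OF w(1) st] have eq: "[:c:] * h = w * s + t" and t: "t = 0 \<or> degree t < degree w"
      by (auto simp: c_def)
    have "rt (w * s + t)" using that unfolding eq[symmetric] rt_mult by blast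
    then have "rt t" using w(2) rt_add rt_mult by blast
    with t least[of t] have "t = 0" by fastforce
    with eq c0 show ?thesis by auto
  qed
  have not_const: "\<not> r dvd [:c:]" if "c \<noteq> 0" for c
  proof
    assume "r dvd [:c:]"
    moreover have "[:c:] \<noteq> 0" using that by simp
    ultimately have "degree r \<le> degree [:c:]" by (rule dvd_imp_degree_le)
    then show False using rt_deg[of r] r(2) r0 by (simp add: rt_def)
  qed
  obtain c s where cs: "c \<noteq> 0" "[:c:] * r = w * s" using key[of r] r(2) unfolding rt_def by blast
  have "r dvd w * s" unfolding cs(2)[symmetric] by (rule dvd_triv_right)
  with prime have "r dvd w \<or> r dvd s" by (simp add: prime_elem_dvd_mult_iff)
  moreover have "\<not> r dvd s"
  proof
    assume "r dvd s"
    then obtain s' where "s = r * s'" by (rule dvdE)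
    with cs(2) have "r * (w * s') = r * [:c:]" by (simp only: mult_ac)
    then have eq: "w * s' = [:c:]" using r0 by (simp only: mult_cancel_left) simp
    then have "s' \<noteq> 0" using cs(1) by auto
    then have "degree (w * s') = degree w + degree s'" using w(1) by (rule degree_mult_eq[rotated])
    with rt_deg[OF w(2,1)] show False unfolding eq by simp
  qed
  ultimately have "r dvd w" by blast
  obtain c' s' where cs': "c' \<noteq> 0" "[:c':] * h = w * s'" using key[of h] h unfolding rt_def by blast
  have "r dvd [:c':] * h" unfolding cs'(2) using \<open>r dvd w\<close> by (rule dvd_mult2)
  with prime not_const[OF cs'(1)] show ?thesis by (simp only: prime_elem_dvd_mult_iff) blast
qed

lemma irreducible_int_poly_unique:
  fixes p q :: "int poly" and \<alpha> :: complex
  assumes p: "irreducible p" "poly (map_poly of_int p) \<alpha> = 0" "lead_coeff p > 0"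
    and q: "irreducible q" "poly (map_poly of_int q) \<alpha> = 0" "lead_coeff q > 0"
  shows "p = q"
proof -
  have dvd: "q dvd p" "p dvd q"
    using irreducible_int_poly_dvd p q by blast+
  have p0: "p \<noteq> 0" "q \<noteq> 0" using p q by auto
  obtain k where k: "q = p * k" using dvd(2) by (rule dvdE)
  have "degree p = degree q" using dvd p0 by (metis dvd_imp_degree_le le_antisym)
  moreover have "k \<noteq> 0" using k p0 by auto
  ultimately have "degree k = 0" using k p0 by (simp add: degree_mult_eq)
  then obtain c where c: "k = [:c:]" using degree_eq_zeroE by blast
  obtain l where "p = q * l" using dvd(1) by (rule dvdE)
  then have "p * 1 = p * (k * l)" by (metis k mult.assoc mult.right_neutral)
  then have "k * l = 1" using p0 by simp
  then have "k dvd 1" by (metis dvd_triv_left)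
  then have "c dvd 1" using c by (simp add: is_unit_const_poly_iff)
  moreover have "lead_coeff q = lead_coeff p * c" using k c by (simp add: mult.commute)
  then have "c > 0" using p(3) q(3) by (metis zero_less_mult_pos)
  ultimately have "c = 1" by (simp add: zdvd1_eq)
  with k c show ?thesis by (simp add: one_pCons[symmetric])
qed

section \<open>Integer bases of spaces of polynomials\<close>

definition in_span :: "bpoly set \<Rightarrow> bpoly \<Rightarrow> bool" where
  "in_span G P \<longleftrightarrow> (\<exists>c. P = (\<Sum>g\<in>G. cscale (c g) g))"

lemma in_span_0: "in_span G 0"
  unfolding in_span_def by (rule exI[of _ "\<lambda>_. 0"]) simp

lemma in_span_add: "in_span G P \<Longrightarrow> in_span G Q \<Longrightarrow> in_span G (P + Q)"
proof -
  assume "in_span G P" "in_span G Q"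
  then obtain c d where "P = (\<Sum>g\<in>G. cscale (c g) g)" "Q = (\<Sum>g\<in>G. cscale (d g) g)"
    unfolding in_span_def by blast
  then have "P + Q = (\<Sum>g\<in>G. cscale (c g + d g) g)" by (simp add: cscale_add_left sum.distrib)
  then show ?thesis unfolding in_span_def by (rule exI[of _ "\<lambda>g. c g + d g"])
qed

lemma in_span_cscale: "in_span G P \<Longrightarrow> in_span G (cscale a P)"
proof -
  assume "in_span G P"
  then obtain c where "P = (\<Sum>g\<in>G. cscale (c g) g)" unfolding in_span_def by blast
  then have "cscale a P = (\<Sum>g\<in>G. cscale (a * c g) g)" by (simp add: cscale_sum cscale_cscale)
  then show ?thesis unfolding in_span_def by (rule exI[of _ "\<lambda>g. a * c g"])
qed

lemma in_span_member: "finite G \<Longrightarrow> g \<in> G \<Longrightarrow> in_span G g"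
  unfolding in_span_def
  by (rule exI[of _ "\<lambda>h. if h = g then 1 else 0"])
    (simp add: if_distrib[of "\<lambda>c. cscale c _"] cong: if_cong)

lemma in_span_sum: "(\<And>a. a \<in> A \<Longrightarrow> in_span G (f a)) \<Longrightarrow> in_span G (\<Sum>a\<in>A. f a)"
  by (induction A rule: infinite_finite_induct) (auto intro: in_span_0 in_span_add)

lemma in_span_trans:
  assumes "in_span G P" "\<And>g. g \<in> G \<Longrightarrow> in_span H g"
  shows "in_span H P"
  using assms unfolding in_span_def[of G] by (auto intro!: in_span_sum in_span_cscale)

lemma in_span_dvd:
  assumes "in_span G P" "\<And>g. g \<in> G \<Longrightarrow> f dvd g"
  shows "f dvd P"
proof -
  obtain c where c: "P = (\<Sum>g\<in>G. cscale (c g) g)" using assms(1) unfolding in_span_def ..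
  show ?thesis unfolding c cscale_def using assms(2) by (intro dvd_sum dvd_mult)
qed

definition int_coeffs :: "nat \<Rightarrow> bpoly \<Rightarrow> bool" where
  "int_coeffs X P \<longleftrightarrow> (\<forall>i j. \<exists>k::int. xycoeff P i j = of_int k \<and> \<bar>k\<bar> \<le> int X)"

lemma int_coeffs_mono: "int_coeffs X P \<Longrightarrow> X \<le> Y \<Longrightarrow> int_coeffs Y P"
  unfolding int_coeffs_def by (meson of_nat_mono order_trans)

lemma int_coeffs_norm: "int_coeffs X P \<Longrightarrow> cmod (xycoeff P i j) \<le> real X"
proof -
  assume "int_coeffs X P"
  then obtain k :: int where k: "xycoeff P i j = of_int k" "\<bar>k\<bar> \<le> int X" unfolding int_coeffs_def by blast
  then have "\<bar>real_of_int k\<bar> \<le> real X" by linarith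
  with k(1) show ?thesis by simp
qed

lemma int_coeffs_Ints: "int_coeffs X P \<Longrightarrow> xycoeff P i j \<in> \<int>"
  unfolding int_coeffs_def by (metis Ints_of_int)

lemma int_coeffsI:
  assumes "\<And>i j. xycoeff P i j \<in> \<int>" "\<And>i j. cmod (xycoeff P i j) \<le> real X"
  shows "int_coeffs X P"
  unfolding int_coeffs_def
proof (intro allI)
  fix i j
  obtain k :: int where k: "xycoeff P i j = of_int k" using assms(1)[of i j] by (rule Ints_cases)
  then have "\<bar>real_of_int k\<bar> \<le> real X" using assms(2)[of i j] by simp
  then have "\<bar>k\<bar> \<le> int X" by linarith
  with k show "\<exists>k::int. xycoeff P i j = of_int k \<and> \<bar>k\<bar> \<le> int X" by blast
qed

lemma int_coeffs_combination:
  assumes "finite J" "card J \<le> Y" "\<And>j. j \<in> J \<Longrightarrow> int_coeffs X (pol j)" "\<And>j. j \<in> J \<Longrightarrow> \<bar>k j\<bar> \<le> int K"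
  shows "int_coeffs (Y * K * X) (\<Sum>j\<in>J. cscale (of_int (k j)) (pol j))"
proof (rule int_coeffsI)
  fix a b
  show "xycoeff (\<Sum>j\<in>J. cscale (of_int (k j)) (pol j)) a b \<in> \<int>"
    unfolding xycoeff_sum xycoeff_cscale using assms(3) by (intro Ints_sum Ints_mult Ints_of_int int_coeffs_Ints)
  have "cmod (xycoeff (\<Sum>j\<in>J. cscale (of_int (k j)) (pol j)) a b) \<le> (\<Sum>j\<in>J. cmod (of_int (k j) * xycoeff (pol j) a b))"
    unfolding xycoeff_sum xycoeff_cscale by (rule norm_sum)
  also have "\<dots> \<le> (\<Sum>j\<in>J. real K * real X)"
  proof (intro sum_mono)
    fix j assume j: "j \<in> J"
    have "\<bar>real_of_int (k j)\<bar> \<le> real K" using assms(4)[OF j] by linarith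
    then show "cmod (of_int (k j) * xycoeff (pol j) a b) \<le> real K * real X"
      unfolding norm_mult using int_coeffs_norm[OF assms(3)[OF j]] by (intro mult_mono) auto
  qed
  also have "\<dots> = real (card J) * (real K * real X)" by simp
  also have "\<dots> \<le> real Y * (real K * real X)" using assms(2) by (intro mult_right_mono) auto
  finally show "cmod (xycoeff (\<Sum>j\<in>J. cscale (of_int (k j)) (pol j)) a b) \<le> real (Y * K * X)" by simp
qed

lemma xycoeff_xy_monom_mult:
  "xycoeff (xy_monom k l * P) i j = (if k \<le> i \<and> l \<le> j then xycoeff P (i - k) (j - l) else 0)"
proof -
  have "xycoeff (xy_monom k l * P) i j =
      (\<Sum>b\<le>j. \<Sum>a\<le>i. if a = k then (if b = l then xycoeff P (i - k) (j - l) else 0) else 0)"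
    unfolding xycoeff_mult xycoeff_xy_monom by (intro sum.cong) auto
  also have "\<dots> = (\<Sum>b\<le>j. if b = l then (if k \<le> i then xycoeff P (i - k) (j - l) else 0) else 0)"
    by (intro sum.cong) auto
  also have "\<dots> = (if k \<le> i \<and> l \<le> j then xycoeff P (i - k) (j - l) else 0)" by simp
  finally show ?thesis .
qed

lemma int_coeffs_xy_monom_mult: "int_coeffs X P \<Longrightarrow> int_coeffs X (xy_monom k l * P)"
  unfolding int_coeffs_def xycoeff_xy_monom_mult by (metis abs_zero of_int_0 of_nat_0_le_iff)

lemma int_coeffs_xy_monom: "int_coeffs 1 (xy_monom k l)"
  unfolding int_coeffs_def xycoeff_xy_monom by (metis abs_one abs_zero of_int_0 of_int_1 of_nat_0_le_iff of_nat_1 order_refl)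

lemma int_coeffs_swap_xy: "int_coeffs X (swap_xy P) \<longleftrightarrow> int_coeffs X P"
  unfolding int_coeffs_def xycoeff_swap_xy by blast

text \<open>
  The coefficient vectors provided by \<open>integer_kernel_basis\<close>, read as combinations of given polynomials.
\<close>
lemma integer_combination_basis:
  fixes pol :: "'a \<Rightarrow> bpoly" and R :: "('a \<Rightarrow> int) set"
  assumes J: "finite J" "card J \<le> Y" "1 \<le> Y"
    and R: "\<forall>r\<in>R. \<forall>j\<in>J. \<bar>r j\<bar> \<le> int Y"
  obtains H where "finite H" "card H \<le> card J"
    "\<And>h. h \<in> H \<Longrightarrow> \<exists>k. (\<forall>j. \<bar>k j\<bar> \<le> int (kernel_bound Y)) \<and> (\<forall>r\<in>R. (\<Sum>j\<in>J. r j * k j) = 0) \<and>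
        h = (\<Sum>j\<in>J. cscale (of_int (k j)) (pol j))"
    "\<And>x. (\<And>r. r \<in> R \<Longrightarrow> (\<Sum>j\<in>J. of_int (r j) * x j) = 0) \<Longrightarrow> in_span H (\<Sum>j\<in>J. cscale (x j) (pol j))"
proof -
  obtain B where B: "finite B" "card B \<le> card J"
     "\<And>b j. b \<in> B \<Longrightarrow> \<bar>b j\<bar> \<le> int (kernel_bound Y)"
     "\<And>b r. b \<in> B \<Longrightarrow> r \<in> R \<Longrightarrow> (\<Sum>j\<in>J. r j * b j) = 0"
     "\<And>x :: 'a \<Rightarrow> complex. (\<And>r. r \<in> R \<Longrightarrow> (\<Sum>j\<in>J. of_int (r j) * x j) = 0) \<Longrightarrow>
        \<exists>c. \<forall>j\<in>J. x j = (\<Sum>b\<in>B. c b * of_int (b j))"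
    using integer_kernel_basis[OF J R] by blast
  define P where "P b = (\<Sum>j\<in>J. cscale (of_int (b j)) (pol j))" for b
  show thesis
  proof (rule that[of "P ` B"])
    show "finite (P ` B)" using B(1) by simp
    show "card (P ` B) \<le> card J" using card_image_le[OF B(1), of P] B(2) by (rule order_trans)
    show "\<exists>k. (\<forall>j. \<bar>k j\<bar> \<le> int (kernel_bound Y)) \<and> (\<forall>r\<in>R. (\<Sum>j\<in>J. r j * k j) = 0) \<and>
        h = (\<Sum>j\<in>J. cscale (of_int (k j)) (pol j))" if "h \<in> P ` B" for h
    proof -
      from that obtain b where b: "b \<in> B" "h = P b" by blast
      show ?thesis using B(3)[OF b(1)] B(4)[OF b(1)] unfolding b(2) P_def by blast
    qed
    fix x :: "'a \<Rightarrow> complex"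
    assume "\<And>r. r \<in> R \<Longrightarrow> (\<Sum>j\<in>J. of_int (r j) * x j) = 0"
    from B(5)[OF this] obtain c where c: "\<forall>j\<in>J. x j = (\<Sum>b\<in>B. c b * of_int (b j))" ..
    have "(\<Sum>j\<in>J. cscale (x j) (pol j)) = (\<Sum>j\<in>J. \<Sum>b\<in>B. cscale (c b) (cscale (of_int (b j)) (pol j)))"
      using c by (intro sum.cong) (simp_all add: cscale_sum_left cscale_cscale)
    also have "\<dots> = (\<Sum>b\<in>B. cscale (c b) (P b))"
      unfolding P_def cscale_sum by (rule sum.swap)
    finally show "in_span (P ` B) (\<Sum>j\<in>J. cscale (x j) (pol j))"
      using B(1) by (auto intro!: in_span_sum in_span_cscale in_span_member)
  qed
qed

text \<open>
  Both a bound on the degree and the absence of a variable say that the coefficients at certain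
  exponents vanish. With \<open>M\<close> as the set of these exponents, integer linear algebra applies.
\<close>
lemma elimination_basis:
  assumes G: "finite G" "card G \<le> Y" "1 \<le> Y" "\<And>g. g \<in> G \<Longrightarrow> int_coeffs Y g"
  obtains H where "finite H" "card H \<le> card G"
    "\<And>h. h \<in> H \<Longrightarrow> \<exists>k. (\<forall>g. \<bar>k g\<bar> \<le> int (kernel_bound Y)) \<and> h = (\<Sum>g\<in>G. cscale (of_int (k g)) g)"
    "\<And>h p. h \<in> H \<Longrightarrow> p \<in> M \<Longrightarrow> xycoeff h (fst p) (snd p) = 0"
    "\<And>h. h \<in> H \<Longrightarrow> int_coeffs (Y * kernel_bound Y * Y) h"
    "\<And>P. in_span G P \<Longrightarrow> (\<And>p. p \<in> M \<Longrightarrow> xycoeff P (fst p) (snd p) = 0) \<Longrightarrow> in_span H P"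
proof -
  have "\<forall>g i j. \<exists>k::int. g \<in> G \<longrightarrow> xycoeff g i j = of_int k \<and> \<bar>k\<bar> \<le> int Y"
    using G(4) unfolding int_coeffs_def by blast
  then obtain ci :: "bpoly \<Rightarrow> nat \<Rightarrow> nat \<Rightarrow> int" where
    ci: "\<And>g i j. g \<in> G \<Longrightarrow> xycoeff g i j = of_int (ci g i j)" "\<And>g i j. g \<in> G \<Longrightarrow> \<bar>ci g i j\<bar> \<le> int Y"
    by metis
  define R where "R = (\<lambda>p g. ci g (fst p) (snd p)) ` M"
  have R: "\<forall>r\<in>R. \<forall>g\<in>G. \<bar>r g\<bar> \<le> int Y"
    using ci(2) by (auto simp: R_def)
  obtain H where H: "finite H" "card H \<le> card G"
    "\<And>h. h \<in> H \<Longrightarrow> \<exists>k. (\<forall>g. \<bar>k g\<bar> \<le> int (kernel_bound Y)) \<and> (\<forall>r\<in>R. (\<Sum>g\<in>G. r g * k g) = 0) \<and>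
        h = (\<Sum>g\<in>G. cscale (of_int (k g)) g)"
    "\<And>x. (\<And>r. r \<in> R \<Longrightarrow> (\<Sum>g\<in>G. of_int (r g) * x g) = 0) \<Longrightarrow> in_span H (\<Sum>g\<in>G. cscale (x g) g)"
    using integer_combination_basis[OF G(1-3) R, of "\<lambda>g. g"] by blast
  have cfG: "xycoeff (\<Sum>g\<in>G. cscale (x g) g) i j = (\<Sum>g\<in>G. of_int (ci g i j) * x g)" for x i j
    unfolding xycoeff_sum by (intro sum.cong) (simp_all add: ci(1) mult.commute)
  show thesis
  proof (rule that[OF H(1,2)])
    show "\<exists>k. (\<forall>g. \<bar>k g\<bar> \<le> int (kernel_bound Y)) \<and> h = (\<Sum>g\<in>G. cscale (of_int (k g)) g)" if "h \<in> H" for h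
      using H(3)[OF that] by blast
    show "int_coeffs (Y * kernel_bound Y * Y) h" if "h \<in> H" for h
      using H(3)[OF that] int_coeffs_combination[OF G(1,2) G(4), of "\<lambda>g. g"] by blast
    show "xycoeff h (fst p) (snd p) = 0" if h: "h \<in> H" and p: "p \<in> M" for h p
    proof -
      obtain k where k: "\<forall>r\<in>R. (\<Sum>g\<in>G. r g * k g) = 0" "h = (\<Sum>g\<in>G. cscale (of_int (k g)) g)"
        using H(3)[OF h] by blast
      have "(\<Sum>g\<in>G. ci g (fst p) (snd p) * k g) = 0"
        using k(1)[rule_format, of "\<lambda>g. ci g (fst p) (snd p)"] p by (auto simp: R_def)
      then have "(\<Sum>g\<in>G. of_int (ci g (fst p) (snd p)) * of_int (k g)) = (0 :: complex)"
        by (metis (mono_tags, lifting) of_int_0 of_int_mult of_int_sum sum.cong)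
      then show ?thesis unfolding k(2) cfG .
    qed
    fix P assume P: "in_span G P" "\<And>p. p \<in> M \<Longrightarrow> xycoeff P (fst p) (snd p) = 0"
    obtain x where x: "P = (\<Sum>g\<in>G. cscale (x g) g)" using P(1) unfolding in_span_def by blast
    show "in_span H P"
      unfolding x
    proof (rule H(4))
      fix r assume "r \<in> R"
      then obtain p where p: "p \<in> M" "r = (\<lambda>g. ci g (fst p) (snd p))" unfolding R_def by blast
      show "(\<Sum>g\<in>G. of_int (r g) * x g) = 0"
        using P(2)[OF p(1)] unfolding x cfG p(2) .
    qed
  qed
qed

definition jet_size :: "nat \<Rightarrow> nat" where
  "jet_size Y = 2 ^ Y * (Y ^ (2 * Y) * Y * Y ^ (2 * Y)) + (Y + 1) ^ 2"

definition jet_bound :: "nat \<Rightarrow> nat" where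
  "jet_bound Y = jet_size Y * kernel_bound (jet_size Y)"

text \<open>
  The condition that a divided derivative \<open>c\<close> vanishes at each point of \<open>S\<close> is not a linear equation
  with rational coefficients as it stands. It is equivalent to the vanishing of the sums of \<open>c(s) s1^u s2^v\<close>
  over \<open>s \<in> S\<close> for \<open>u + v \<le> card S\<close>, because monomials of these degrees separate the points of \<open>S\<close>.
  The coefficients of these equations are traces, and powers of \<open>A\<close> clear their denominators.
\<close>
lemma jet_basis:
  fixes S :: "(complex \<times> complex) set"
  assumes S: "finite S" "card S \<le> Y" "1 \<le> Y" "N \<le> Y"
    and A: "1 \<le> A" "A \<le> Y" "\<And>k l. of_nat A ^ (k + l) * (\<Sum>s\<in>S. fst s ^ k * snd s ^ l) \<in> \<int>"
    and bd: "\<And>s. s \<in> S \<Longrightarrow> cmod (fst s) \<le> real Y \<and> cmod (snd s) \<le> real Y"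
  obtains Q where "finite Q" "card Q \<le> (Y + 1) ^ 2" "\<And>q. q \<in> Q \<Longrightarrow> int_coeffs (jet_bound Y) q"
    "\<And>q. q \<in> Q \<Longrightarrow> tdeg_le N q" "\<And>q s. q \<in> Q \<Longrightarrow> s \<in> S \<Longrightarrow> vanish_order n s q"
    "\<And>P. tdeg_le N P \<Longrightarrow> (\<And>s. s \<in> S \<Longrightarrow> vanish_order n s P) \<Longrightarrow> in_span Q P"
proof -
  define pol where "pol p = xy_monom (fst p) (snd p)" for p :: "nat \<times> nat"
  have "\<forall>k l. \<exists>t::int. k + l \<le> 2 * Y \<longrightarrow> of_nat A ^ (2 * Y) * (\<Sum>s\<in>S. fst s ^ k * snd s ^ l) = of_int t"
  proof (intro allI)
    fix k l
    show "\<exists>t::int. k + l \<le> 2 * Y \<longrightarrow> of_nat A ^ (2 * Y) * (\<Sum>s\<in>S. fst s ^ k * snd s ^ l) = of_int t"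
    proof (cases "k + l \<le> 2 * Y")
      case True
      then have "of_nat A ^ (2 * Y) * (\<Sum>s\<in>S. fst s ^ k * snd s ^ l)
         = of_nat (A ^ (2 * Y - (k + l))) * (of_nat A ^ (k + l) * (\<Sum>s\<in>S. fst s ^ k * snd s ^ l))"
        by (simp flip: power_add mult.assoc)
      also have "\<dots> \<in> \<int>" by (intro Ints_mult A(3) Ints_of_nat)
      finally show ?thesis by (auto elim: Ints_cases)
    qed simp
  qed
  then obtain T :: "nat \<Rightarrow> nat \<Rightarrow> int" where T:
    "\<And>k l. k + l \<le> 2 * Y \<Longrightarrow> of_nat A ^ (2 * Y) * (\<Sum>s\<in>S. fst s ^ k * snd s ^ l) = of_int (T k l)"
    by metis
  have T_bound: "\<bar>T k l\<bar> \<le> int (Y ^ (2 * Y) * Y * Y ^ (2 * Y))" if kl: "k + l \<le> 2 * Y" for k l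
  proof -
    have "real_of_int \<bar>T k l\<bar> = cmod (of_nat A ^ (2 * Y) * (\<Sum>s\<in>S. fst s ^ k * snd s ^ l))"
      unfolding T[OF kl] by simp
    also have "\<dots> = real A ^ (2 * Y) * cmod (\<Sum>s\<in>S. fst s ^ k * snd s ^ l)"
      by (simp add: norm_mult norm_power)
    also have "cmod (\<Sum>s\<in>S. fst s ^ k * snd s ^ l) \<le> (\<Sum>s\<in>S. real Y ^ (2 * Y))"
    proof (rule sum_norm_le)
      fix s assume "s \<in> S"
      then have "cmod (fst s ^ k * snd s ^ l) \<le> real Y ^ k * real Y ^ l"
        unfolding norm_mult norm_power using bd by (intro mult_mono power_mono) auto
      also have "\<dots> \<le> real Y ^ (2 * Y)"
        unfolding power_add[symmetric] using S(3) kl by (intro power_increasing) auto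
      finally show "cmod (fst s ^ k * snd s ^ l) \<le> real Y ^ (2 * Y)" .
    qed
    also have "(\<Sum>s\<in>S. real Y ^ (2 * Y)) \<le> real Y * real Y ^ (2 * Y)"
      using S(2) by (simp add: mult_right_mono)
    also have "real A ^ (2 * Y) * (real Y * real Y ^ (2 * Y)) \<le> real Y ^ (2 * Y) * (real Y * real Y ^ (2 * Y))"
      using A(2) by (intro mult_right_mono power_mono) auto
    finally have "real_of_int \<bar>T k l\<bar> \<le> real Y ^ (2 * Y) * (real Y * real Y ^ (2 * Y))"
      by (simp add: mult_left_mono)
    also have "\<dots> = real_of_int (int (Y ^ (2 * Y) * Y * Y ^ (2 * Y)))" by simp
    finally show ?thesis by linarith
  qed
  define rowf where "rowf a b u v p =
      int ((fst p choose a) * (snd p choose b)) * T (fst p - a + u) (snd p - b + v)" for a b u v p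
  define R where "R = {rowf a b u v | a b u v. a + b < n \<and> u + v \<le> card S}"
  define Z where "Z = jet_size Y"
  have rowf: "of_int (rowf a b u v p) =
      of_nat A ^ (2 * Y) * (\<Sum>s\<in>S. hasse (fst p) (snd p) a b (fst s) (snd s) * (fst s ^ u * snd s ^ v))"
    if "p \<in> exponents_le N" "u + v \<le> card S" for a b u v p
  proof -
    have "fst p + snd p \<le> N" using that(1) by (auto simp: exponents_le_def)
    then have e: "fst p - a + u + (snd p - b + v) \<le> 2 * Y" using that(2) S(2,4) by linarith
    have "of_int (rowf a b u v p) = of_nat ((fst p choose a) * (snd p choose b)) *
        (of_int (T (fst p - a + u) (snd p - b + v)) :: complex)"
      by (simp add: rowf_def)
    also have "\<dots> = of_nat ((fst p choose a) * (snd p choose b)) *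
        (of_nat A ^ (2 * Y) * (\<Sum>s\<in>S. fst s ^ (fst p - a + u) * snd s ^ (snd p - b + v)))"
      unfolding T[OF e] ..
    finally show ?thesis
      by (simp add: hasse_def power_add sum_distrib_left mult_ac)
  qed
  have R_bound: "\<bar>r p\<bar> \<le> int Z" if r: "r \<in> R" and p: "p \<in> exponents_le N" for r p
  proof -
    obtain a b u v where ab: "r = rowf a b u v" "u + v \<le> card S" using r unfolding R_def by blast
    have pN: "fst p + snd p \<le> N" using p by (auto simp: exponents_le_def)
    then have e: "fst p - a + u + (snd p - b + v) \<le> 2 * Y" using ab(2) S(2,4) by linarith
    have "(fst p choose a) * (snd p choose b) \<le> 2 ^ fst p * 2 ^ snd p"
      by (intro mult_mono binomial_le_pow2) auto
    also have "\<dots> \<le> 2 ^ Y" unfolding power_add[symmetric] using pN S(4) by (intro power_increasing) auto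
    finally have "int ((fst p choose a) * (snd p choose b)) \<le> int (2 ^ Y)" by (rule of_nat_mono)
    then have "\<bar>r p\<bar> \<le> int (2 ^ Y) * int (Y ^ (2 * Y) * Y * Y ^ (2 * Y))"
      unfolding ab(1) rowf_def abs_mult using T_bound[OF e] by (intro mult_mono) auto
    also have "\<dots> = int (2 ^ Y * (Y ^ (2 * Y) * Y * Y ^ (2 * Y)))" by simp
    also have "\<dots> \<le> int Z" unfolding Z_def jet_size_def by (intro of_nat_mono) simp
    finally show ?thesis .
  qed
  have cardN: "card (exponents_le N) \<le> (Y + 1) ^ 2"
    using card_exponents_le_le[of N] S(4) by (meson add_le_mono1 order_trans power_mono zero_le)
  then have cardZ: "card (exponents_le N) \<le> Z" by (simp add: Z_def jet_size_def)
  have "1 \<le> (Y + 1) ^ 2" by simp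
  then have Z1: "1 \<le> Z" unfolding Z_def jet_size_def by (rule trans_le_add2)
  have cfP: "(\<Sum>p\<in>exponents_le N. of_int (rowf a b u v p) * x p) =
      of_nat A ^ (2 * Y) * (\<Sum>s\<in>S. xycoeff (shift (fst s) (snd s) (\<Sum>p\<in>exponents_le N. cscale (x p) (pol p))) a b *
        (fst s ^ u * snd s ^ v))" if "u + v \<le> card S" for a b u v x
  proof -
    have "(\<Sum>p\<in>exponents_le N. of_int (rowf a b u v p) * x p) =
      (\<Sum>p\<in>exponents_le N. \<Sum>s\<in>S. of_nat A ^ (2 * Y) *
         (x p * hasse (fst p) (snd p) a b (fst s) (snd s) * (fst s ^ u * snd s ^ v)))"
      using rowf[OF _ that] by (intro sum.cong refl) (simp add: sum_distrib_left sum_distrib_right mult_ac)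
    also have "\<dots> = (\<Sum>s\<in>S. \<Sum>p\<in>exponents_le N. of_nat A ^ (2 * Y) *
         (x p * hasse (fst p) (snd p) a b (fst s) (snd s) * (fst s ^ u * snd s ^ v)))"
      by (rule sum.swap)
    also have "\<dots> = of_nat A ^ (2 * Y) * (\<Sum>s\<in>S. (\<Sum>p\<in>exponents_le N. x p * hasse (fst p) (snd p) a b (fst s) (snd s)) *
         (fst s ^ u * snd s ^ v))"
      by (simp add: sum_distrib_left sum_distrib_right)
    finally show ?thesis by (simp add: shift_sum xycoeff_sum pol_def xycoeff_shift_xy_monom)
  qed
  have vanish_iff: "(\<forall>r\<in>R. (\<Sum>p\<in>exponents_le N. of_int (r p) * x p) = 0) \<longleftrightarrow>
      (\<forall>s\<in>S. vanish_order n s (\<Sum>p\<in>exponents_le N. cscale (x p) (pol p)))" for x :: "nat \<times> nat \<Rightarrow> complex"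
  proof
    define P where "P = (\<Sum>p\<in>exponents_le N. cscale (x p) (pol p))"
    assume *: "\<forall>r\<in>R. (\<Sum>p\<in>exponents_le N. of_int (r p) * x p) = 0"
    show "\<forall>s\<in>S. vanish_order n s (\<Sum>p\<in>exponents_le N. cscale (x p) (pol p))"
      unfolding P_def[symmetric] vanish_order_def
    proof (intro ballI allI impI)
      fix s a b assume s: "s \<in> S" and ab: "a + b < n"
      define c where "c t = xycoeff (shift (fst t) (snd t) P) a b" for t
      obtain E where E: "tdeg_le (card S) E" "xyeval E (fst s) (snd s) = 1"
        "\<And>t. t \<in> S \<Longrightarrow> t \<noteq> s \<Longrightarrow> xyeval E (fst t) (snd t) = 0"
        using separating_polynomial[OF S(1) s] by blast
      have zero: "(\<Sum>t\<in>S. c t * (fst t ^ u * snd t ^ v)) = 0" if "u + v \<le> card S" for u v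
      proof -
        have "rowf a b u v \<in> R" unfolding R_def using ab that by blast
        with * have "(\<Sum>p\<in>exponents_le N. of_int (rowf a b u v p) * x p) = 0" by blast
        then show ?thesis using A(1) unfolding cfP[OF that] c_def P_def by simp
      qed
      have "(\<Sum>t\<in>S. c t * xyeval E (fst t) (snd t)) =
         (\<Sum>t\<in>S. \<Sum>p\<in>exponents_le (card S). xycoeff E (fst p) (snd p) * (c t * (fst t ^ fst p * snd t ^ snd p)))"
        unfolding xyeval_expand[OF E(1)] by (intro sum.cong refl) (simp add: sum_distrib_left case_prod_beta mult_ac)
      also have "\<dots> = (\<Sum>p\<in>exponents_le (card S). xycoeff E (fst p) (snd p) * (\<Sum>t\<in>S. c t * (fst t ^ fst p * snd t ^ snd p)))"
        by (subst sum.swap) (simp add: sum_distrib_left)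
      also have "\<dots> = 0"
        using zero by (intro sum.neutral) (auto simp: exponents_le_def)
      finally have "0 = (\<Sum>t\<in>S. c t * xyeval E (fst t) (snd t))" by simp
      also have "\<dots> = (\<Sum>t\<in>S. if t = s then c s else 0)"
        using E by (intro sum.cong) auto
      also have "\<dots> = c s" using S(1) s by simp
      finally show "xycoeff (shift (fst s) (snd s) P) a b = 0" by (simp add: c_def)
    qed
  next
    assume *: "\<forall>s\<in>S. vanish_order n s (\<Sum>p\<in>exponents_le N. cscale (x p) (pol p))"
    show "\<forall>r\<in>R. (\<Sum>p\<in>exponents_le N. of_int (r p) * x p) = 0"
    proof
      fix r assume "r \<in> R"
      then obtain a b u v where r: "r = rowf a b u v" "a + b < n" "u + v \<le> card S" unfolding R_def by blast
      show "(\<Sum>p\<in>exponents_le N. of_int (r p) * x p) = 0"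
        unfolding r(1) cfP[OF r(3)] using * r(2) by (simp add: vanish_order_def)
    qed
  qed
  obtain H where H: "finite H" "card H \<le> card (exponents_le N)"
    "\<And>h. h \<in> H \<Longrightarrow> \<exists>k. (\<forall>j. \<bar>k j\<bar> \<le> int (kernel_bound Z)) \<and> (\<forall>r\<in>R. (\<Sum>j\<in>exponents_le N. r j * k j) = 0) \<and>
        h = (\<Sum>j\<in>exponents_le N. cscale (of_int (k j)) (pol j))"
    "\<And>x. (\<And>r. r \<in> R \<Longrightarrow> (\<Sum>j\<in>exponents_le N. of_int (r j) * x j) = 0) \<Longrightarrow>
        in_span H (\<Sum>j\<in>exponents_le N. cscale (x j) (pol j))"
    using integer_combination_basis[OF finite_exponents_le cardZ Z1, of R pol] R_bound by blast
  show thesis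
  proof (rule that[OF H(1)])
    show "card H \<le> (Y + 1) ^ 2" using H(2) cardN by (rule order_trans)
    fix q assume "q \<in> H"
    from H(3)[OF this] obtain k where k: "\<forall>j. \<bar>k j\<bar> \<le> int (kernel_bound Z)"
      "\<forall>r\<in>R. (\<Sum>j\<in>exponents_le N. r j * k j) = 0" "q = (\<Sum>j\<in>exponents_le N. cscale (of_int (k j)) (pol j))" by blast
    have "int_coeffs (Z * kernel_bound Z * 1) q"
      unfolding k(3) using k(1) cardZ
      by (intro int_coeffs_combination) (auto simp: pol_def intro: int_coeffs_xy_monom[unfolded One_nat_def])
    then show "int_coeffs (jet_bound Y) q" by (simp add: jet_bound_def Z_def)
    show "tdeg_le N q"
      unfolding k(3) pol_def by (intro tdeg_le_sum tdeg_le_cscale tdeg_le_xy_monom) (auto simp: exponents_le_def)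
    have "\<forall>r\<in>R. (\<Sum>p\<in>exponents_le N. of_int (r p) * of_int (k p)) = (0 :: complex)"
      using k(2) by (metis (mono_tags, lifting) of_int_0 of_int_mult of_int_sum sum.cong)
    then show "vanish_order n s q" if "s \<in> S" for s
      using that unfolding vanish_iff k(3) by blast
  next
    fix P assume P: "tdeg_le N P" "\<And>s. s \<in> S \<Longrightarrow> vanish_order n s P"
    define x where "x p = xycoeff P (fst p) (snd p)" for p
    have Px: "P = (\<Sum>p\<in>exponents_le N. cscale (x p) (pol p))"
      using bpoly_expand[OF P(1)] by (simp add: x_def pol_def case_prod_beta)
    have "\<forall>r\<in>R. (\<Sum>p\<in>exponents_le N. of_int (r p) * x p) = 0"
      unfolding vanish_iff Px[symmetric] using P(2) by blast
    then show "in_span H P" by (subst Px) (rule H(4), blast)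
  qed
qed

text \<open>
  In the Taylor expansion at \<open>s\<close> only terms of degree at least \<open>n\<close> occur.
\<close>
lemma xyeval_near_zero_bound:
  assumes P: "int_coeffs H P" "tdeg_le N P" "vanish_order n s P"
    and s: "cmod (fst s) \<le> real Y" "cmod (snd s) \<le> real Y" "1 \<le> Y"
    and x: "cmod (x - fst s) \<le> \<epsilon>" "cmod (y - snd s) \<le> \<epsilon>" "0 \<le> \<epsilon>" "\<epsilon> \<le> 1"
  shows "cmod (xyeval P x y) \<le> real ((N + 1) ^ 4 * H * 2 ^ N * Y ^ N) * \<epsilon> ^ n"
proof -
  define c where "c a b = xycoeff (shift (fst s) (snd s) P) a b" for a b
  have cb: "cmod (c a b) \<le> real ((N + 1) ^ 2 * (H * (2 ^ N * Y ^ N)))" for a b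
  proof -
    have "cmod (c a b) \<le> (\<Sum>p\<in>exponents_le N. real (H * (2 ^ N * Y ^ N)))"
      unfolding c_def xycoeff_shift[OF P(2)]
    proof (rule sum_norm_le)
      fix p assume "p \<in> exponents_le N"
      then obtain i j where p: "p = (i, j)" "i + j \<le> N" by (auto simp: exponents_le_def)
      have "(i choose a) * (j choose b) \<le> 2 ^ i * 2 ^ j"
        by (intro mult_mono binomial_le_pow2) auto
      also have "\<dots> \<le> 2 ^ N" unfolding power_add[symmetric] using p(2) by (intro power_increasing) auto
      finally have "real ((i choose a) * (j choose b)) \<le> real (2 ^ N)" by (rule of_nat_mono)
      moreover have "cmod (fst s) ^ (i - a) * cmod (snd s) ^ (j - b) \<le> real Y ^ (i - a) * real Y ^ (j - b)"
        using s by (intro mult_mono power_mono) auto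
      moreover have "\<dots> \<le> real Y ^ N"
        unfolding power_add[symmetric] using p(2) s(3) by (intro power_increasing) auto
      ultimately have "cmod (hasse i j a b (fst s) (snd s)) \<le> real (2 ^ N) * real Y ^ N"
        unfolding hasse_def norm_mult norm_power norm_of_nat by (intro mult_mono) auto
      then have "cmod (xycoeff P i j) * cmod (hasse i j a b (fst s) (snd s)) \<le> real H * (real (2 ^ N) * real Y ^ N)"
        using int_coeffs_norm[OF P(1)] by (intro mult_mono) auto
      then show "cmod (case p of (i, j) \<Rightarrow> xycoeff P i j * hasse i j a b (fst s) (snd s)) \<le> real (H * (2 ^ N * Y ^ N))"
        by (simp add: p(1) norm_mult)
    qed
    also have "\<dots> = real (card (exponents_le N) * (H * (2 ^ N * Y ^ N)))" by simp
    also have "\<dots> \<le> real ((N + 1) ^ 2 * (H * (2 ^ N * Y ^ N)))"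
      by (intro of_nat_mono mult_right_mono card_exponents_le_le) simp
    finally show ?thesis .
  qed
  have "xyeval P x y = xyeval (shift (fst s) (snd s) P) (x - fst s) (y - snd s)" by (simp add: xyeval_shift)
  also have "\<dots> = (\<Sum>(a, b)\<in>exponents_le N. c a b * ((x - fst s) ^ a * (y - snd s) ^ b))"
    unfolding c_def by (rule xyeval_expand[OF tdeg_le_shift[OF P(2)]])
  also have "cmod \<dots> \<le> (\<Sum>p\<in>exponents_le N. real ((N + 1) ^ 2 * (H * (2 ^ N * Y ^ N))) * \<epsilon> ^ n)"
  proof (rule sum_norm_le)
    fix p assume "p \<in> exponents_le N"
    obtain a b where p: "p = (a, b)" by force
    show "cmod (case p of (a, b) \<Rightarrow> c a b * ((x - fst s) ^ a * (y - snd s) ^ b))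
        \<le> real ((N + 1) ^ 2 * (H * (2 ^ N * Y ^ N))) * \<epsilon> ^ n"
    proof (cases "a + b < n")
      case True
      then have "c a b = 0" using P(3) by (simp add: c_def vanish_order_def)
      then show ?thesis using x(3) by (simp add: p)
    next
      case False
      have "cmod (x - fst s) ^ a * cmod (y - snd s) ^ b \<le> \<epsilon> ^ a * \<epsilon> ^ b"
        using x by (intro mult_mono power_mono) auto
      also have "\<dots> \<le> \<epsilon> ^ n"
        unfolding power_add[symmetric] using x False by (intro power_decreasing) auto
      finally show ?thesis
        using cb[of a b] x(3) unfolding p by (simp only: prod.case norm_mult norm_power) (intro mult_mono, auto)
    qed
  qed
  also have "\<dots> = real (card (exponents_le N)) * (real ((N + 1) ^ 2 * (H * (2 ^ N * Y ^ N))) * \<epsilon> ^ n)" by simp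
  also have "\<dots> \<le> real ((N + 1) ^ 2) * (real ((N + 1) ^ 2 * (H * (2 ^ N * Y ^ N))) * \<epsilon> ^ n)"
    using card_exponents_le_le[of N] x(3) by (intro mult_right_mono of_nat_mono) auto
  also have "\<dots> = real ((N + 1) ^ 4 * H * 2 ^ N * Y ^ N) * \<epsilon> ^ n"
  proof -
    have "(N + 1) ^ 4 = (N + 1) ^ 2 * (N + 1) ^ 2" by (simp flip: power_add)
    then show ?thesis by (simp only: of_nat_mult mult_ac)
  qed
  finally show ?thesis .
qed

text \<open>
  An integer of absolute value less than one is zero.
\<close>
lemma xyeval_rational_zero:
  assumes P: "int_coeffs H P" "tdeg_le e P" and q: "0 < (q :: nat)"
    and small: "real q ^ e * cmod (xyeval P (of_int p1 / of_nat q) (of_int p2 / of_nat q)) < 1"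
  shows "xyeval P (of_int p1 / of_nat q) (of_int p2 / of_nat q) = 0"
proof -
  define w where "w = of_nat q ^ e * xyeval P (of_int p1 / of_nat q) (of_int p2 / of_nat q)"
  have "w = (\<Sum>(i, j)\<in>exponents_le e. xycoeff P i j * of_int (p1 ^ i * p2 ^ j * int q ^ (e - (i + j))))"
    unfolding w_def xyeval_expand[OF P(2)] sum_distrib_left
  proof (intro sum.cong refl, clarify)
    fix i j assume "(i, j) \<in> exponents_le e"
    then have "i + j \<le> e" by (simp add: exponents_le_def)
    then have "(of_nat q :: complex) ^ e = of_nat q ^ (e - (i + j)) * (of_nat q ^ i * of_nat q ^ j)"
      by (simp flip: power_add)
    then show "of_nat q ^ e * (xycoeff P i j * ((of_int p1 / of_nat q) ^ i * (of_int p2 / of_nat q) ^ j)) =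
        xycoeff P i j * of_int (p1 ^ i * p2 ^ j * int q ^ (e - (i + j)))"
      using q by (simp add: power_divide field_simps)
  qed
  also have "\<dots> \<in> \<int>"
    using int_coeffs_Ints[OF P(1)] by (intro Ints_sum) (auto simp: case_prod_beta intro!: Ints_mult)
  finally obtain k :: int where k: "w = of_int k" by (auto elim: Ints_cases)
  have "cmod w < 1" using small by (simp add: w_def norm_mult norm_power)
  then have "\<bar>real_of_int k\<bar> < 1" unfolding k by simp
  then have "k = 0" by linarith
  then show ?thesis using k q by (simp add: w_def)
qed

section \<open>Rational points close to an algebraic point of a curve\<close>

definition ddx :: "bpoly \<Rightarrow> bpoly" where "ddx P = map_poly pderiv P"
definition ddy :: "bpoly \<Rightarrow> bpoly" where "ddy P = pderiv P"

lemma xycoeff_ddx: "xycoeff (ddx P) i j = of_nat (Suc i) * xycoeff P (Suc i) j"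
  by (simp add: xycoeff_def ddx_def coeff_map_poly coeff_pderiv)

lemma xycoeff_ddy: "xycoeff (ddy P) i j = of_nat (Suc j) * xycoeff P i (Suc j)"
proof -
  have "coeff (of_nat n * (p :: complex poly)) i = of_nat n * coeff p i" for n p
    by (induction n) (auto simp: algebra_simps)
  then show ?thesis by (simp add: xycoeff_def ddy_def coeff_pderiv del: of_nat_Suc)
qed

lemma xyeval_ddx: "xyeval (ddx P) s t = xycoeff (shift s t P) 1 0"
proof -
  obtain n where n: "tdeg_le n P" using ex_tdeg_le by blast
  have "ddx P = (\<Sum>p\<in>exponents_le n. cscale (xycoeff P (fst p) (snd p)) (ddx (xy_monom (fst p) (snd p))))"
  proof (rule bpoly_eqI)
    fix i j
    show "xycoeff (ddx P) i j = xycoeff (\<Sum>p\<in>exponents_le n. cscale (xycoeff P (fst p) (snd p)) (ddx (xy_monom (fst p) (snd p)))) i j"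
      by (subst bpoly_expand[OF n]) (simp add: xycoeff_ddx xycoeff_sum sum_distrib_left case_prod_beta mult_ac)
  qed
  moreover have "ddx (xy_monom i j) = cscale (of_nat i) (xy_monom (i - 1) j)" for i j
    by (rule bpoly_eqI) (auto simp: xycoeff_ddx xycoeff_xy_monom)
  ultimately show ?thesis
    unfolding xycoeff_shift[OF n] by (simp add: xyeval_sum hasse_def case_prod_beta)
qed

lemma xyeval_ddy: "xyeval (ddy P) s t = xycoeff (shift s t P) 0 1"
proof -
  obtain n where n: "tdeg_le n P" using ex_tdeg_le by blast
  have "ddy P = (\<Sum>p\<in>exponents_le n. cscale (xycoeff P (fst p) (snd p)) (ddy (xy_monom (fst p) (snd p))))"
  proof (rule bpoly_eqI)
    fix i j
    show "xycoeff (ddy P) i j = xycoeff (\<Sum>p\<in>exponents_le n. cscale (xycoeff P (fst p) (snd p)) (ddy (xy_monom (fst p) (snd p)))) i j"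
      by (subst bpoly_expand[OF n]) (simp add: xycoeff_ddy xycoeff_sum sum_distrib_left case_prod_beta mult_ac)
  qed
  moreover have "ddy (xy_monom i j) = cscale (of_nat j) (xy_monom i (j - 1))" for i j
    by (rule bpoly_eqI) (auto simp: xycoeff_ddy xycoeff_xy_monom)
  ultimately show ?thesis
    unfolding xycoeff_shift[OF n] by (simp add: xyeval_sum hasse_def case_prod_beta)
qed

lemma tdeg_le_ddx: "tdeg_le m P \<Longrightarrow> tdeg_le (m - 1) (ddx P)"
  and tdeg_le_ddy: "tdeg_le m P \<Longrightarrow> tdeg_le (m - 1) (ddy P)"
  by (auto simp: tdeg_le_altdef xycoeff_ddx xycoeff_ddy)

text \<open>
  If each polynomial of \<open>W\<close> is a multiple of \<open>f\<close>, then \<open>f\<close> is proportional to a rational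
  polynomial \<open>g\<close>. At a singular point both partial derivatives of \<open>g\<close> vanish; being rational, they
  vanish on all of \<open>S\<close>. So they are multiples of \<open>f\<close> of smaller degree, hence zero, and \<open>g\<close> is
  constant, a contradiction.
\<close>
lemma smooth_on_conjugates:
  fixes S :: "(complex \<times> complex) set"
  assumes f: "tdeg_le m f" "i0 + j0 = m" "xycoeff f i0 j0 \<noteq> 0" "1 \<le> m"
    and W: "\<And>g i j. g \<in> W \<Longrightarrow> xycoeff g i j \<in> \<rat>" "\<And>g. g \<in> W \<Longrightarrow> tdeg_le m g"
    and span: "\<And>P. tdeg_le m P \<Longrightarrow> (\<And>s. s \<in> S \<Longrightarrow> xyeval P (fst s) (snd s) = 0) \<Longrightarrow> in_span W P"
    and fS: "\<And>s. s \<in> S \<Longrightarrow> xyeval f (fst s) (snd s) = 0"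
    and conj: "\<And>H s s'. (\<forall>i j. xycoeff H i j \<in> \<rat>) \<Longrightarrow> s \<in> S \<Longrightarrow> s' \<in> S \<Longrightarrow> xyeval H (fst s) (snd s) = 0 \<Longrightarrow>
       xyeval H (fst s') (snd s') = 0"
    and dvd: "\<And>g. g \<in> W \<Longrightarrow> f dvd g"
    and s0: "s0 \<in> S"
  shows "smooth_at f s0"
proof (rule ccontr)
  assume "\<not> smooth_at f s0"
  then have sing: "xycoeff (shift (fst s0) (snd s0) f) 1 0 = 0" "xycoeff (shift (fst s0) (snd s0) f) 0 1 = 0"
    by (auto simp: smooth_at_def)
  obtain c where c: "f = (\<Sum>g\<in>W. cscale (c g) g)"
    using span[OF f(1) fS] unfolding in_span_def by blast
  have "\<exists>g\<in>W. g \<noteq> 0"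
  proof (rule ccontr)
    assume "\<not> ?thesis"
    then have "f = 0" unfolding c by (intro sum.neutral) auto
    with f(3) show False by simp
  qed
  then obtain g where g: "g \<in> W" "g \<noteq> 0" by blast
  obtain R where R: "g = f * R" using dvd[OF g(1)] by (rule dvdE)
  with g(2) have "R \<noteq> 0" by auto
  have "tdeg_le (m - m) R"
    using tdeg_le_cofactor[OF _ f(1-3) \<open>R \<noteq> 0\<close>, of m] W(2)[OF g(1)] R by simp
  then have R1: "R = cscale (xycoeff R 0 0) 1"
    by (intro bpoly_eqI) (auto simp: tdeg_le_altdef xycoeff_1)
  with \<open>R \<noteq> 0\<close> have c0: "xycoeff R 0 0 \<noteq> 0" by (metis cscale_0(1))
  have gf: "g = cscale (xycoeff R 0 0) f"
    using R R1 by (metis mult.right_neutral cscale_mult_right)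
  have g_sing: "xycoeff (shift (fst s0) (snd s0) g) 1 0 = 0" "xycoeff (shift (fst s0) (snd s0) g) 0 1 = 0"
    unfolding gf shift_cscale xycoeff_cscale sing by simp_all
  have zero: "D = 0" if "tdeg_le (m - 1) D" "\<And>i j. xycoeff D i j \<in> \<rat>" "xyeval D (fst s0) (snd s0) = 0" for D
  proof (rule ccontr)
    assume "D \<noteq> 0"
    have "in_span W D"
    proof (rule span)
      show "tdeg_le m D" using that(1) by (rule tdeg_le_mono) simp
      show "xyeval D (fst s) (snd s) = 0" if "s \<in> S" for s
        using conj[of D s0 s] \<open>\<And>i j. xycoeff D i j \<in> \<rat>\<close> s0 that \<open>xyeval D (fst s0) (snd s0) = 0\<close> by blast
    qed
    then have "f dvd D" using dvd by (rule in_span_dvd)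
    then obtain T where T: "D = f * T" by (rule dvdE)
    with \<open>D \<noteq> 0\<close> have "T \<noteq> 0" by auto
    from conjunct1[OF tdeg_le_cofactor[OF that(1)[unfolded T] f(1-3) this]] f(4) show False by linarith
  qed
  have gQ: "xycoeff g i j \<in> \<rat>" for i j using W(1)[OF g(1)] .
  have "ddx g = 0"
    by (rule zero[OF tdeg_le_ddx[OF W(2)[OF g(1)]]])
      (use gQ g_sing in \<open>auto simp: xycoeff_ddx xyeval_ddx intro!: Rats_mult simp del: of_nat_Suc\<close>)
  moreover have "ddy g = 0"
    by (rule zero[OF tdeg_le_ddy[OF W(2)[OF g(1)]]])
      (use gQ g_sing in \<open>auto simp: xycoeff_ddy xyeval_ddy intro!: Rats_mult simp del: of_nat_Suc\<close>)
  moreover have "xycoeff g i0 j0 \<noteq> 0" by (subst gf) (use c0 f(3) in simp)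
  ultimately show False
    using f(2,4) xycoeff_ddx[of g "i0 - 1" j0] xycoeff_ddy[of g i0 "j0 - 1"]
    by (cases i0; cases j0) (auto simp del: of_nat_Suc)
qed

text \<open>
  Multiplication by a polynomial of degree at most \<open>D\<close> is absorbed by adding monomial multiples of the
  generators.
\<close>
lemma in_span_mult:
  assumes "finite G" "tdeg_le D A" "in_span G P"
  shows "in_span ((\<lambda>(p, g). xy_monom (fst p) (snd p) * g) ` (exponents_le D \<times> G)) (A * P)"
proof -
  obtain c where c: "P = (\<Sum>g\<in>G. cscale (c g) g)" using assms(3) unfolding in_span_def ..
  have "A * P = (\<Sum>p\<in>exponents_le D. cscale (xycoeff A (fst p) (snd p)) (xy_monom (fst p) (snd p))) * P"
    using bpoly_expand[OF assms(2)] by (simp add: case_prod_beta)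
  also have "\<dots> = (\<Sum>p\<in>exponents_le D. \<Sum>g\<in>G. cscale (xycoeff A (fst p) (snd p)) (cscale (c g) (xy_monom (fst p) (snd p) * g)))"
    unfolding c sum_product by (simp only: cscale_mult_left cscale_mult_right cscale_cscale mult.commute)
  finally show ?thesis
    using assms(1)
    by (auto intro!: in_span_sum in_span_cscale in_span_member)
qed

text \<open>
  The constants of \<open>small_integer_relations\<close>. There \<open>X\<close> bounds the data, \<open>base_size X\<close> bounds the degrees
  and numbers of points in the argument, each "height" bounds the coefficients of the integer
  polynomials found at one of three stages, each "error" times
  a power of \<open>\<epsilon>\<close> bounds their values at distance \<open>\<epsilon>\<close> from \<open>\<alpha>\<close>, and the sizes \<open>aux_size\<close> and \<open>elim_size\<close> bound the linear systems.
\<close>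
definition base_size :: "nat \<Rightarrow> nat" where "base_size X = (X + 2) ^ 6"
definition jet_height :: "nat \<Rightarrow> nat" where "jet_height X = jet_bound (base_size X)"
definition jet_error :: "nat \<Rightarrow> nat" where
  "jet_error X = (base_size X + 1) ^ 4 * jet_height X * 2 ^ base_size X * base_size X ^ base_size X"
definition aux_size :: "nat \<Rightarrow> nat" where
  "aux_size X = (base_size X + 1) ^ 4 + (base_size X + 1) ^ 2 + jet_height X"
definition aux_height :: "nat \<Rightarrow> nat" where "aux_height X = aux_size X * kernel_bound (aux_size X) * aux_size X"
definition aux_error :: "nat \<Rightarrow> nat" where "aux_error X = aux_size X * kernel_bound (aux_size X) * jet_error X"
definition elim_size :: "nat \<Rightarrow> nat" where
  "elim_size X = ((2 * base_size X + 1) ^ 2 + 1) ^ 2 * aux_size X + aux_height X"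
definition elim_height :: "nat \<Rightarrow> nat" where "elim_height X = elim_size X * kernel_bound (elim_size X) * elim_size X"
definition threshold :: "nat \<Rightarrow> nat" where "threshold X = jet_error X ^ X + aux_error X"

text \<open>
  For \<open>\<delta> = a/b\<close> the degree \<open>e\<close> is \<open>n\<delta> - 1\<close>, the largest integer less than \<open>n\<delta>\<close>. From
  \<open>\<delta> > d/m\<close> one gets \<open>a m \<ge> b d + 1\<close>, and the factor \<open>m (m + 1)\<close> in \<open>n\<close> turns this surplus into
  \<open>e m \<ge> n d + m^2\<close>, enough to absorb the lower-order terms in the dimension of the space of
  polynomials of degree at most \<open>e\<close> modulo those divisible by \<open>f\<close>.
\<close>
lemma degree_count:
  fixes a b m d :: nat
  assumes "1 \<le> m" "1 \<le> b" "b * m < a" "b * d < a * m"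
  defines "n \<equiv> b * m * (m + 1)" and "e \<equiv> a * m * (m + 1) - 1"
  shows "e + 1 = a * m * (m + 1)" "m \<le> e" "1 \<le> n"
    "n * d + card (exponents_le (e - m)) < card (exponents_le e)"
proof -
  have a: "1 \<le> a" "m < a" using assms(2,3) by (auto intro: le_less_trans[of m "b * m" a])
  have "0 < a * m * (m + 1)" using a assms(1) by (intro mult_pos_pos) auto
  then have am: "1 \<le> a * m * (m + 1)" by linarith
  then show e1: "e + 1 = a * m * (m + 1)" unfolding e_def by simp
  have "m + 1 \<le> a * 1" using a(2) by simp
  also have "\<dots> \<le> a * (m * (m + 1))" using assms(1) by (intro mult_left_mono) auto
  also have "\<dots> = a * m * (m + 1)" by (simp only: mult.assoc)
  finally have "m + 1 \<le> a * m * (m + 1)" .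
  then show "m \<le> e" using e1 by linarith
  have "0 < b * m * (m + 1)" using assms(1,2) by (intro mult_pos_pos) auto
  then show "1 \<le> n" unfolding n_def by linarith
  obtain k where k: "e = k + m" using \<open>m \<le> e\<close> by (metis le_add_diff_inverse2)
  have "(b * d + 1) * (m * (m + 1)) \<le> a * m * (m * (m + 1))"
    using assms(4) by (intro mult_right_mono) auto
  also have "\<dots> = m * (e + 1)" unfolding e1 by (simp add: algebra_simps)
  finally have "n * d + m * (m + 1) \<le> m * (k + m + 1)"
    unfolding k n_def by (simp add: algebra_simps)
  then have nd: "n * d \<le> m * k" by (simp add: algebra_simps)
  have "2 * (n * d + card (exponents_le (e - m))) = 2 * (n * d) + (k + 1) * (k + 2)"
    using card_exponents_le[of k] by (simp add: k)
  also have "\<dots> \<le> 2 * (m * k) + (k + 1) * (k + 2)" using nd by simp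
  also have "\<dots> < (k + m + 1) * (k + m + 2)"
    using assms(1) by (simp add: algebra_simps)
  also have "\<dots> = 2 * card (exponents_le e)" using card_exponents_le[of e] by (simp add: k)
  finally show "n * d + card (exponents_le (e - m)) < card (exponents_le e)" by simp
qed

lemma base_size_bounds:
  fixes a b m d :: nat
  assumes "m \<le> X" "a \<le> X" "b \<le> X" "d \<le> X ^ 2"
  shows "a * m * (m + 1) \<le> base_size X" "b * m * (m + 1) * (d + 1) + m \<le> base_size X"
    "X ^ 2 \<le> base_size X" "X + 1 \<le> base_size X" "1 \<le> base_size X"
proof -
  define t where "t = X + 2"
  have t: "2 \<le> t" "m \<le> t" "a \<le> t" "b \<le> t" "m + 1 \<le> t" "X + 1 \<le> t" using assms by (auto simp: t_def)
  have s: "base_size X = t ^ 6" by (simp add: base_size_def t_def)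
  have pow: "t ^ i \<le> base_size X" if "i \<le> 6" for i
    unfolding s using that t(1) by (intro power_increasing) auto
  have "a * m * (m + 1) \<le> t * t * t" using t by (intro mult_le_mono) auto
  also have "\<dots> = t ^ 3" by (simp add: power3_eq_cube)
  also have "\<dots> \<le> base_size X" by (rule pow) simp
  finally show "a * m * (m + 1) \<le> base_size X" .
  have "d + 1 \<le> t ^ 2" using assms(4) by (simp add: t_def power2_eq_square)
  then have "b * m * (m + 1) * (d + 1) \<le> t * t * t * t ^ 2" using t by (intro mult_le_mono) auto
  also have "\<dots> = t ^ 5" by (simp add: eval_nat_numeral)
  finally have "b * m * (m + 1) * (d + 1) + m \<le> t ^ 5 + t ^ 1" using t by simp
  also have "\<dots> \<le> t ^ 5 + t ^ 5" using t by (intro add_left_mono power_increasing) auto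
  also have "\<dots> = 2 * t ^ 5" by simp
  also have "\<dots> \<le> t * t ^ 5" using t by (intro mult_right_mono) auto
  also have "\<dots> = base_size X" by (simp add: s eval_nat_numeral)
  finally show "b * m * (m + 1) * (d + 1) + m \<le> base_size X" .
  have "X ^ 2 \<le> t ^ 2" by (intro power_mono) (auto simp: t_def)
  also have "\<dots> \<le> base_size X" by (rule pow) simp
  finally show "X ^ 2 \<le> base_size X" .
  have "X + 1 \<le> t ^ 1" using t by simp
  also have "\<dots> \<le> base_size X" by (rule pow) simp
  finally show "X + 1 \<le> base_size X" .
  then show "1 \<le> base_size X" by simp
qed

lemma kernel_bound_pos: "1 \<le> Y \<Longrightarrow> 1 \<le> kernel_bound Y"
  by (simp add: kernel_bound_def)

lemma jet_height_pos: "1 \<le> jet_height X"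
proof -
  have "1 \<le> (base_size X + 1) ^ 2" by simp
  then have "1 \<le> jet_size (base_size X)" unfolding jet_size_def by (rule trans_le_add2)
  then show ?thesis unfolding jet_height_def jet_bound_def
    using kernel_bound_pos[of "jet_size (base_size X)"] by simp
qed

lemma jet_error_pos: "1 \<le> jet_error X"
proof -
  have "1 \<le> base_size X" by (simp add: base_size_def)
  then show ?thesis unfolding jet_error_def using jet_height_pos[of X] by simp
qed

text \<open>
  The core of the proof: for large \<open>q\<close> the point \<open>\<xi>\<close> lies on two curves without common component,
  and elimination yields integer relations of bounded size for each of its coordinates. The number
  \<open>\<epsilon>\<close> stands for \<open>q^(-\<delta>)\<close> with \<open>\<delta> = a/b\<close>, so that \<open>\<epsilon>^b q^a = 1\<close>.
\<close>
lemma small_integer_relations: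
  fixes S :: "(complex \<times> complex) set" and a b m d q :: nat and \<epsilon> :: real
  assumes S: "finite S" "\<alpha> \<in> S" "card S = d"
    and X: "m \<le> X" "a \<le> X" "b \<le> X" "d \<le> X ^ 2" "1 \<le> m" "1 \<le> b"
    and A: "1 \<le> A" "A \<le> X ^ 2" "\<And>k l. of_nat A ^ (k + l) * (\<Sum>s\<in>S. fst s ^ k * snd s ^ l) \<in> \<int>"
    and bd: "\<And>s. s \<in> S \<Longrightarrow> cmod (fst s) \<le> real (X + 1) \<and> cmod (snd s) \<le> real (X + 1)"
    and conj: "\<And>H s s'. (\<forall>i j. xycoeff H i j \<in> \<rat>) \<Longrightarrow> s \<in> S \<Longrightarrow> s' \<in> S \<Longrightarrow> xyeval H (fst s) (snd s) = 0 \<Longrightarrow>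
       xyeval H (fst s') (snd s') = 0"
    and f: "irreducible f" "tdeg_le m f" "i0 + j0 = m" "xycoeff f i0 j0 \<noteq> 0"
    and fS: "\<And>s. s \<in> S \<Longrightarrow> xyeval f (fst s) (snd s) = 0"
    and \<delta>: "b * m < a" "b * d < a * m"
    and \<epsilon>: "0 \<le> \<epsilon>" "\<epsilon> \<le> 1" "\<epsilon> ^ b * real q ^ a = 1"
    and near: "cmod (of_int p1 / of_nat q - fst \<alpha>) \<le> \<epsilon>" "cmod (of_int p2 / of_nat q - snd \<alpha>) \<le> \<epsilon>"
    and large: "threshold X < q"
  shows "\<exists>R. R \<noteq> 0 \<and> int_coeffs (elim_height X) R \<and> (\<forall>i j. 0 < j \<longrightarrow> xycoeff R i j = 0) \<and>
             xyeval R (of_int p1 / of_nat q) (of_int p2 / of_nat q) = 0"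
    and "\<exists>R. R \<noteq> 0 \<and> int_coeffs (elim_height X) R \<and> (\<forall>i j. 0 < i \<longrightarrow> xycoeff R i j = 0) \<and>
             xyeval R (of_int p1 / of_nat q) (of_int p2 / of_nat q) = 0"
proof -
  define \<xi>1 \<xi>2 where "\<xi>1 = (of_int p1 / of_nat q :: complex)" and "\<xi>2 = (of_int p2 / of_nat q :: complex)"
  define n e where "n = b * m * (m + 1)" and "e = a * m * (m + 1) - 1"
  note dc = degree_count[OF X(5,6) \<delta>, folded n_def e_def]
  define D N where "D = n * (d + 1)" and "N = max e (D + m)"
  define Y where "Y = base_size X"
  note sb = base_size_bounds[OF X(1-4), folded n_def Y_def]
  have q0: "0 < q" using large by simp
  have NY: "N \<le> Y" using sb(1,2) dc(1) by (simp add: N_def D_def)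
  have mY: "m \<le> Y" and DY: "D \<le> Y" and eY: "e \<le> Y" using NY by (auto simp: N_def)
  have cardS: "card S \<le> Y" using S(3) X(4) sb(3) by linarith
  have AY: "A \<le> Y" using A(2) sb(3) by linarith
  have bdY: "cmod (fst s) \<le> real Y \<and> cmod (snd s) \<le> real Y" if "s \<in> S" for s
    using bd[OF that] sb(4) by (meson of_nat_mono order_trans)
  have Y1: "1 \<le> Y" using sb(5) .
  \<comment> \<open>The power sums of \<open>S\<close> are rational with denominators dividing powers of \<open>A\<close>, so bases with integer
    coefficients exist although \<open>f\<close> itself has complex coefficients.\<close>
  obtain W where W: "finite W" "card W \<le> (Y + 1) ^ 2" "\<And>g. g \<in> W \<Longrightarrow> int_coeffs (jet_height X) g"
    "\<And>g. g \<in> W \<Longrightarrow> tdeg_le m g" "\<And>g s. g \<in> W \<Longrightarrow> s \<in> S \<Longrightarrow> vanish_order 1 s g"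
    "\<And>P. tdeg_le m P \<Longrightarrow> (\<And>s. s \<in> S \<Longrightarrow> vanish_order 1 s P) \<Longrightarrow> in_span W P"
    unfolding jet_height_def Y_def[symmetric]
    using jet_basis[OF S(1) cardS Y1 mY A(1) AY A(3) bdY, of 1] by blast
  obtain Q where Q: "finite Q" "card Q \<le> (Y + 1) ^ 2" "\<And>g. g \<in> Q \<Longrightarrow> int_coeffs (jet_height X) g"
    "\<And>g. g \<in> Q \<Longrightarrow> tdeg_le N g" "\<And>g s. g \<in> Q \<Longrightarrow> s \<in> S \<Longrightarrow> vanish_order n s g"
    "\<And>P. tdeg_le N P \<Longrightarrow> (\<And>s. s \<in> S \<Longrightarrow> vanish_order n s P) \<Longrightarrow> in_span Q P"
    unfolding jet_height_def Y_def[symmetric]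
    using jet_basis[OF S(1) cardS Y1 NY A(1) AY A(3) bdY, of n] by blast
  have W_span: "in_span W P" if "tdeg_le m P" "\<And>s. s \<in> S \<Longrightarrow> xyeval P (fst s) (snd s) = 0" for P
    using W(6)[OF that(1)] that(2) unfolding vanish_order_1 by blast
  have est: "cmod (xyeval P \<xi>1 \<xi>2) \<le> real (jet_error X) * \<epsilon> ^ k"
    if "int_coeffs (jet_height X) P" "tdeg_le Y P" "vanish_order k \<alpha> P" for P k
    unfolding jet_error_def Y_def[symmetric]
    using xyeval_near_zero_bound[OF that _ _ Y1, of \<xi>1 \<epsilon> \<xi>2] bdY[OF S(2)] near \<epsilon>
    unfolding \<xi>1_def[symmetric] \<xi>2_def[symmetric] by simp
  have q_real: "0 < real q" "1 \<le> real q" using q0 by auto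
  have C1: "1 \<le> real (jet_error X)" using jet_error_pos[of X] by simp
  have W_zero: "xyeval g \<xi>1 \<xi>2 = 0" if "g \<in> W" for g
    unfolding \<xi>1_def \<xi>2_def
  proof (rule xyeval_rational_zero[OF W(3)[OF that] W(4)[OF that] q0], fold \<xi>1_def \<xi>2_def)
    \<comment> \<open>As \<open>b m < a\<close>, the \<open>b\<close>-th power of \<open>u\<close> is at most \<open>jet_error X ^ b / q\<close>.\<close>
    define u where "u = real q ^ m * (real (jet_error X) * \<epsilon>)"
    have "real q ^ m * cmod (xyeval g \<xi>1 \<xi>2) \<le> u"
      unfolding u_def using est[of g 1] W(3,4,5)[OF that] S(2) tdeg_le_mono[OF _ mY]
      by (intro mult_left_mono) auto
    also have "u < 1"
    proof (rule ccontr)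
      assume "\<not> u < 1"
      then have "1 \<le> u ^ b" by (intro one_le_power) simp
      have "jet_error X ^ b \<le> jet_error X ^ X" using jet_error_pos[of X] X(3) by (intro power_increasing) auto
      also have "\<dots> < q" using large by (simp add: threshold_def)
      finally have "real (jet_error X) ^ b < real q" by (metis of_nat_less_iff of_nat_power)
      have "u ^ b * real q ^ a = real q ^ (b * m) * real (jet_error X) ^ b * (\<epsilon> ^ b * real q ^ a)"
        by (simp add: u_def power_mult_distrib power_mult[symmetric] mult.commute mult.left_commute)
      also have "\<dots> = real q ^ (b * m) * real (jet_error X) ^ b" using \<epsilon>(3) by simp
      also have "\<dots> < real q ^ (b * m) * real q"
        using \<open>real (jet_error X) ^ b < real q\<close> q_real by (intro mult_strict_left_mono) auto
      also have "\<dots> = real q ^ (b * m + 1)" by simp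
      also have "\<dots> \<le> real q ^ a" using \<delta>(1) q_real by (intro power_increasing) auto
      finally have "u ^ b * real q ^ a < 1 * real q ^ a" by simp
      then have "u ^ b < 1" using q_real by (simp add: mult_less_cancel_right)
      with \<open>1 \<le> u ^ b\<close> show False by simp
    qed
    finally show "real q ^ m * cmod (xyeval g \<xi>1 \<xi>2) < 1" .
  qed
  \<comment> \<open>The span of \<open>G\<close> contains what agrees with a combination of \<open>Q\<close> modulo multiples of \<open>W\<close>;
    at \<open>\<xi>\<close> the elements of \<open>W\<close> vanish and those of \<open>Q\<close> are tiny.\<close>
  define G where "G = (\<lambda>(p, g). xy_monom (fst p) (snd p) * g) ` (exponents_le D \<times> W) \<union> Q"
  have finG: "finite G" using W(1) Q(1) by (simp add: G_def)
  have int_G: "int_coeffs (jet_height X) g" if "g \<in> G" for g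
    using that W(3) Q(3) by (auto simp: G_def intro: int_coeffs_xy_monom_mult)
  have xyeval_G: "cmod (xyeval g \<xi>1 \<xi>2) \<le> real (jet_error X) * \<epsilon> ^ n" if "g \<in> G" for g
  proof (cases "g \<in> Q")
    case True
    show ?thesis
      by (rule est[OF Q(3)[OF True] tdeg_le_mono[OF Q(4)[OF True] NY] Q(5)[OF True S(2)]])
  next
    case False
    with that obtain p w where "w \<in> W" "g = xy_monom (fst p) (snd p) * w" by (auto simp: G_def)
    then show ?thesis using W_zero \<epsilon>(1) by simp
  qed
  have cardG: "card G \<le> aux_size X"
  proof -
    have "card G \<le> card (exponents_le D \<times> W) + card Q"
      unfolding G_def using W(1)
      by (intro order_trans[OF card_Un_le] add_right_mono card_image_le) auto
    also have "\<dots> \<le> (Y + 1) ^ 2 * (Y + 1) ^ 2 + (Y + 1) ^ 2"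
      using card_exponents_le_le[of D] W(2) Q(2) DY unfolding card_cartesian_product
      by (intro add_mono mult_mono) (auto intro: order_trans[OF _ power_mono])
    also have "(Y + 1) ^ 2 * (Y + 1) ^ 2 = (Y + 1) ^ 4" by (simp flip: power_add)
    also have "(Y + 1) ^ 4 + (Y + 1) ^ 2 \<le> aux_size X" by (simp add: aux_size_def Y_def)
    finally show ?thesis .
  qed
  have s2: "1 \<le> aux_size X" using jet_height_pos[of X] by (simp add: aux_size_def)
  have int_G2: "int_coeffs (aux_size X) g" if "g \<in> G" for g
    using int_G[OF that] by (rule int_coeffs_mono) (simp add: aux_size_def)
  \<comment> \<open>\<open>V\<close>: the part of degree at most \<open>e\<close> of this span, so small at \<open>\<xi>\<close> that it vanishes there.\<close>
  obtain V where V: "finite V" "card V \<le> card G"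
    "\<And>h. h \<in> V \<Longrightarrow> \<exists>k. (\<forall>g. \<bar>k g\<bar> \<le> int (kernel_bound (aux_size X))) \<and> h = (\<Sum>g\<in>G. cscale (of_int (k g)) g)"
    "\<And>h p. h \<in> V \<Longrightarrow> p \<in> {p. e < fst p + snd p} \<Longrightarrow> xycoeff h (fst p) (snd p) = 0"
    "\<And>h. h \<in> V \<Longrightarrow> int_coeffs (aux_height X) h"
    "\<And>P. in_span G P \<Longrightarrow> (\<And>p. p \<in> {p. e < fst p + snd p} \<Longrightarrow> xycoeff P (fst p) (snd p) = 0) \<Longrightarrow> in_span V P"
    unfolding aux_height_def
    using elimination_basis[OF finG cardG s2 int_G2, of "{p. e < fst p + snd p}"] by blast
  have V_deg: "tdeg_le e h" if "h \<in> V" for h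
    using V(4)[OF that, of "(i, j)" for i j] by (auto simp: tdeg_le_altdef)
  have V_span: "in_span V P" if "in_span G P" "tdeg_le e P" for P
    using V(6)[OF that(1)] that(2) by (auto simp: tdeg_le_altdef)
  have V_zero: "xyeval h \<xi>1 \<xi>2 = 0" if hV: "h \<in> V" for h
    unfolding \<xi>1_def \<xi>2_def
  proof (rule xyeval_rational_zero[OF V(5)[OF hV] V_deg[OF hV] q0], fold \<xi>1_def \<xi>2_def)
    obtain k where k: "\<forall>g. \<bar>k g\<bar> \<le> int (kernel_bound (aux_size X))" "h = (\<Sum>g\<in>G. cscale (of_int (k g)) g)"
      using V(3)[OF hV] by blast
    define K where "K = real (kernel_bound (aux_size X))"
    have "cmod (xyeval h \<xi>1 \<xi>2) \<le> (\<Sum>g\<in>G. K * (real (jet_error X) * \<epsilon> ^ n))"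
      unfolding k(2) xyeval_sum xyeval_cscale
    proof (rule sum_norm_le)
      fix g assume g: "g \<in> G"
      have "\<bar>real_of_int (k g)\<bar> \<le> K" using k(1)[rule_format, of g] unfolding K_def by linarith
      then show "cmod (of_int (k g) * xyeval g \<xi>1 \<xi>2) \<le> K * (real (jet_error X) * \<epsilon> ^ n)"
        unfolding norm_mult using xyeval_G[OF g] by (intro mult_mono) (auto simp: K_def)
    qed
    also have "\<dots> = real (card G) * (K * (real (jet_error X) * \<epsilon> ^ n))" by simp
    also have "\<dots> \<le> real (aux_size X) * (K * (real (jet_error X) * \<epsilon> ^ n))"
      using cardG \<epsilon>(1) by (intro mult_right_mono) (auto simp: K_def)
    also have "\<dots> = real (aux_error X) * \<epsilon> ^ n" by (simp add: aux_error_def K_def)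
    finally have le: "real q ^ e * cmod (xyeval h \<xi>1 \<xi>2) \<le> real q ^ e * (real (aux_error X) * \<epsilon> ^ n)"
      by (rule mult_left_mono) simp
    have "(\<epsilon> ^ b * real q ^ a) ^ (m * (m + 1)) = \<epsilon> ^ n * real q ^ (e + 1)"
      unfolding power_mult_distrib power_mult[symmetric] dc(1) n_def by (simp only: mult.assoc)
    then have "real q ^ e * (real (aux_error X) * \<epsilon> ^ n) * real q = real (aux_error X)"
      using \<epsilon>(3) by (simp add: mult_ac)
    also have "\<dots> < 1 * real q" using large by (simp add: threshold_def)
    finally have "real q ^ e * (real (aux_error X) * \<epsilon> ^ n) * real q < 1 * real q" .
    then have "real q ^ e * (real (aux_error X) * \<epsilon> ^ n) < 1"
      using less_imp_le[OF q_real(1)] by (rule mult_right_less_imp_less)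
    with le show "real q ^ e * cmod (xyeval h \<xi>1 \<xi>2) < 1" by simp
  qed
  have f_span_W: "in_span W f" using f(2) fS by (rule W_span)
  have span_G_W: "in_span G (B * P)" if "tdeg_le D B" "in_span W P" for B P
  proof (rule in_span_trans[OF in_span_mult[OF W(1) that]])
    fix g assume "g \<in> (\<lambda>(p, g). xy_monom (fst p) (snd p) * g) ` (exponents_le D \<times> W)"
    then have "g \<in> G" by (simp add: G_def)
    with finG show "in_span G g" by (rule in_span_member)
  qed
  have W_G: "in_span G P" if "in_span W P" for P
    using span_G_W[OF tdeg_le_1 that] by simp
  \<comment> \<open>The second curve: an element of \<open>W\<close> if possible, else provided by \<open>auxiliary_curve\<close>.\<close>
  have ex_h: "\<exists>h. in_span G h \<and> tdeg_le e h \<and> \<not> f dvd h"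
  proof (cases "\<forall>g\<in>W. f dvd g")
    case False
    then obtain g where g: "g \<in> W" "\<not> f dvd g" by blast
    have "in_span G g" using in_span_member[OF W(1) g(1)] by (rule W_G)
    moreover have "tdeg_le e g" using W(4)[OF g(1)] dc(2) by (rule tdeg_le_mono)
    ultimately show ?thesis using g(2) by blast
  next
    case True
    have rat: "xycoeff g i j \<in> \<rat>" if "g \<in> W" for g i j
      using int_coeffs_Ints[OF W(3)[OF that]] Ints_subset_Rats by blast
    have smooth: "smooth_at f s" if "s \<in> S" for s
      by (rule smooth_on_conjugates[OF f(2-4) X(5) rat W(4) W_span fS conj _ that]) (use True in auto)
    obtain h B where h: "tdeg_le e h" "\<not> f dvd h" "tdeg_le D B" "\<forall>s\<in>S. vanish_order n s (h - B * f)"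
      using auxiliary_curve[OF S(1,3) f(2-4) fS smooth dc(4,3)] unfolding D_def by blast
    have "tdeg_le N (h - B * f)"
      using tdeg_le_mono[OF h(1)] tdeg_le_mono[OF tdeg_le_mult[OF h(3) f(2)]]
      by (intro tdeg_le_diff) (auto simp: N_def)
    then have "in_span Q (h - B * f)" using h(4) by (intro Q(6)) auto
    then have "in_span G (h - B * f)"
      by (rule in_span_trans) (auto simp: G_def intro!: in_span_member finG[unfolded G_def])
    moreover have "in_span G (B * f)" using h(3) f_span_W by (rule span_G_W)
    ultimately have "in_span G (h - B * f + B * f)" by (rule in_span_add)
    then show ?thesis using h(1,2) by auto
  qed
  then obtain h where h: "in_span G h" "tdeg_le e h" "\<not> f dvd h" by blast
  have f_V: "in_span V f" by (rule V_span[OF W_G[OF f_span_W] tdeg_le_mono[OF f(2) dc(2)]])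
  have h_V: "in_span V h" by (rule V_span[OF h(1,2)])
  \<comment> \<open>The resultants of \<open>f\<close> and \<open>h\<close> are combinations of monomial multiples of \<open>V\<close>.\<close>
  define D' where "D' = (m + e + 1) ^ 2"
  define G' where "G' = (\<lambda>(p, g). xy_monom (fst p) (snd p) * g) ` (exponents_le D' \<times> V)"
  have finG': "finite G'" using V(1) by (simp add: G'_def)
  have cardG': "card G' \<le> elim_size X"
  proof -
    have "D' \<le> (2 * Y + 1) ^ 2" unfolding D'_def using mY eY by (intro power_mono) auto
    then have "(D' + 1) ^ 2 \<le> ((2 * Y + 1) ^ 2 + 1) ^ 2" by (intro power_mono) auto
    then have "card (exponents_le D') \<le> ((2 * Y + 1) ^ 2 + 1) ^ 2" using card_exponents_le_le[of D'] by (rule order_trans[rotated])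
    moreover have "card V \<le> aux_size X" using V(2) cardG by (rule order_trans)
    ultimately have "card (exponents_le D') * card V \<le> ((2 * Y + 1) ^ 2 + 1) ^ 2 * aux_size X" by (rule mult_le_mono)
    moreover have "card G' \<le> card (exponents_le D' \<times> V)" unfolding G'_def using V(1) by (intro card_image_le) simp
    ultimately show ?thesis unfolding card_cartesian_product elim_size_def Y_def by linarith
  qed
  have s3: "1 \<le> elim_size X"
  proof -
    have "1 * 1 \<le> ((2 * base_size X + 1) ^ 2 + 1) ^ 2 * aux_size X"
      using s2 by (intro mult_le_mono one_le_power) simp_all
    then show ?thesis unfolding elim_size_def mult_1 by (rule trans_le_add1)
  qed
  have int_G': "int_coeffs (elim_size X) g" if "g \<in> G'" for g
  proof -
    have "int_coeffs (aux_height X) g" using that V(5) by (auto simp: G'_def intro: int_coeffs_xy_monom_mult)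
    then show ?thesis by (rule int_coeffs_mono) (simp add: elim_size_def)
  qed
  have xyeval_G': "xyeval g \<xi>1 \<xi>2 = 0" if "g \<in> G'" for g
    using that V_zero by (auto simp: G'_def)
  have concl: "\<exists>R. R \<noteq> 0 \<and> int_coeffs (elim_height X) R \<and> (\<forall>p\<in>M. xycoeff R (fst p) (snd p) = 0) \<and> xyeval R \<xi>1 \<xi>2 = 0"
    if AB: "tdeg_le D' B1" "tdeg_le D' B2" "B1 * f + B2 * h \<noteq> 0"
      "\<And>p. p \<in> M \<Longrightarrow> xycoeff (B1 * f + B2 * h) (fst p) (snd p) = 0" for B1 B2 M
  proof -
    show ?thesis
    proof (rule elimination_basis[OF finG' cardG' s3 int_G', of M])
      fix U
      assume U: "finite U" "card U \<le> card G'"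
        "\<And>h. h \<in> U \<Longrightarrow> \<exists>k. (\<forall>g. \<bar>k g\<bar> \<le> int (kernel_bound (elim_size X))) \<and> h = (\<Sum>g\<in>G'. cscale (of_int (k g)) g)"
        "\<And>h p. h \<in> U \<Longrightarrow> p \<in> M \<Longrightarrow> xycoeff h (fst p) (snd p) = 0"
        "\<And>h. h \<in> U \<Longrightarrow> int_coeffs (elim_size X * kernel_bound (elim_size X) * elim_size X) h"
        "\<And>P. in_span G' P \<Longrightarrow> (\<And>p. p \<in> M \<Longrightarrow> xycoeff P (fst p) (snd p) = 0) \<Longrightarrow> in_span U P"
      have "in_span G' (B1 * f + B2 * h)"
        unfolding G'_def by (intro in_span_add in_span_mult V(1) AB(1,2) f_V h_V)
      from U(6)[OF this AB(4)] obtain c where c: "B1 * f + B2 * h = (\<Sum>g\<in>U. cscale (c g) g)"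
        unfolding in_span_def by blast
      have "\<exists>R\<in>U. R \<noteq> 0"
      proof (rule ccontr)
        assume "\<not> ?thesis"
        then have "B1 * f + B2 * h = 0" unfolding c by (intro sum.neutral) auto
        with AB(3) show False by simp
    qed
      then obtain R where R: "R \<in> U" "R \<noteq> 0" by blast
      obtain k where k: "R = (\<Sum>g\<in>G'. cscale (of_int (k g)) g)" using U(3)[OF R(1)] by blast
      have "xyeval R \<xi>1 \<xi>2 = 0" unfolding k xyeval_sum xyeval_cscale using xyeval_G' by (intro sum.neutral) auto
      then show ?thesis using R(2) U(4,5)[OF R(1)] unfolding elim_height_def by blast
    qed
  qed
  obtain B1 B2 where AB: "tdeg_le D' B1" "tdeg_le D' B2" "B1 * f + B2 * h \<noteq> 0"
     "\<forall>i j. 0 < j \<longrightarrow> xycoeff (B1 * f + B2 * h) i j = 0"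
    using eliminate_y[OF f(1,2) h(3,2)] unfolding D'_def by blast
  have "\<exists>R. R \<noteq> 0 \<and> int_coeffs (elim_height X) R \<and> (\<forall>p\<in>{p. 0 < snd p}. xycoeff R (fst p) (snd p) = 0) \<and> xyeval R \<xi>1 \<xi>2 = 0"
  proof (rule concl[OF AB(1-3)])
    fix p :: "nat \<times> nat" assume "p \<in> {p. 0 < snd p}"
    then show "xycoeff (B1 * f + B2 * h) (fst p) (snd p) = 0" using AB(4) by simp
  qed
  then show "\<exists>R. R \<noteq> 0 \<and> int_coeffs (elim_height X) R \<and> (\<forall>i j. 0 < j \<longrightarrow> xycoeff R i j = 0) \<and>
      xyeval R (of_int p1 / of_nat q) (of_int p2 / of_nat q) = 0"
    unfolding \<xi>1_def \<xi>2_def by auto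
  obtain B1 B2 where AB: "tdeg_le D' B1" "tdeg_le D' B2" "B1 * f + B2 * h \<noteq> 0"
     "\<forall>i j. 0 < i \<longrightarrow> xycoeff (B1 * f + B2 * h) i j = 0"
    using eliminate_x[OF f(1,2) h(3,2)] unfolding D'_def by blast
  have "\<exists>R. R \<noteq> 0 \<and> int_coeffs (elim_height X) R \<and> (\<forall>p\<in>{p. 0 < fst p}. xycoeff R (fst p) (snd p) = 0) \<and> xyeval R \<xi>1 \<xi>2 = 0"
  proof (rule concl[OF AB(1-3)])
    fix p :: "nat \<times> nat" assume "p \<in> {p. 0 < fst p}"
    then show "xycoeff (B1 * f + B2 * h) (fst p) (snd p) = 0" using AB(4) by simp
  qed
  then show "\<exists>R. R \<noteq> 0 \<and> int_coeffs (elim_height X) R \<and> (\<forall>i j. 0 < i \<longrightarrow> xycoeff R i j = 0) \<and>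
      xyeval R (of_int p1 / of_nat q) (of_int p2 / of_nat q) = 0"
    unfolding \<xi>1_def \<xi>2_def by auto
qed

lemma root_bound:
  fixes p :: "int poly" and z :: complex
  assumes p: "p \<noteq> 0" "poly (map_poly of_int p) z = 0" and X: "\<And>i. \<bar>coeff p i\<bar> \<le> int X"
  shows "cmod z \<le> real (X + 1)"
proof (rule ccontr)
  assume "\<not> ?thesis"
  then have big: "real X + 1 < cmod z" by simp
  then have z1: "1 < cmod z" by (meson le_add_same_cancel2 le_less_trans of_nat_0_le_iff)
  define n where "n = degree p"
  have "poly (map_poly of_int p) z = (\<Sum>i\<le>n. of_int (coeff p i) * z ^ i)"
    by (simp add: poly_altdef n_def coeff_map_poly degree_map_poly)
  also have "\<dots> = (\<Sum>i<n. of_int (coeff p i) * z ^ i) + of_int (coeff p n) * z ^ n"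
    by (simp only: lessThan_Suc_atMost[symmetric] sum.lessThan_Suc)
  finally have eq: "of_int (coeff p n) * z ^ n = - (\<Sum>i<n. of_int (coeff p i) * z ^ i)"
    using p(2) by (simp add: eq_neg_iff_add_eq_0 add.commute)
  have "coeff p n \<noteq> 0" using p(1) by (simp add: n_def)
  then have "1 \<le> \<bar>real_of_int (coeff p n)\<bar>" by linarith
  then have "1 * cmod z ^ n \<le> cmod (of_int (coeff p n) * z ^ n)"
    unfolding norm_mult norm_power by (intro mult_right_mono) auto
  also have "\<dots> \<le> (\<Sum>i<n. real X * cmod z ^ i)"
    unfolding eq norm_minus_cancel
  proof (rule sum_norm_le)
    fix i
    have "\<bar>real_of_int (coeff p i)\<bar> \<le> real X" using X[of i] by linarith
    then show "cmod (of_int (coeff p i) * z ^ i) \<le> real X * cmod z ^ i"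
      unfolding norm_mult norm_power by (intro mult_right_mono) auto
  qed
  also have "\<dots> = real X * ((cmod z ^ n - 1) / (cmod z - 1))"
    using z1 by (simp add: sum_distrib_left[symmetric] geometric_sum)
  finally have "cmod z ^ n * (cmod z - 1) \<le> real X * (cmod z ^ n - 1)"
    using z1 by (simp add: field_simps)
  also have "\<dots> \<le> real X * cmod z ^ n" by (simp add: right_diff_distrib)
  also have "\<dots> < (cmod z - 1) * cmod z ^ n"
    using big z1 by (intro mult_strict_right_mono zero_less_power) linarith+
  finally show False by simp
qed

text \<open>
  The leading coefficient of an integer polynomial times a root is an algebraic integer, and a rational
  algebraic integer is an integer.
\<close>
lemma univariate_relation:
  assumes R: "R \<noteq> 0" "int_coeffs K R" "\<forall>i j. 0 < j \<longrightarrow> xycoeff R i j = 0" "xyeval R x y = 0" and x: "x \<in> \<rat>"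
  obtains l :: int where "l \<noteq> 0" "\<bar>l\<bar> \<le> int K" "of_int l * x \<in> \<int>"
proof -
  have "\<forall>i. \<exists>k::int. xycoeff R i 0 = of_int k \<and> \<bar>k\<bar> \<le> int K"
    using R(2) unfolding int_coeffs_def by blast
  from choice[OF this] obtain k :: "nat \<Rightarrow> int"
    where "\<forall>i. xycoeff R i 0 = of_int (k i) \<and> \<bar>k i\<bar> \<le> int K" ..
  then have k: "\<And>i. xycoeff R i 0 = of_int (k i)" "\<And>i. \<bar>k i\<bar> \<le> int K" by blast+
  define p where "p = Abs_poly k"
  have fin: "\<forall>\<^sub>\<infinity>i. k i = 0"
  proof -
    have "\<forall>\<^sub>\<infinity>i. coeff (coeff R 0) i = 0" by (rule MOST_coeff_eq_0)
    then show ?thesis by (rule MOST_mono) (use k(1) in \<open>auto simp: xycoeff_def\<close>)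
  qed
  have cp: "coeff p i = k i" for i
    unfolding p_def using fin by (simp add: Abs_poly_inverse)
  have RP: "R = const_y p"
    by (rule bpoly_eqI) (use R(3) k(1) cp in \<open>auto simp: xycoeff_const_y\<close>)
  have p0: "p \<noteq> 0"
  proof
    assume "p = 0"
    then have "R = 0" unfolding RP by (intro bpoly_eqI) (simp add: xycoeff_const_y)
    with R(1) show False ..
  qed
  have root: "poly (map_poly of_int p) x = 0" using R(4) unfolding RP xyeval_const_y .
  have "algebraic_int (of_int (lead_coeff p) * x)" using p0 root by (rule algebraic_int_lead_coeff_mult)
  then have "of_int (lead_coeff p) * x \<in> \<int>"
    by (rule rational_algebraic_int_complex) (use x in auto)
  moreover have "\<bar>lead_coeff p\<bar> \<le> int K" unfolding cp by (rule k(2))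
  ultimately show thesis using that[of "lead_coeff p"] p0 by simp
qed

text \<open>
  The irreducible polynomial divides the linear polynomial \<open>q X - u\<close>, which has only one root.
\<close>
lemma rational_root_irreducible:
  assumes p: "irreducible p" "poly (map_poly of_int p) \<alpha> = 0" "poly (map_poly of_int p) x = 0"
    and x: "x = of_int u / of_nat q" "0 < q"
  shows "(\<alpha> :: complex) = x"
proof -
  define h where "h = [:- u, int q:]"
  have h_xyeval: "poly (map_poly of_int h) z = of_nat q * z - of_int u" for z :: complex
  proof -
    have "map_poly of_int h = [:- of_int u, of_nat q :: complex:]"
      by (rule poly_eqI) (simp add: coeff_map_poly h_def coeff_pCons split: nat.split)
    then show ?thesis by (simp add: algebra_simps)
  qed
  have "poly (map_poly of_int h) x = 0" using x by (simp add: h_xyeval)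
  with p(1,3) have "p dvd h" by (rule irreducible_int_poly_dvd)
  then obtain k where k: "h = p * k" by (rule dvdE)
  have "poly (map_poly of_int h) \<alpha> = 0" unfolding k using p(2) by (simp add: of_int_poly_hom.hom_mult)
  then have "of_nat q * \<alpha> = of_int u" by (simp add: h_xyeval)
  also have "\<dots> = of_nat q * x" using x by simp
  finally show ?thesis using x(2) by simp
qed

definition liouville_factor :: "nat \<Rightarrow> nat" where
  "liouville_factor X = (X + 1) ^ 4 * X * 2 ^ X * (X + 1) ^ X"

text \<open>
  If \<open>l x\<close> is an integer, then \<open>l^(deg p) p(x)\<close> is a nonzero integer, whereas \<open>p(x)\<close> is bounded by a
  multiple of \<open>\<epsilon>\<close>, because \<open>p\<close> vanishes at \<open>\<alpha>\<close>. In \<open>liouville_factor\<close> the general estimate for two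
  variables is applied to \<open>p\<close> as a polynomial in \<open>x\<close> and \<open>y\<close>.
\<close>
lemma liouville:
  fixes p :: "int poly" and \<alpha> x :: complex and q :: nat and l :: int
  assumes p: "irreducible p" "poly (map_poly of_int p) \<alpha> = 0" "\<And>i. \<bar>coeff p i\<bar> \<le> int X" "degree p \<le> X"
    and x: "x = of_int u / of_nat q" "0 < q" "x \<noteq> \<alpha>"
    and l: "l \<noteq> 0" "\<bar>l\<bar> \<le> int K" "of_int l * x \<in> \<int>"
    and \<epsilon>: "cmod (x - \<alpha>) \<le> \<epsilon>" "0 \<le> \<epsilon>" "\<epsilon> \<le> 1" "\<epsilon> * real q \<le> 1"
  shows "q \<le> liouville_factor X * K ^ X"
proof -
  define n where "n = degree p"
  have p0: "p \<noteq> 0" using p(1) by (auto simp: irreducible_def)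
  have tp: "tdeg_le X (const_y p)"
    unfolding tdeg_le_altdef xycoeff_const_y using p(4) by (auto intro!: coeff_eq_0)
  have "cmod (xyeval (const_y p) x 0) \<le> real ((X + 1) ^ 4 * X * 2 ^ X * (X + 1) ^ X) * \<epsilon> ^ 1"
  proof (rule xyeval_near_zero_bound[where s = "(\<alpha>, 0)"])
    show "int_coeffs X (const_y p)"
      unfolding int_coeffs_def xycoeff_const_y using p(3)
      by (metis abs_zero of_int_0 of_nat_0_le_iff)
    show "vanish_order 1 (\<alpha>, 0) (const_y p)"
      unfolding vanish_order_1 xyeval_const_y using p(2) by simp
    show "cmod (fst (\<alpha>, 0)) \<le> real (X + 1)" using root_bound[OF p0 p(2,3)] by simp
  qed (use tp \<epsilon> in auto)
  then have up: "cmod (poly (map_poly of_int p) x) \<le> real (liouville_factor X) * \<epsilon>"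
    by (simp add: xyeval_const_y liouville_factor_def)
  have nz: "poly (map_poly of_int p) x \<noteq> 0"
    using rational_root_irreducible[OF p(1,2) _ x(1,2)] x(3) by blast
  obtain t :: int where t: "of_int l * x = of_int t" using l(3) by (rule Ints_cases)
  have "of_int l ^ n * poly (map_poly of_int p) x = (\<Sum>i\<le>n. of_int (coeff p i * t ^ i * l ^ (n - i)))"
  proof -
    have e1: "poly (map_poly of_int p) x = (\<Sum>i\<le>n. of_int (coeff p i) * x ^ i)"
      by (simp add: poly_altdef n_def coeff_map_poly degree_map_poly)
    have e2: "of_int l ^ n * (of_int (coeff p i) * x ^ i) = of_int (coeff p i * t ^ i * l ^ (n - i))"
      if "i \<le> n" for i
    proof -
      have "(of_int l :: complex) ^ n = of_int l ^ (n - i) * of_int l ^ i"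
        using that by (simp flip: power_add)
      then have "of_int l ^ n * (of_int (coeff p i) * x ^ i) =
          of_int (coeff p i) * (of_int l * x) ^ i * of_int l ^ (n - i)"
        by (simp add: power_mult_distrib)
      then show ?thesis by (simp add: t)
    qed
    show ?thesis unfolding e1 sum_distrib_left by (rule sum.cong[OF refl]) (rule e2, simp)
  qed
  then have "of_int l ^ n * poly (map_poly of_int p) x = of_int (\<Sum>i\<le>n. coeff p i * t ^ i * l ^ (n - i))"
    by simp
  moreover have "of_int l ^ n * poly (map_poly of_int p) x \<noteq> 0" using nz l(1) by simp
  ultimately obtain w :: int where w: "of_int l ^ n * poly (map_poly of_int p) x = of_int w" "w \<noteq> 0"
    by (metis of_int_0)
  then have "1 \<le> \<bar>real_of_int w\<bar>" by linarith
  also have "\<dots> = cmod (of_int l ^ n * poly (map_poly of_int p) x)" unfolding w(1) by simp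
  also have "\<dots> = \<bar>real_of_int l\<bar> ^ n * cmod (poly (map_poly of_int p) x)"
    by (simp add: norm_mult norm_power)
  also have "\<dots> \<le> real K ^ X * (real (liouville_factor X) * \<epsilon>)"
  proof (intro mult_mono up)
    have l1: "1 \<le> real K" using l(1,2) by linarith
    have "\<bar>real_of_int l\<bar> ^ n \<le> real K ^ n" using l(2) by (intro power_mono) linarith+
    also have "\<dots> \<le> real K ^ X" using l1 p(4) by (intro power_increasing) (auto simp: n_def)
    finally show "\<bar>real_of_int l\<bar> ^ n \<le> real K ^ X" .
  qed auto
  finally have "1 * real q \<le> real K ^ X * (real (liouville_factor X) * \<epsilon>) * real q"
    by (rule mult_right_mono) simp
  also have "\<dots> = real (liouville_factor X * K ^ X) * (\<epsilon> * real q)" by simp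
  also have "\<dots> \<le> real (liouville_factor X * K ^ X) * 1" using \<epsilon>(4) by (intro mult_left_mono) auto
  finally show ?thesis by (metis mult_1 mult.right_neutral of_nat_le_iff)
qed

definition denominator_bound :: "nat \<Rightarrow> nat" where
  "denominator_bound X = threshold X + liouville_factor X * elim_height X ^ X + X ^ 2"

lemma recursive_denominator_bound:
  "recursive k h \<Longrightarrow> recursive k (\<lambda>xs. denominator_bound (h xs))"
  unfolding denominator_bound_def threshold_def liouville_factor_def elim_height_def elim_size_def aux_error_def aux_height_def aux_size_def
    jet_error_def jet_height_def base_size_def jet_bound_def jet_size_def kernel_bound_def
  by (intro recursive_intros)

section \<open>The effective bound\<close>

lemma abs_le_int_encode: "\<bar>z\<bar> \<le> int (int_encode z)"
  by (simp add: int_encode_def sum_encode_def)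

lemma list_encode_bounds:
  "length xs \<le> list_encode xs" "x \<in> set xs \<Longrightarrow> x \<le> list_encode xs"
proof -
  have "length xs \<le> list_encode xs \<and> (\<forall>x\<in>set xs. x \<le> list_encode xs)"
  proof (induction xs)
    case (Cons y ys)
    have "y \<le> prod_encode (y, list_encode ys)" "list_encode ys \<le> prod_encode (y, list_encode ys)"
      by (rule le_prod_encode_1, rule le_prod_encode_2)
    with Cons show ?case by auto
  qed simp
  then show "length xs \<le> list_encode xs" "x \<in> set xs \<Longrightarrow> x \<le> list_encode xs" by blast+
qed

lemma int_poly_encode_bounds:
  assumes "p \<noteq> 0"
  shows "degree p \<le> int_poly_encode p" "\<bar>coeff p i\<bar> \<le> int (int_poly_encode p)"
proof -
  have "length (coeffs p) \<le> int_poly_encode p"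
    using list_encode_bounds(1)[of "map int_encode (coeffs p)"] by (simp add: int_poly_encode_def)
  then show "degree p \<le> int_poly_encode p" using assms by (simp add: length_coeffs_degree)
  show "\<bar>coeff p i\<bar> \<le> int (int_poly_encode p)"
  proof (cases "coeff p i = 0")
    case False
    then have "i \<le> degree p" by (rule le_degree)
    then have "coeff p i \<in> set (coeffs p)"
      by (metis assms coeffs_nth length_coeffs_degree less_Suc_eq_le nth_mem)
    then have "int_encode (coeff p i) \<le> int_poly_encode p"
      unfolding int_poly_encode_def by (intro list_encode_bounds(2)) simp
    then have "int (int_encode (coeff p i)) \<le> int (int_poly_encode p)" by (rule of_nat_mono)
    with abs_le_int_encode show ?thesis by (rule order_trans)
  qed simp
qed

text \<open>
  The choice is unique by \<open>irreducible_int_poly_unique\<close> whenever such a polynomial exists.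
\<close>
definition min_int_poly :: "complex \<Rightarrow> int poly" where
  "min_int_poly \<alpha> = (SOME p. irreducible p \<and> lead_coeff p > 0 \<and> poly (map_poly of_int p) \<alpha> = 0)"

text \<open>
  The first component of a code is the code of the minimal polynomial. So a function of this component
  depends on \<open>\<alpha>\<close> alone.
\<close>
lemma algebraic_code_imp:
  assumes "algebraic_code c \<alpha>"
  shows "fst (prod_decode c) = int_poly_encode (min_int_poly \<alpha>)"
    "irreducible (min_int_poly \<alpha>)" "lead_coeff (min_int_poly \<alpha>) > 0"
    "poly (map_poly of_int (min_int_poly \<alpha>)) \<alpha> = 0"
proof -
  obtain p :: "int poly" and a b r :: rat where
    c: "c = prod_encode (int_poly_encode p, prod_encode (rat_encode a, prod_encode (rat_encode b, rat_encode r)))"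
    and p: "irreducible p" "lead_coeff p > 0"
    and iso: "{z. poly (map_poly of_int p) z = 0} \<inter> ball (Complex (of_rat a) (of_rat b)) (of_rat r) = {\<alpha>}"
    using assms unfolding algebraic_code_def by blast
  have root: "poly (map_poly of_int p) \<alpha> = 0" using iso by blast
  have ex: "irreducible (min_int_poly \<alpha>) \<and> lead_coeff (min_int_poly \<alpha>) > 0 \<and>
      poly (map_poly of_int (min_int_poly \<alpha>)) \<alpha> = 0"
    unfolding min_int_poly_def by (rule someI[of _ p]) (use p root in blast)
  then have "min_int_poly \<alpha> = p" using irreducible_int_poly_unique p root by blast
  then show "fst (prod_decode c) = int_poly_encode (min_int_poly \<alpha>)" unfolding c by simp
  show "irreducible (min_int_poly \<alpha>)" "lead_coeff (min_int_poly \<alpha>) > 0"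
    "poly (map_poly of_int (min_int_poly \<alpha>)) \<alpha> = 0" using ex by auto
qed

lemma card_poly_roots_le:
  fixes p :: "int poly"
  assumes "p \<noteq> 0"
  shows "finite {z :: complex. poly (map_poly of_int p) z = 0}"
    "card {z :: complex. poly (map_poly of_int p) z = 0} \<le> degree p"
proof -
  have nz: "map_poly of_int p \<noteq> (0 :: complex poly)" using assms by (subst map_poly_eq_0_iff) auto
  show "finite {z :: complex. poly (map_poly of_int p) z = 0}" using nz by (rule poly_roots_finite)
  have "card {z :: complex. poly (map_poly of_int p) z = 0} \<le> degree (map_poly of_int p :: complex poly)"
    using nz by (rule card_poly_roots_bound)
  then show "card {z :: complex. poly (map_poly of_int p) z = 0} \<le> degree p" by (simp add: degree_map_poly)
qed

text \<open>
  There are three cases: \<open>q\<close> lies below the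
  threshold of \<open>small_integer_relations\<close>; or a coordinate of \<open>\<xi>\<close> differs from that of \<open>\<alpha>\<close> and
  \<open>liouville\<close> applies; or \<open>\<xi> = \<alpha>\<close>, and then \<open>q\<close> divides the product \<open>A\<close> of the leading coefficients,
  because \<open>A \<alpha>1\<close> and \<open>A \<alpha>2\<close> are integers and the fractions are in lowest terms.
\<close>
lemma denominator_le:
  fixes p1 p2 :: "int poly" and \<alpha>1 \<alpha>2 :: complex and a b m q :: nat and u1 u2 :: int
  assumes p1: "irreducible p1" "poly (map_poly of_int p1) \<alpha>1 = 0" "lead_coeff p1 > 0"
    and p2: "irreducible p2" "poly (map_poly of_int p2) \<alpha>2 = 0" "lead_coeff p2 > 0"
    and alg: "algebraic \<alpha>1" "algebraic \<alpha>2"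
    and X: "\<And>i. \<bar>coeff p1 i\<bar> \<le> int X" "\<And>i. \<bar>coeff p2 i\<bar> \<le> int X" "degree p1 \<le> X" "degree p2 \<le> X"
      "m \<le> X" "a \<le> X" "b \<le> X"
    and C: "irreducible_plane_curve m C" "\<forall>(x, y) \<in> conjugate_points \<alpha>1 \<alpha>2. (x, y, 1) \<in> C"
    and \<delta>: "1 \<le> b" "b * m < a" "b * rat_adjoin_degree \<alpha>1 \<alpha>2 < a * m"
    and q: "0 < q" "\<alpha>1 = of_int u1 / of_nat q \<and> \<alpha>2 = of_int u2 / of_nat q \<longrightarrow> gcd (gcd u1 u2) (int q) = 1"
    and \<epsilon>: "0 \<le> \<epsilon>" "\<epsilon> \<le> 1" "\<epsilon> * real q \<le> 1" "\<epsilon> ^ b * real q ^ a = 1"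
    and near: "cmod (of_int u1 / of_nat q - \<alpha>1) \<le> \<epsilon>" "cmod (of_int u2 / of_nat q - \<alpha>2) \<le> \<epsilon>"
  shows "q \<le> denominator_bound X"
proof (cases "threshold X < q")
  case False
  then show ?thesis by (simp add: denominator_bound_def)
next
  case True
  define x1 x2 where "x1 = (of_int u1 / of_nat q :: complex)" and "x2 = (of_int u2 / of_nat q :: complex)"
  obtain S where S: "finite S" "(\<alpha>1, \<alpha>2) \<in> S" "S \<subseteq> conjugate_points \<alpha>1 \<alpha>2"
    "card S = rat_adjoin_degree \<alpha>1 \<alpha>2"
    "\<And>H s s'. (\<forall>i j. xycoeff H i j \<in> \<rat>) \<Longrightarrow> s \<in> S \<Longrightarrow> s' \<in> S \<Longrightarrow> xyeval H (fst s) (snd s) = 0 \<Longrightarrow>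
       xyeval H (fst s') (snd s') = 0"
    "\<And>k l. (\<Sum>s\<in>S. fst s ^ k * snd s ^ l) \<in> \<rat>"
    using conjugate_point_set[OF alg] by blast
  have p0: "p1 \<noteq> 0" "p2 \<noteq> 0" using p1(3) p2(3) by auto
  have roots1: "poly (map_poly of_int p1) (fst s) = 0" if "s \<in> S" for s
    using S(5)[of "const_y p1" "(\<alpha>1, \<alpha>2)" s] S(2) that p1(2) by (simp add: xyeval_const_y xycoeff_const_y)
  have roots2: "poly (map_poly of_int p2) (snd s) = 0" if "s \<in> S" for s
    using S(5)[of "swap_xy (const_y p2)" "(\<alpha>1, \<alpha>2)" s] S(2) that p2(2)
    by (simp add: xyeval_const_y xycoeff_const_y xyeval_swap_xy)
  obtain F where F: "irreducible F" "homogeneous3 m F"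
    "C = {(x, y, z). (x, y, z) \<noteq> (0, 0, 0) \<and> poly3_eval F x y z = 0}"
    using C(1) unfolding irreducible_plane_curve_def by blast
  have F0: "poly3_eval F (fst s) (snd s) 1 = 0" if "s \<in> S" for s
    using C(2) S(3) that unfolding F(3) by (cases s) auto
  define f where "f = poly F 1"
  note hf = irreducible_dehomogenize[OF F(1,2) F0[OF S(2)], folded f_def]
  obtain i0 j0 where ij: "i0 + j0 = m" "xycoeff f i0 j0 \<noteq> 0" using hf(3) by blast
  have fS: "xyeval f (fst s) (snd s) = 0" if "s \<in> S" for s
    using F0[OF that] by (simp add: poly3_eval_def xyeval_def f_def one_pCons)
  define A where "A = nat (lead_coeff p1 * lead_coeff p2)"
  have A_int: "int A = lead_coeff p1 * lead_coeff p2" using p1(3) p2(3) by (simp add: A_def)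
  have A1: "1 \<le> A"
  proof -
    have "0 < lead_coeff p1 * lead_coeff p2" using p1(3) p2(3) by (rule mult_pos_pos)
    then show ?thesis using A_int by linarith
  qed
  have A2: "A \<le> X ^ 2"
  proof -
    have "lead_coeff p1 \<le> int X" "lead_coeff p2 \<le> int X"
      using X(1)[of "degree p1"] X(2)[of "degree p2"] by linarith+
    then have "int A \<le> int X * int X" unfolding A_int using p1(3) p2(3) by (intro mult_mono) auto
    then have "int A \<le> int (X * X)" by simp
    then show ?thesis unfolding of_nat_le_iff by (simp add: power2_eq_square)
  qed
  have int_scale: "algebraic_int (of_nat A * fst s)" "algebraic_int (of_nat A * snd s)" if "s \<in> S" for s
  proof -
    have AA: "(of_nat A :: complex) = of_int (lead_coeff p1) * of_int (lead_coeff p2)"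
      by (metis A_int of_int_mult of_int_of_nat_eq)
    have ci: "algebraic_int (of_int k :: complex)" for k by (intro int_imp_algebraic_int) auto
    have eq1: "of_nat A * fst s = of_int (lead_coeff p2) * (of_int (lead_coeff p1) * fst s)"
      unfolding AA by (simp only: mult_ac)
    show "algebraic_int (of_nat A * fst s)"
      unfolding eq1
      by (rule algebraic_int_add_mult(2)[OF ci algebraic_int_lead_coeff_mult[OF p0(1) roots1[OF that]]])
    have eq2: "of_nat A * snd s = of_int (lead_coeff p1) * (of_int (lead_coeff p2) * snd s)"
      unfolding AA by (simp only: mult_ac)
    show "algebraic_int (of_nat A * snd s)"
      unfolding eq2
      by (rule algebraic_int_add_mult(2)[OF ci algebraic_int_lead_coeff_mult[OF p0(2) roots2[OF that]]])
  qed
  have tr: "of_nat A ^ (k + l) * (\<Sum>s\<in>S. fst s ^ k * snd s ^ l) \<in> \<int>" for k l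
  proof (rule rational_algebraic_int_complex)
    have eq: "of_nat A ^ (k + l) * (\<Sum>s\<in>S. fst s ^ k * snd s ^ l)
        = (\<Sum>s\<in>S. (of_nat A * fst s) ^ k * (of_nat A * snd s) ^ l)"
      unfolding sum_distrib_left by (intro sum.cong refl) (simp add: power_add power_mult_distrib mult_ac)
    show "algebraic_int (of_nat A ^ (k + l) * (\<Sum>s\<in>S. fst s ^ k * snd s ^ l))"
      unfolding eq
      by (intro algebraic_int_sum_complex algebraic_int_add_mult(2) algebraic_int_power_complex int_scale)
    show "of_nat A ^ (k + l) * (\<Sum>s\<in>S. fst s ^ k * snd s ^ l) \<in> \<rat>"
      by (intro Rats_mult Rats_power S(6) Rats_of_nat)
  qed
  have bd: "cmod (fst s) \<le> real (X + 1) \<and> cmod (snd s) \<le> real (X + 1)" if "s \<in> S" for s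
    using root_bound[OF p0(1) roots1[OF that] X(1)] root_bound[OF p0(2) roots2[OF that] X(2)] by blast
  have dX: "rat_adjoin_degree \<alpha>1 \<alpha>2 \<le> X ^ 2"
  proof -
    define E1 where "E1 = {z :: complex. poly (map_poly of_int p1) z = 0}"
    define E2 where "E2 = {z :: complex. poly (map_poly of_int p2) z = 0}"
    note r1 = card_poly_roots_le[OF p0(1), folded E1_def] and r2 = card_poly_roots_le[OF p0(2), folded E2_def]
    have "S \<subseteq> E1 \<times> E2" using roots1 roots2 by (auto simp: E1_def E2_def)
    then have "card S \<le> card E1 * card E2"
      using card_mono[of "E1 \<times> E2" S] r1(1) r2(1) by (simp add: card_cartesian_product)
    also have "\<dots> \<le> X * X" using r1(2) r2(2) X(3,4) by (intro mult_mono) auto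
    finally show ?thesis using S(4) by (simp add: power2_eq_square)
  qed
  have rel1: "\<exists>R. R \<noteq> 0 \<and> int_coeffs (elim_height X) R \<and> (\<forall>i j. 0 < j \<longrightarrow> xycoeff R i j = 0) \<and> xyeval R x1 x2 = 0"
    unfolding x1_def x2_def
  proof (rule small_integer_relations(1)[OF S(1,2) S(4) X(5-7) dX hf(4) \<delta>(1) A1 A2 tr _ _ hf(1,2) ij _
        \<delta>(2,3) \<epsilon>(1,2,4) _ _ True])
    show "cmod (of_int u1 / of_nat q - fst (\<alpha>1, \<alpha>2)) \<le> \<epsilon>" "cmod (of_int u2 / of_nat q - snd (\<alpha>1, \<alpha>2)) \<le> \<epsilon>"
      using near by simp_all
    fix s assume s: "s \<in> S"
    show "cmod (fst s) \<le> real (X + 1) \<and> cmod (snd s) \<le> real (X + 1)" using s by (rule bd)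
    show "xyeval f (fst s) (snd s) = 0" using s by (rule fS)
    fix H s' assume "\<forall>i j. xycoeff H i j \<in> \<rat>" "s' \<in> S" "xyeval H (fst s) (snd s) = 0"
    then show "xyeval H (fst s') (snd s') = 0" using S(5)[of H s s'] s by blast
  qed
  have rel2: "\<exists>R. R \<noteq> 0 \<and> int_coeffs (elim_height X) R \<and> (\<forall>i j. 0 < i \<longrightarrow> xycoeff R i j = 0) \<and> xyeval R x1 x2 = 0"
    unfolding x1_def x2_def
  proof (rule small_integer_relations(2)[OF S(1,2) S(4) X(5-7) dX hf(4) \<delta>(1) A1 A2 tr _ _ hf(1,2) ij _
        \<delta>(2,3) \<epsilon>(1,2,4) _ _ True])
    show "cmod (of_int u1 / of_nat q - fst (\<alpha>1, \<alpha>2)) \<le> \<epsilon>" "cmod (of_int u2 / of_nat q - snd (\<alpha>1, \<alpha>2)) \<le> \<epsilon>"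
      using near by simp_all
    fix s assume s: "s \<in> S"
    show "cmod (fst s) \<le> real (X + 1) \<and> cmod (snd s) \<le> real (X + 1)" using s by (rule bd)
    show "xyeval f (fst s) (snd s) = 0" using s by (rule fS)
    fix H s' assume "\<forall>i j. xycoeff H i j \<in> \<rat>" "s' \<in> S" "xyeval H (fst s) (snd s) = 0"
    then show "xyeval H (fst s') (snd s') = 0" using S(5)[of H s s'] s by blast
  qed
  have x_rat: "x1 \<in> \<rat>" "x2 \<in> \<rat>" by (auto simp: x1_def x2_def)
  obtain l1 :: int where l1: "l1 \<noteq> 0" "\<bar>l1\<bar> \<le> int (elim_height X)" "of_int l1 * x1 \<in> \<int>"
    using rel1 univariate_relation[OF _ _ _ _ x_rat(1)] by blast
  obtain R where R: "R \<noteq> 0" "int_coeffs (elim_height X) R" "\<forall>i j. 0 < i \<longrightarrow> xycoeff R i j = 0" "xyeval R x1 x2 = 0"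
    using rel2 by blast
  have R': "swap_xy R \<noteq> 0" "int_coeffs (elim_height X) (swap_xy R)" "\<forall>i j. 0 < j \<longrightarrow> xycoeff (swap_xy R) i j = 0"
    "xyeval (swap_xy R) x2 x1 = 0"
    using R by (auto simp: int_coeffs_swap_xy xyeval_swap_xy)
  obtain l2 :: int where l2: "l2 \<noteq> 0" "\<bar>l2\<bar> \<le> int (elim_height X)" "of_int l2 * x2 \<in> \<int>"
    using univariate_relation[OF R' x_rat(2)] by blast
  show ?thesis
  proof (cases "x1 = \<alpha>1 \<and> x2 = \<alpha>2")
    case False
    then have "q \<le> liouville_factor X * elim_height X ^ X"
    proof (cases "x1 = \<alpha>1")
      case True
      with False have "x2 \<noteq> \<alpha>2" by blast
      from liouville[OF p2(1,2) X(2,4) x2_def q(1) this l2 near(2)[folded x2_def] \<epsilon>(1-3)]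
      show ?thesis .
    next
      case False
      from liouville[OF p1(1,2) X(1,3) x1_def q(1) this l1 near(1)[folded x1_def] \<epsilon>(1-3)]
      show ?thesis .
    qed
    then show ?thesis by (simp add: denominator_bound_def)
  next
    case True
    then have eq: "\<alpha>1 = of_int u1 / of_nat q" "\<alpha>2 = of_int u2 / of_nat q" by (auto simp: x1_def x2_def)
    with q(2) have g: "gcd (gcd u1 u2) (int q) = 1" by blast
    have div: "int q dvd int A * u" if "algebraic_int (of_nat A * x)" "x = of_int u / of_nat q"
      for x :: complex and u :: int
    proof -
      have "of_nat A * x \<in> \<int>" using that by (intro rational_algebraic_int_complex) auto
      then obtain k :: int where "of_nat A * x = of_int k" by (rule Ints_cases)
      then have "(of_int (int A * u) :: complex) = of_int (k * int q)"
        using that(2) q(1) by (simp add: field_simps)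
      then have "int A * u = k * int q" by (simp only: of_int_eq_iff)
      then show ?thesis by simp
    qed
    have "int q dvd int A * u1" using int_scale(1)[OF S(2)] eq(1) by (intro div) auto
    moreover have "int q dvd int A * u2" using int_scale(2)[OF S(2)] eq(2) by (intro div) auto
    ultimately have "int q dvd gcd (gcd (int A * u1) (int A * u2)) (int A * int q)" by simp
    also have "\<dots> = int A * gcd (gcd u1 u2) (int q)"
      by (simp only: gcd_mult_left normalize_int_def abs_mult abs_of_nat gcd_abs1_int abs_gcd_int)
    also have "\<dots> = int A" using g by simp
    finally have "q dvd A" by simp
    then have "q \<le> A" using A1 by (intro dvd_imp_le) auto
    then show ?thesis using A2 by (simp add: denominator_bound_def)
  qed
qed

theorem theorem1:
  shows "\<exists>(f :: recf) (C0 :: complex \<Rightarrow> complex \<Rightarrow> rat \<Rightarrow> nat \<Rightarrow> nat).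
    \<forall>(\<alpha>1 :: complex) (\<alpha>2 :: complex) (d :: nat) (m :: nat) (\<delta> :: rat).
      algebraic \<alpha>1 \<longrightarrow> algebraic \<alpha>2 \<longrightarrow>
      d = rat_adjoin_degree \<alpha>1 \<alpha>2 \<longrightarrow>
      (\<exists>C. irreducible_plane_curve m C \<and>
           (\<forall>(x, y) \<in> conjugate_points \<alpha>1 \<alpha>2. (x, y, 1) \<in> C)) \<longrightarrow>
      \<delta> > max (of_nat m) (of_nat d / of_nat m) \<longrightarrow>
      computes_constant_at f C0 \<alpha>1 \<alpha>2 \<delta> m \<and>
      (\<forall>(p1 :: int) (p2 :: int) (q :: nat).
         q > 0 \<longrightarrow>
         (\<alpha>1 = of_int p1 / of_nat q \<and> \<alpha>2 = of_int p2 / of_nat q \<longrightarrow>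
            gcd (gcd p1 p2) (int q) = 1) \<longrightarrow>
         cmod (\<alpha>1 - of_int p1 / of_nat q) \<le> real q powr (- of_rat \<delta>) \<longrightarrow>
         cmod (\<alpha>2 - of_int p2 / of_nat q) \<le> real q powr (- of_rat \<delta>) \<longrightarrow>
         q \<le> C0 \<alpha>1 \<alpha>2 \<delta> m)"
proof -
  define B where "B xs = denominator_bound (fst (prod_decode (xs ! 0)) + fst (prod_decode (xs ! 1)) + xs ! 2 + xs ! 3)"
    for xs :: "nat list"
  have "recursive 4 B"
    unfolding B_def by (intro recursive_denominator_bound recursive_intros recursive_fst_prod_decode) auto
  then obtain f where f: "\<And>xs. length xs = 4 \<Longrightarrow> computes f xs (B xs)"
    unfolding recursive_def by blast
  define C0 where "C0 \<alpha>1 \<alpha>2 \<delta> m = denominator_bound (int_poly_encode (min_int_poly \<alpha>1) +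
      int_poly_encode (min_int_poly \<alpha>2) + rat_encode \<delta> + m)" for \<alpha>1 \<alpha>2 :: complex and \<delta> :: rat and m :: nat
  show ?thesis
  proof (intro exI[of _ f] exI[of _ C0] allI impI conjI)
    fix \<alpha>1 \<alpha>2 :: complex and d m :: nat and \<delta> :: rat
    assume alg: "algebraic \<alpha>1" "algebraic \<alpha>2" and d: "d = rat_adjoin_degree \<alpha>1 \<alpha>2"
      and C: "\<exists>C. irreducible_plane_curve m C \<and> (\<forall>(x, y) \<in> conjugate_points \<alpha>1 \<alpha>2. (x, y, 1) \<in> C)"
      and \<delta>: "\<delta> > max (of_nat m) (of_nat d / of_nat m)"
    show "computes_constant_at f C0 \<alpha>1 \<alpha>2 \<delta> m"
      unfolding computes_constant_at_def
    proof (intro allI impI)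
      fix c1 c2 assume "algebraic_code c1 \<alpha>1" "algebraic_code c2 \<alpha>2"
      then have "B [c1, c2, rat_encode \<delta>, m] = C0 \<alpha>1 \<alpha>2 \<delta> m"
        by (simp add: B_def C0_def algebraic_code_imp(1) numeral_2_eq_2 numeral_3_eq_3)
      then show "computes f [c1, c2, rat_encode \<delta>, m] (C0 \<alpha>1 \<alpha>2 \<delta> m)"
        using f[of "[c1, c2, rat_encode \<delta>, m]"] by simp
    qed
    fix u1 u2 :: int and q :: nat
    assume q: "0 < q" "\<alpha>1 = of_int u1 / of_nat q \<and> \<alpha>2 = of_int u2 / of_nat q \<longrightarrow> gcd (gcd u1 u2) (int q) = 1"
      and near: "cmod (\<alpha>1 - of_int u1 / of_nat q) \<le> real q powr (- of_rat \<delta>)"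
        "cmod (\<alpha>2 - of_int u2 / of_nat q) \<le> real q powr (- of_rat \<delta>)"
    obtain c1 c2 where c: "algebraic_code c1 \<alpha>1" "algebraic_code c2 \<alpha>2"
      using algebraic_code_exists alg by blast
    define p1 p2 where "p1 = min_int_poly \<alpha>1" and "p2 = min_int_poly \<alpha>2"
    note hp1 = algebraic_code_imp(2-4)[OF c(1), folded p1_def]
    note hp2 = algebraic_code_imp(2-4)[OF c(2), folded p2_def]
    have p0: "p1 \<noteq> 0" "p2 \<noteq> 0" using hp1 hp2 by auto
    obtain Cv where Cv: "irreducible_plane_curve m Cv" "\<forall>(x, y) \<in> conjugate_points \<alpha>1 \<alpha>2. (x, y, 1) \<in> Cv"
      using C by blast
    obtain a0 b0 where ab0: "quotient_of \<delta> = (a0, b0)" by force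
    have b0: "0 < b0" using quotient_of_denom_pos[OF ab0] .
    have \<delta>_eq: "\<delta> = of_int a0 / of_int b0" using quotient_of_div[OF ab0] .
    have \<delta>m: "of_nat m < \<delta>" and \<delta>d: "of_nat d / of_nat m < \<delta>" using \<delta> by auto
    have "0 < \<delta>" using \<delta>m by (meson le_less_trans of_nat_0_le_iff)
    then have a0: "0 < a0" using b0 unfolding \<delta>_eq by (simp add: zero_less_divide_iff)
    define a b where "a = nat a0" and "b = nat b0"
    have ab: "int a = a0" "int b = b0" "1 \<le> b" using a0 b0 by (auto simp: a_def b_def)
    have \<delta>ab: "\<delta> = of_nat a / of_nat b" unfolding \<delta>_eq ab(1,2)[symmetric] by simp
    define X where "X = int_poly_encode p1 + int_poly_encode p2 + rat_encode \<delta> + m"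
    have enc: "rat_encode \<delta> = prod_encode (int_encode a0, b)" by (simp add: rat_encode_def ab0 b_def)
    have bX: "b \<le> X" using le_prod_encode_2[of b "int_encode a0"] by (simp add: X_def enc)
    have aX: "a \<le> X"
    proof -
      have "a \<le> int_encode a0" using abs_le_int_encode[of a0] ab(1) by linarith
      also have "\<dots> \<le> rat_encode \<delta>" unfolding enc by (rule le_prod_encode_1)
      finally show ?thesis by (simp add: X_def)
    qed
    have coeffX: "\<bar>coeff p1 i\<bar> \<le> int X" "\<bar>coeff p2 i\<bar> \<le> int X" for i
      using int_poly_encode_bounds(2)[OF p0(1), of i] int_poly_encode_bounds(2)[OF p0(2), of i]
      by (simp_all add: X_def)
    have degX: "degree p1 \<le> X" "degree p2 \<le> X"
      using int_poly_encode_bounds(1)[OF p0(1)] int_poly_encode_bounds(1)[OF p0(2)] by (simp_all add: X_def)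
    have bm: "b * m < a"
    proof -
      have "(of_nat (b * m) :: rat) < of_nat a" using \<delta>m ab(3) unfolding \<delta>ab by (simp add: field_simps)
      then show ?thesis by (simp only: of_nat_less_iff)
    qed
    have m1: "1 \<le> m"
    proof -
      obtain F where F: "irreducible F" "homogeneous3 m F"
        "Cv = {(x, y, z). (x, y, z) \<noteq> (0, 0, 0) \<and> poly3_eval F x y z = 0}"
        using Cv(1) unfolding irreducible_plane_curve_def by blast
      have "(\<alpha>1, \<alpha>2) \<in> conjugate_points \<alpha>1 \<alpha>2"
        unfolding conjugate_points_def field_embedding_def by (intro CollectI exI[of _ "\<lambda>x. x"]) simp
      then have "poly3_eval F \<alpha>1 \<alpha>2 1 = 0" using Cv(2) unfolding F(3) by auto
      from irreducible_dehomogenize(4)[OF F(1,2) this] show ?thesis .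
    qed
    have bd: "b * d < a * m"
    proof -
      have "(of_nat (b * d) :: rat) < of_nat (a * m)"
        using \<delta>d ab(3) m1 unfolding \<delta>ab by (simp add: field_simps)
      then show ?thesis by (simp only: of_nat_less_iff)
    qed
    define \<epsilon> where "\<epsilon> = real q powr (- of_rat \<delta>)"
    have \<delta>r: "(of_rat \<delta> :: real) = real a / real b" unfolding \<delta>ab by (simp add: of_rat_divide)
    have q1: "1 \<le> real q" using q(1) by simp
    have ba: "real b \<le> real a" using bm m1 by (metis le_trans less_imp_le_nat mult.right_neutral mult_le_mono2 of_nat_le_iff)
    have \<delta>1: "1 \<le> (of_rat \<delta> :: real)" unfolding \<delta>r using ba ab(3) by simp
    have \<epsilon>: "0 \<le> \<epsilon>" by (simp add: \<epsilon>_def)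
    have "\<epsilon> \<le> real q powr (- 1)" unfolding \<epsilon>_def using q1 \<delta>1 by (intro powr_mono) auto
    also have "\<dots> = 1 / real q" using q1 by (simp add: powr_minus_divide)
    finally have \<epsilon>q: "\<epsilon> \<le> 1 / real q" .
    then have \<epsilon>q': "\<epsilon> * real q \<le> 1" using q1 by (simp add: field_simps)
    have \<epsilon>1: "\<epsilon> \<le> 1" using \<epsilon>q q1 by (smt (verit) divide_le_eq_1)
    have "0 < \<epsilon>" unfolding \<epsilon>_def using q1 by simp
    then have "\<epsilon> ^ b = \<epsilon> powr real b" by (simp add: powr_realpow)
    also have "\<dots> = real q powr (- of_rat \<delta> * real b)" by (simp only: \<epsilon>_def powr_powr)
    also have "- of_rat \<delta> * real b = - real a" unfolding \<delta>r using ab(3) by simp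
    also have "real q powr (- real a) = 1 / real q ^ a" using q1 by (simp add: powr_minus_divide powr_realpow)
    finally have \<epsilon>b: "\<epsilon> ^ b * real q ^ a = 1" using q1 by simp
    have "q \<le> denominator_bound X"
      by (rule denominator_le[OF hp1(1,3,2) hp2(1,3,2) alg coeffX degX _ aX bX Cv ab(3) bm bd[unfolded d] q
          \<epsilon> \<epsilon>1 \<epsilon>q' \<epsilon>b]) (use near in \<open>simp_all add: X_def \<epsilon>_def norm_minus_commute\<close>)
    then show "q \<le> C0 \<alpha>1 \<alpha>2 \<delta> m" by (simp add: C0_def X_def p1_def p2_def)
  qed
qed

end
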